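(* Let $d\ge 2$ and consider the annealed Ising model on the random $d$-regular (multi)graph with $n$ vertices. For all $(\beta,B)\in\mathcal{U}$, the total spin satisfies a central limit theorem under the annealed measure: as $n\to\infty$, $$\frac{S_n-\mathbb{E}_{\mu_n}(S_n)}{\sqrt n}\ \longrightarrow\ \mathcal{N}(0,\chi(\beta,B))\quad\text{in distribution with respect to }\mu_n,$$ where $\chi(\beta,B)=\lim_{n\to\infty}\operatorname{Var}_{\mu_n}(S_n/\sqrt n)=\frac{\partial^2}{\partial B^2}\psi(\beta,B)$ and $\mathcal{N}(0,\chi)$ denotes a centered Gaussian random variable with variance $\chi$.
   Context: Random $d$-regular graph $G_{n,d}$ (configuration model): attach $d$ half-edges to each of the vertices $v_1,\dots,v_n$ and pair all half-edges by a uniformly random perfect matching, each pair forming an edge; self-loops and multiple edges are allowed. The total number of half-edges is assumed even (if $dn$ is odd, the degree of one vertex is increased by $1$). Ising model: let $k_{i,j}$ be the number of edges between $v_i$ and $v_j$ (for $i=j$, the number of self-loops at $v_i$), $\beta\ge 0$, $B\in\mathbb{R}$, $\Omega_n=\{-1,1\}^n$. For $\sigma\in\Omega_n$ put $$H(\sigma)=-\beta\sum_{i\le j}k_{i,j}\sigma_i\sigma_j-B\sum_{i=1}^n\sigma_i,\qquad Z_n(\beta,B)=\sum_{\sigma\in\Omega_n}e^{-H(\sigma)}.$$ With $\mathbb{E}$ the expectation over the random graph, the annealed measure on $\Omega_n$ is $\mu_n(\sigma)=\mathbb{E}(e^{-H(\sigma)})/\mathbb{E}(Z_n(\beta,B))$;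 $S_n=\sigma_1+\dots+\sigma_n$. The limiting annealed pressure $\psi(\beta,B)=\lim_n\frac1n\log\mathbb{E}(Z_n(\beta,B))$ is $$\psi(\beta,B)=\frac{\beta d}{2}-B+\max_{0\le t\le 1}\Big[(t-1)\log(1-t)-t\log t+2Bt+dF(t)\Big],$$ with $F(t)=\int_0^{\min\{t,1-t\}}\log f(s)\,ds$, $f(s)=\frac{e^{-2\beta}(1-2s)+\sqrt{1+(e^{-4\beta}-1)(1-2s)^2}}{2(1-s)}$, and $0\log 0=0$. With $\mathcal{M}(\beta,B)=\lim_n\mathbb{E}_{\mu_n}(S_n/n)$ (when it exists), the critical inverse temperature is $\beta_c=\inf\{\beta>0:\lim_{B\searrow 0}\mathcal{M}(\beta,B)>0\}$, which equals $\operatorname{atanh}(1/(d-1))$ (so $\frac12\log\frac{d}{d-2}$ if $d\ge3$ and $\infty$ if $d=2$), and $\mathcal{U}=\{(\beta,B):\ \beta\ge 0,\ B\ne 0,\ \text{ or }\ 0<\beta<\beta_c,\ B=0\}$. *)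

theory Defs
  imports "HOL-Probability.Probability"
begin

text \<open>The vertices are \<open>1, \<dots>, n\<close>. If \<open>d * n\<close> is odd, the vertex whose degree is increased
  is taken to be the last one.\<close>

definition vertex_degree :: "nat \<Rightarrow> nat \<Rightarrow> nat \<Rightarrow> nat" where
  "vertex_degree d n i = (if odd (d * n) \<and> i = n then d + 1 else d)"

definition half_edges :: "nat \<Rightarrow> nat \<Rightarrow> (nat \<times> nat) set" where
  "half_edges d n = (SIGMA i:{1..n}. {..<vertex_degree d n i})"

definition perfect_matchings :: "'a set \<Rightarrow> 'a set set set" where
  "perfect_matchings A = {M. partition_on A M \<and> (\<forall>e\<in>M. card e = 2)}"

definition config_model :: "nat \<Rightarrow> nat \<Rightarrow> (nat \<times> nat) set set pmf" where
  "config_model d n = pmf_of_set (perfect_matchings (half_edges d n))"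

text \<open>For \<open>i = j\<close> the condition reads \<open>fst ` e = {i}\<close>, so each self-loop is counted once.\<close>

definition edge_mult :: "(nat \<times> nat) set set \<Rightarrow> nat \<Rightarrow> nat \<Rightarrow> nat" where
  "edge_mult M i j = card {e \<in> M. fst ` e = {i, j}}"

definition spin_configs :: "nat \<Rightarrow> (nat \<Rightarrow> real) set" where
  "spin_configs n = {1..n} \<rightarrow>\<^sub>E {-1, 1}"

definition total_spin :: "nat \<Rightarrow> (nat \<Rightarrow> real) \<Rightarrow> real" where
  "total_spin n \<sigma> = (\<Sum>i = 1..n. \<sigma> i)"

definition hamiltonian ::
  "real \<Rightarrow> real \<Rightarrow> nat \<Rightarrow> (nat \<times> nat) set set \<Rightarrow> (nat \<Rightarrow> real) \<Rightarrow> real" where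
  "hamiltonian \<beta> B n M \<sigma> =
     - \<beta> * (\<Sum>i = 1..n. \<Sum>j = i..n. real (edge_mult M i j) * \<sigma> i * \<sigma> j)
     - B * (\<Sum>i = 1..n. \<sigma> i)"

definition partition_function ::
  "real \<Rightarrow> real \<Rightarrow> nat \<Rightarrow> (nat \<times> nat) set set \<Rightarrow> real" where
  "partition_function \<beta> B n M = (\<Sum>\<sigma>\<in>spin_configs n. exp (- hamiltonian \<beta> B n M \<sigma>))"

definition annealed_prob :: "nat \<Rightarrow> real \<Rightarrow> real \<Rightarrow> nat \<Rightarrow> (nat \<Rightarrow> real) \<Rightarrow> real" where
  "annealed_prob d \<beta> B n \<sigma> =
     measure_pmf.expectation (config_model d n) (\<lambda>M. exp (- hamiltonian \<beta> B n M \<sigma>)) /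
     measure_pmf.expectation (config_model d n) (partition_function \<beta> B n)"

definition annealed_measure :: "nat \<Rightarrow> real \<Rightarrow> real \<Rightarrow> nat \<Rightarrow> (nat \<Rightarrow> real) measure" where
  "annealed_measure d \<beta> B n =
     point_measure (spin_configs n) (\<lambda>\<sigma>. ennreal (annealed_prob d \<beta> B n \<sigma>))"

definition pressure :: "nat \<Rightarrow> real \<Rightarrow> real \<Rightarrow> real" where
  "pressure d \<beta> B =
     lim (\<lambda>n. ln (measure_pmf.expectation (config_model d n) (partition_function \<beta> B n)) / real n)"

definition mean_spin :: "nat \<Rightarrow> real \<Rightarrow> real \<Rightarrow> nat \<Rightarrow> real" where
  "mean_spin d \<beta> B n =
     prob_space.expectation (annealed_measure d \<beta> B n) (\<lambda>\<sigma>. total_spin n \<sigma> / real n)"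

definition magnetization :: "nat \<Rightarrow> real \<Rightarrow> real \<Rightarrow> real" where
  "magnetization d \<beta> B = lim (mean_spin d \<beta> B)"

text \<open>The infimum is taken in the extended reals, so that it is \<open>\<infinity>\<close> for the empty set,
  which occurs for \<open>d = 2\<close>. The convergence requirement excludes unspecified values
  of \<open>lim\<close>.\<close>

definition critical_beta :: "nat \<Rightarrow> ereal" where
  "critical_beta d =
     Inf (ereal ` {\<beta>. \<beta> > 0 \<and>
       (\<forall>\<^sub>F B in at_right 0. convergent (mean_spin d \<beta> B)) \<and>
       (\<exists>m>0. (magnetization d \<beta> \<longlongrightarrow> m) (at_right 0))})"

definition uniqueness_region :: "nat \<Rightarrow> (real \<times> real) set" where
  "uniqueness_region d =
     {(\<beta>, B). (\<beta> \<ge> 0 \<and> B \<noteq> 0) \<or> (0 < \<beta> \<and> ereal \<beta> < critical_beta d \<and> B = 0)}"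

definition has_second_derivative :: "(real \<Rightarrow> real) \<Rightarrow> real \<Rightarrow> real \<Rightarrow> bool" where
  "has_second_derivative f D x \<longleftrightarrow>
     (\<forall>\<^sub>F y in nhds x. f differentiable (at y)) \<and> (deriv f has_real_derivative D) (at x)"

text \<open>The second argument of \<open>normal_density\<close> is the standard deviation, and
  \<open>normal_density 0 0\<close> vanishes identically, so variance zero is treated separately.\<close>

definition centered_gaussian :: "real \<Rightarrow> real measure" where
  "centered_gaussian v =
     (if v = 0 then return borel 0 else density lborel (normal_density 0 (sqrt v)))"

end

theory Submission
  imports Defs "HOL-Real_Asymp.Real_Asymp"
begin

text \<open>
  For \<open>\<beta> \<ge> 0\<close> an edge with end spins \<open>s\<close>, \<open>s'\<close> contributes the factor
  \<open>exp (\<beta> s s') = cosh \<beta> (1 + tanh \<beta> s s')\<close>, which is \<open>cosh \<beta>\<close> times the inner product of the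
  vectors \<open>(1, r s)\<close> and \<open>(1, r s')\<close>, where \<open>r = sqrt (tanh \<beta>)\<close>. A sum over perfect matchings of
  products of inner products is, as in Wick's formula, a Gaussian moment of a product of linear
  forms. Its radial part depends only on the number of vectors, so what remains is the integral
  over a half circle of the product of the forms \<open>cos \<theta> + r s sin \<theta>\<close>
  (\<open>sum_perfect_matchings_wick\<close>). Under this integral the spins are independent, and the sum over
  the configurations can be taken vertex by vertex: the exponential moments of the total spin are
  quotients of integrals of \<open>q(\<theta>)^n\<close>, up to a correction at the last vertex, with
  \<open>q(\<theta>) = exp B (cos \<theta> + r sin \<theta>)^d + exp (-B) (cos \<theta> - r sin \<theta>)^d\<close>
  (\<open>annealed_exponential_moment\<close>).

  Laplace's method applies to these integrals once the maximum of \<open>\<bar>q\<bar>\<close> is known. Every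
  maximiser has the form \<open>tan \<theta> = r tanh w\<close> with \<open>B = w - (d - 1) artanh (tanh \<beta> tanh w)\<close>. If
  \<open>(d - 1) tanh \<beta> < 1\<close> the right-hand side is increasing in \<open>w\<close>; if \<open>B \<noteq> 0\<close> then \<open>w\<close> has the
  sign of \<open>B\<close>, and the right-hand side is odd, and convex for \<open>w > 0\<close>. In both cases exactly one \<open>w\<close>
  remains, at which \<open>B\<close> has positive slope, and this slope is minus the second derivative of
  \<open>log q\<close> divided by \<open>d\<close>; so the maximum is unique and nondegenerate
  (\<open>envelope_unique_max\<close>, \<open>second_order_centered_weight\<close>).

  With \<open>m\<close> the mean spin at the maximum, the moment \<open>E exp (z (S\<^sub>n - n m) / sqrt n)\<close> is a quotient of
  two such integrals, one of them with \<open>B\<close> replaced by \<open>B + z / sqrt n\<close>. Rescaling \<open>\<theta>\<close> by \<open>sqrt n\<close>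
  around the maximum gives the limit \<open>exp (\<chi> z^2 / 2)\<close> for every complex \<open>z\<close>
  (\<open>laplace_limit\<close>, \<open>fluctuation_limit\<close>). Imaginary \<open>z\<close> yields the central limit theorem by
  Levy's continuity theorem, and small real and imaginary \<open>z\<close> squeeze the first two moments
  (\<open>moments_from_exponential_moments\<close>).

  The size of the same integral gives the pressure as an explicit function of \<open>w\<close>. Its derivative
  in \<open>B\<close> is \<open>m\<close>, so its second derivative is \<open>m'(w) / B'(w)\<close>, which equals \<open>\<chi>\<close>
  (\<open>pressure_second_derivative\<close>). It remains to see that at \<open>B = 0\<close> the uniqueness region only
  contains \<open>\<beta>\<close> with \<open>(d - 1) tanh \<beta> < 1\<close>: if \<open>(d - 1) tanh \<beta> > 1\<close>, then \<open>B\<close> is negative for small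
  positive \<open>w\<close>, hence \<open>w\<close> stays away from \<open>0\<close> as \<open>B\<close> decreases to \<open>0\<close>, and the limiting
  magnetization is positive (\<open>spontaneous_magnetization\<close>, \<open>subcritical_beta\<close>).
\<close>

section \<open>A Wick formula on the half circle\<close>

text \<open>
  A product of an even number of linear forms in \<open>cos \<theta>\<close> and \<open>sin \<theta>\<close> has period \<open>\<pi>\<close>, so half a
  turn carries all the information.
\<close>

definition half_circle :: "(real \<Rightarrow> 'a::euclidean_space) \<Rightarrow> 'a" where
  "half_circle f = (LINT \<theta>:{-(pi/2)..pi/2}|lborel. f \<theta>)"

lemma perfect_matchings_empty: "perfect_matchings {} = {{}}"
  by (auto simp: perfect_matchings_def partition_on_def)

lemma partition_on_insert_block:
  assumes "partition_on (A - e) M" "e \<subseteq> A" "e \<noteq> {}"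
  shows "partition_on A (insert e M)"
proof -
  have M: "\<Union>M = A - e" "disjoint M" "{} \<notin> M"
    using assms(1) by (auto simp: partition_on_def)
  then have "e \<inter> f = {}" if "f \<in> M" for f
    using that by auto
  then have "disjoint (insert e M)"
    using M(2) by (auto simp: disjoint_def)
  moreover have "\<Union>(insert e M) = A"
    using M(1) assms(2) by auto
  ultimately show ?thesis
    using M(3) assms(3) by (simp add: partition_on_def)
qed

lemma partition_on_remove_block:
  assumes "partition_on A M" "e \<in> M"
  shows "partition_on (A - e) (M - {e})"
proof -
  have M: "\<Union>M = A" "disjoint M" "{} \<notin> M"
    using assms(1) by (auto simp: partition_on_def)
  then have "e \<inter> f = {}" if "f \<in> M - {e}" for f
    using that assms(2) by (auto simp: disjoint_def)
  then have "\<Union>(M - {e}) = A - e"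
    using M(1) assms(2) by auto
  moreover have "disjoint (M - {e})"
    using M(2) by (auto simp: disjoint_def)
  ultimately show ?thesis
    using M(3) by (simp add: partition_on_def)
qed

lemma finite_perfect_matchings:
  assumes "finite A" shows "finite (perfect_matchings A)"
proof (rule finite_subset)
  show "perfect_matchings A \<subseteq> Pow (Pow A)"
    by (auto simp: perfect_matchings_def partition_on_def)
qed (use assms in auto)

text \<open>
  A perfect matching is determined by the partner of one fixed point and a perfect matching of
  what is left; this is the recursion behind Wick's formula.
\<close>

lemma perfect_matchings_remove_point:
  assumes "x \<in> A"
  shows "perfect_matchings A =
    (\<Union>y\<in>A - {x}. insert {x, y} ` perfect_matchings (A - {x, y}))" (is "?L = ?R")
proof (intro equalityI subsetI)
  fix M assume M: "M \<in> ?L"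
  then obtain e where e: "e \<in> M" "x \<in> e"
    using assms unfolding perfect_matchings_def partition_on_def by blast
  from M e have "card e = 2" by (auto simp: perfect_matchings_def)
  then obtain y where y: "e = {x, y}" "y \<noteq> x"
    using e(2) by (auto simp: card_2_iff)
  have "e \<subseteq> A" using M e by (auto simp: perfect_matchings_def partition_on_def)
  moreover have "M - {e} \<in> perfect_matchings (A - e)"
    using M e partition_on_remove_block[of A M e] by (auto simp: perfect_matchings_def)
  moreover have "M = insert e (M - {e})" using e by auto
  ultimately show "M \<in> ?R" using y by blast
next
  fix M assume "M \<in> ?R"
  then obtain y M' where y: "y \<in> A" "y \<noteq> x" "M = insert {x,y} M'"
    "M' \<in> perfect_matchings (A - {x,y})" by auto
  then show "M \<in> ?L"
    using partition_on_insert_block[of A "{x,y}" M'] assms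
    by (auto simp: perfect_matchings_def card_insert_if)
qed

lemma sum_perfect_matchings_remove_point:
  fixes K :: "'a set \<Rightarrow> real"
  assumes "finite A" "x \<in> A"
  shows "(\<Sum>M\<in>perfect_matchings A. \<Prod>e\<in>M. K e) =
    (\<Sum>y\<in>A - {x}. K {x, y} * (\<Sum>M\<in>perfect_matchings (A - {x, y}). \<Prod>e\<in>M. K e))"
proof -
  have new: "{x, y} \<notin> M" if "M \<in> perfect_matchings (A - {x, y})" for y M
    using that by (auto simp: perfect_matchings_def partition_on_def)
  have "(\<Sum>M\<in>perfect_matchings A. \<Prod>e\<in>M. K e) =
     (\<Sum>y\<in>A - {x}. \<Sum>M\<in>insert {x, y} ` perfect_matchings (A - {x, y}). \<Prod>e\<in>M. K e)"
    unfolding perfect_matchings_remove_point[OF assms(2)]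
  proof (rule sum.UNION_disjoint)
    show "\<forall>y\<in>A - {x}. \<forall>z\<in>A - {x}. y \<noteq> z \<longrightarrow>
        insert {x, y} ` perfect_matchings (A - {x, y}) \<inter> insert {x, z} ` perfect_matchings (A - {x, z}) = {}"
    proof (intro ballI impI, rule ccontr)
      fix y z assume yz: "y \<in> A - {x}" "z \<in> A - {x}" "y \<noteq> z"
        and "insert {x, y} ` perfect_matchings (A - {x, y}) \<inter> insert {x, z} ` perfect_matchings (A - {x, z}) \<noteq> {}"
      then obtain M1 M2 where M: "M1 \<in> perfect_matchings (A - {x, y})" "M2 \<in> perfect_matchings (A - {x, z})"
        "insert {x,y} M1 = insert {x,z} M2" by auto
      then have "{x,y} \<in> M2" using yz by (auto simp: doubleton_eq_iff)
      then show False using M(2) by (auto simp: perfect_matchings_def partition_on_def)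
    qed
  qed (use assms finite_perfect_matchings in auto)
  also have "\<dots> = (\<Sum>y\<in>A - {x}. K {x, y} * (\<Sum>M\<in>perfect_matchings (A - {x, y}). \<Prod>e\<in>M. K e))"
  proof (rule sum.cong[OF refl])
    fix y assume "y \<in> A - {x}"
    have inj: "inj_on (insert {x, y}) (perfect_matchings (A - {x, y}))"
      using new by (intro inj_onI) (metis insert_ident)
    have fin: "finite M" if "M \<in> perfect_matchings (A - {x, y})" for M
      using that assms(1) by (auto simp: perfect_matchings_def partition_on_def intro: finite_UnionD)
    show "(\<Sum>M\<in>insert {x, y} ` perfect_matchings (A - {x, y}). \<Prod>e\<in>M. K e) =
       K {x, y} * (\<Sum>M\<in>perfect_matchings (A - {x, y}). \<Prod>e\<in>M. K e)"
      unfolding sum.reindex[OF inj] sum_distrib_left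
      by (rule sum.cong[OF refl]) (use new fin in simp)
  qed
  finally show ?thesis .
qed

definition half_edge_form :: "real \<Rightarrow> real \<Rightarrow> real \<Rightarrow> real" where
  "half_edge_form r s \<theta> = cos \<theta> + r * s * sin \<theta>"

lemma half_circle_FTC:
  fixes F f :: "real \<Rightarrow> real"
  assumes "\<And>x. (F has_real_derivative f x) (at x)" "continuous_on UNIV f"
  shows "half_circle f = F (pi/2) - F (-(pi/2))"
  unfolding half_circle_def set_lebesgue_integral_def
  by (rule integral_FTC_atLeastAtMost)
     (use assms in \<open>auto intro: has_vector_derivative_within_subset continuous_on_subset
        has_vector_derivative_at_within simp: has_real_derivative_iff_has_vector_derivative\<close>)

lemma set_integrable_half_circle:
  fixes f :: "real \<Rightarrow> 'a :: euclidean_space"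
  assumes "continuous_on UNIV f"
  shows "set_integrable lborel {-(pi/2)..pi/2} f"
  by (rule borel_integrable_atLeastAtMost') (use assms continuous_on_subset in blast)

lemma half_circle_sum:
  fixes f :: "'i \<Rightarrow> real \<Rightarrow> 'a :: euclidean_space"
  assumes "\<And>i. i \<in> I \<Longrightarrow> continuous_on UNIV (f i)"
  shows "half_circle (\<lambda>\<theta>. \<Sum>i\<in>I. f i \<theta>) = (\<Sum>i\<in>I. half_circle (f i))"
proof -
  have "integrable lborel (\<lambda>\<theta>. indicator {-(pi/2)..pi/2} \<theta> *\<^sub>R f i \<theta>)" if "i \<in> I" for i
    using set_integrable_half_circle[OF assms[OF that]] by (simp add: set_integrable_def)
  then show ?thesis
    unfolding half_circle_def set_lebesgue_integral_def scaleR_sum_right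
    by (rule Bochner_Integration.integral_sum)
qed

text \<open>
  The same recursion as for matchings. With \<open>l' x\<close> the derivative of the form \<open>l x\<close> at the
  chosen point, the function \<open>l' x\<close> times the product of the other forms takes equal values at the
  two ends of the half circle, so its derivative has integral zero. The derivative is computed from
  \<open>l x * l y + l' x * l' y = 1 + r\<^sup>2 * s x * s y\<close>, the invariance of the inner product under a
  rotation.
\<close>

lemma half_circle_wick:
  fixes s :: "'a \<Rightarrow> real"
  assumes A: "finite A" "even (card A)" "x \<in> A"
  shows "real (card A) * half_circle (\<lambda>\<theta>. \<Prod>a\<in>A. half_edge_form r (s a) \<theta>) =
    (\<Sum>y\<in>A - {x}. (1 + r\<^sup>2 * s x * s y) *
       half_circle (\<lambda>\<theta>. \<Prod>a\<in>A - {x, y}. half_edge_form r (s a) \<theta>))"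
proof -
  define l where "l = (\<lambda>a \<theta>. half_edge_form r (s a) \<theta>)"
  define l' where "l' = (\<lambda>a \<theta>. r * s a * cos \<theta> - sin \<theta>)"
  have l: "(l a has_real_derivative l' a \<theta>) (at \<theta>)" for a \<theta>
    unfolding l_def l'_def half_edge_form_def by (auto intro!: derivative_eq_intros)
  have l': "(l' a has_real_derivative - l a \<theta>) (at \<theta>)" for a \<theta>
    unfolding l_def l'_def half_edge_form_def by (auto intro!: derivative_eq_intros)
  have rot: "l x \<theta> * l y \<theta> + l' x \<theta> * l' y \<theta> = 1 + r\<^sup>2 * s x * s y" for y \<theta>
  proof -
    have "l x \<theta> * l y \<theta> + l' x \<theta> * l' y \<theta> = (1 + r\<^sup>2 * s x * s y) * ((sin \<theta>)\<^sup>2 + (cos \<theta>)\<^sup>2)"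
      by (simp only: l_def l'_def half_edge_form_def) algebra
    then show ?thesis by simp
  qed
  define N where "N = real (card A)"
  define B where "B = A - {x}"
  have B: "finite B" "x \<notin> B" "A = insert x B" "real (card B) = N - 1"
    using A card_Suc_Diff1[of A x] by (auto simp: B_def N_def)
  define F where "F = (\<lambda>\<theta>. l' x \<theta> * (\<Prod>a\<in>B. l a \<theta>))"
  define f where "f = (\<lambda>\<theta>. (\<Sum>y\<in>B. (1 + r\<^sup>2 * s x * s y) * (\<Prod>a\<in>B - {y}. l a \<theta>)) - N * (\<Prod>a\<in>A. l a \<theta>))"
  have F: "(F has_real_derivative f \<theta>) (at \<theta>)" for \<theta>
  proof -
    have P: "((\<lambda>\<theta>. \<Prod>a\<in>B. l a \<theta>) has_real_derivative (\<Sum>y\<in>B. l' y \<theta> * (\<Prod>a\<in>B - {y}. l a \<theta>))) (at \<theta>)"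
      by (rule has_field_derivative_prod) (rule l)
    have "(F has_real_derivative (- l x \<theta>) * (\<Prod>a\<in>B. l a \<theta>) +
          (\<Sum>y\<in>B. l' y \<theta> * (\<Prod>a\<in>B - {y}. l a \<theta>)) * l' x \<theta>) (at \<theta>)"
      unfolding F_def by (rule DERIV_mult[OF l' P])
    also have "(\<Sum>y\<in>B. l' y \<theta> * (\<Prod>a\<in>B - {y}. l a \<theta>)) * l' x \<theta>
       = (\<Sum>y\<in>B. (1 + r\<^sup>2 * s x * s y) * (\<Prod>a\<in>B - {y}. l a \<theta>) - l x \<theta> * (\<Prod>a\<in>B. l a \<theta>))"
      unfolding sum_distrib_right
    proof (rule sum.cong[OF refl])
      fix y assume y: "y \<in> B"
      have "(\<Prod>a\<in>B. l a \<theta>) = l y \<theta> * (\<Prod>a\<in>B - {y}. l a \<theta>)"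
        using B(1) y by (simp add: prod.remove)
      then show "l' y \<theta> * (\<Prod>a\<in>B - {y}. l a \<theta>) * l' x \<theta> =
         (1 + r\<^sup>2 * s x * s y) * (\<Prod>a\<in>B - {y}. l a \<theta>) - l x \<theta> * (\<Prod>a\<in>B. l a \<theta>)"
        unfolding rot[of \<theta> y, symmetric] by (simp add: algebra_simps)
    qed
    also have "(- l x \<theta>) * (\<Prod>a\<in>B. l a \<theta>) + \<dots> = f \<theta>"
      unfolding f_def using B by (simp add: sum_subtractf left_diff_distrib)
    finally show ?thesis .
  qed
  have cl: "continuous_on UNIV (l a)" for a
    unfolding l_def half_edge_form_def by (intro continuous_intros)
  have cont: "continuous_on UNIV f"
    unfolding f_def by (intro continuous_intros cl)
  have "half_circle f = F (pi/2) - F (-(pi/2))"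
    by (rule half_circle_FTC[OF F cont])
  also have "\<dots> = 0"
  proof -
    have "odd (card B)" using A B by auto
    then have "(\<Prod>a\<in>B. l a (-(pi/2))) = - (\<Prod>a\<in>B. l a (pi/2))"
      using B(1) by (simp add: l_def half_edge_form_def prod_uminus)
    then show ?thesis by (simp add: F_def l'_def)
  qed
  finally have "half_circle f = 0" .
  have cp: "continuous_on UNIV (\<lambda>\<theta>. \<Prod>a\<in>C. l a \<theta>)" for C
    by (intro continuous_intros cl)
  have "half_circle f = half_circle (\<lambda>\<theta>. \<Sum>y\<in>B. (1 + r\<^sup>2 * s x * s y) * (\<Prod>a\<in>B - {y}. l a \<theta>))
     - half_circle (\<lambda>\<theta>. N * (\<Prod>a\<in>A. l a \<theta>))"
    unfolding f_def half_circle_def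
    by (rule set_integral_diff(2)) (intro set_integrable_half_circle continuous_intros cp)+
  also have "\<dots> = (\<Sum>y\<in>B. (1 + r\<^sup>2 * s x * s y) * half_circle (\<lambda>\<theta>. \<Prod>a\<in>B - {y}. l a \<theta>))
     - N * half_circle (\<lambda>\<theta>. \<Prod>a\<in>A. l a \<theta>)"
    by (subst half_circle_sum) (auto intro!: continuous_intros cp simp: half_circle_def)
  finally have "half_circle f = (\<Sum>y\<in>B. (1 + r\<^sup>2 * s x * s y) * half_circle (\<lambda>\<theta>. \<Prod>a\<in>B - {y}. l a \<theta>))
     - N * half_circle (\<lambda>\<theta>. \<Prod>a\<in>A. l a \<theta>)" .
  then show ?thesis
    using \<open>half_circle f = 0\<close> unfolding B_def N_def l_def by (simp add: Diff_insert2 [symmetric])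
qed

lemma half_circle_one: "half_circle (\<lambda>\<theta>. 1::real) = pi"
  using half_circle_FTC[of "\<lambda>x. x" "\<lambda>_. 1"] by simp

text \<open>
  Both sides satisfy the same recursion on the number of points. The constant is the radial part
  of a Gaussian moment; for \<open>r = 0\<close> the formula counts the perfect matchings.
\<close>

lemma sum_perfect_matchings_wick:
  fixes s :: "'a \<Rightarrow> real"
  assumes "finite A" "card A = 2 * M"
  shows "(\<Sum>m\<in>perfect_matchings A. \<Prod>e\<in>m. (1 + r\<^sup>2 * (\<Prod>a\<in>e. s a))) =
     2 ^ M * fact M / pi * half_circle (\<lambda>\<theta>. \<Prod>a\<in>A. half_edge_form r (s a) \<theta>)"
  using assms
proof (induction M arbitrary: A)
  case 0
  then show ?case by (simp add: perfect_matchings_empty half_circle_one)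
next
  case (Suc M)
  then obtain x where x: "x \<in> A" by (metis card.empty ex_in_conv mult_eq_0_iff nat.distinct(1) zero_neq_numeral)
  let ?I = "\<lambda>A. half_circle (\<lambda>\<theta>. \<Prod>a\<in>A. half_edge_form r (s a) \<theta>)"
  have "(\<Sum>m\<in>perfect_matchings A. \<Prod>e\<in>m. (1 + r\<^sup>2 * (\<Prod>a\<in>e. s a))) =
    (\<Sum>y\<in>A - {x}. (1 + r\<^sup>2 * s x * s y) * (2 ^ M * fact M / pi * ?I (A - {x, y})))"
    unfolding sum_perfect_matchings_remove_point[OF Suc.prems(1) x]
  proof (rule sum.cong[OF refl])
    fix y assume y: "y \<in> A - {x}"
    then have "card (A - {x, y}) = 2 * M"
      using Suc.prems x by (subst card_Diff_subset) auto
    then show "(1 + r\<^sup>2 * prod s {x, y}) *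
         (\<Sum>M\<in>perfect_matchings (A - {x, y}). \<Prod>e\<in>M. 1 + r\<^sup>2 * prod s e) =
         (1 + r\<^sup>2 * s x * s y) * (2 ^ M * fact M / pi * ?I (A - {x, y}))"
      using Suc.IH[of "A - {x, y}"] Suc.prems y by (auto simp: mult.assoc)
  qed
  also have "\<dots> = 2 ^ M * fact M / pi * (\<Sum>y\<in>A - {x}. (1 + r\<^sup>2 * s x * s y) * ?I (A - {x, y}))"
    by (simp add: sum_distrib_left mult_ac)
  also have "\<dots> = 2 ^ M * fact M / pi * (real (card A) * ?I A)"
    using Suc.prems x by (subst half_circle_wick[of A x]) auto
  also have "\<dots> = 2 ^ Suc M * fact (Suc M) / pi * ?I A"
    using Suc.prems by (simp add: field_simps)
  finally show ?case .
qed

section \<open>The annealed measure as a one-dimensional integral\<close>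

lemma perfect_matchings_nonempty:
  assumes "finite A" "card A = 2 * M"
  shows "perfect_matchings A \<noteq> {}"
  using assms
proof (induction M arbitrary: A)
  case 0
  then show ?case by (simp add: perfect_matchings_empty)
next
  case (Suc M)
  then obtain x where x: "x \<in> A" by fastforce
  then have "card (A - {x}) = Suc (2 * M)" using Suc.prems by simp
  then obtain y where y: "y \<in> A - {x}" by (metis card.empty equals0I nat.distinct(1))
  then have "card (A - {x, y}) = 2 * M"
    using Suc.prems x by (subst card_Diff_subset) auto
  then have "perfect_matchings (A - {x, y}) \<noteq> {}"
    using Suc.IH[of "A - {x, y}"] Suc.prems by simp
  then show ?case
    using x y by (auto simp: perfect_matchings_remove_point[of x A])
qed

lemma half_circle_cos_pos: "half_circle (\<lambda>\<theta>. cos \<theta> ^ (2 * M)) > 0"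
proof -
  let ?A = "{..<2 * M}"
  have "0 < real (card (perfect_matchings ?A))"
    using perfect_matchings_nonempty[of ?A M] finite_perfect_matchings[of ?A]
    by (simp add: card_gt_0_iff)
  also have "\<dots> = 2 ^ M * fact M / pi * half_circle (\<lambda>\<theta>. cos \<theta> ^ (2 * M))"
    using sum_perfect_matchings_wick[of ?A M 0 "\<lambda>_. 1"] by (simp add: half_edge_form_def)
  finally show ?thesis
    by (rule zero_less_mult_pos) simp
qed

lemma finite_half_edges: "finite (half_edges d n)"
  by (simp add: half_edges_def)

lemma card_half_edges:
  "card (half_edges d n) = d * n + (if odd (d * n) then 1 else 0)"
proof (cases n)
  case (Suc m)
  have "card (half_edges d n) = (\<Sum>i\<in>{1..n}. vertex_degree d n i)"
    unfolding half_edges_def by (subst card_SigmaI) auto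
  also have "{1..n} = insert n {1..m}" using Suc by auto
  also have "(\<Sum>i\<in>insert n {1..m}. vertex_degree d n i) = vertex_degree d n n + (\<Sum>i\<in>{1..m}. d)"
    using Suc by (subst sum.insert) (auto intro!: sum.cong simp: vertex_degree_def)
  finally show ?thesis using Suc by (simp add: vertex_degree_def)
qed (simp add: half_edges_def)

definition num_edges :: "nat \<Rightarrow> nat \<Rightarrow> nat" where
  "num_edges d n = card (half_edges d n) div 2"

lemma card_half_edges_eq: "card (half_edges d n) = 2 * num_edges d n"
  unfolding num_edges_def card_half_edges by auto

text \<open>
  Each edge is counted once, at the pair \<open>(min, max)\<close> of its end vertices; this also covers
  self-loops.
\<close>

lemma edge_interaction:
  assumes "M \<in> perfect_matchings (half_edges d n)"
  shows "(\<Sum>i = 1..n. \<Sum>j = i..n. real (edge_mult M i j) * \<sigma> i * \<sigma> j) =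
    (\<Sum>e\<in>M. \<Prod>a\<in>e. \<sigma> (fst a))"
proof -
  have fin: "finite M"
    using assms finite_half_edges[of d n]
    by (auto simp: perfect_matchings_def partition_on_def intro: finite_UnionD)
  have "(\<Sum>i = 1..n. \<Sum>j = i..n. real (edge_mult M i j) * \<sigma> i * \<sigma> j) =
     (\<Sum>i = 1..n. \<Sum>j = i..n. \<Sum>e\<in>M. if fst ` e = {i, j} then \<sigma> i * \<sigma> j else 0)"
    using fin by (simp add: edge_mult_def sum.If_cases mult.assoc Int_def Collect_conj_eq[symmetric])
  also have "\<dots> = (\<Sum>(i,j)\<in>(SIGMA i:{1..n}. {i..n}). \<Sum>e\<in>M. if fst ` e = {i, j} then \<sigma> i * \<sigma> j else 0)"
    by (subst sum.Sigma) auto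
  also have "\<dots> = (\<Sum>e\<in>M. \<Sum>(i,j)\<in>(SIGMA i:{1..n}. {i..n}). if fst ` e = {i, j} then \<sigma> i * \<sigma> j else 0)"
    unfolding case_prod_unfold by (rule sum.swap)
  also have "\<dots> = (\<Sum>e\<in>M. \<Prod>a\<in>e. \<sigma> (fst a))"
  proof (rule sum.cong[OF refl])
    fix e assume e: "e \<in> M"
    then have "card e = 2" "e \<subseteq> half_edges d n"
      using assms by (auto simp: perfect_matchings_def partition_on_def)
    then obtain a b where ab: "e = {a, b}" "a \<noteq> b" "fst a \<in> {1..n}" "fst b \<in> {1..n}"
      by (auto simp: card_2_iff half_edges_def)
    define p where "p = (min (fst a) (fst b), max (fst a) (fst b))"
    have eq: "fst ` e = {i, j} \<longleftrightarrow> (i, j) = p" if "i \<le> j" for i j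
      using that ab(1) by (auto simp: p_def doubleton_eq_iff min_def max_def)
    have "(\<Sum>(i,j)\<in>(SIGMA i:{1..n}. {i..n}). if fst ` e = {i, j} then \<sigma> i * \<sigma> j else 0) =
       (\<Sum>q\<in>(SIGMA i:{1..n}. {i..n}). if q = p then \<sigma> (fst q) * \<sigma> (snd q) else 0)"
      by (rule sum.cong) (use eq in auto)
    also have "\<dots> = \<sigma> (fst p) * \<sigma> (snd p)"
      using ab by (subst sum.delta) (auto simp: p_def)
    also have "\<dots> = (\<Prod>a\<in>e. \<sigma> (fst a))"
      using ab by (auto simp: p_def min_def max_def)
    finally show "(\<Sum>(i,j)\<in>(SIGMA i:{1..n}. {i..n}). if fst ` e = {i, j} then \<sigma> i * \<sigma> j else 0) =
      (\<Prod>a\<in>e. \<sigma> (fst a))" .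
  qed
  finally show ?thesis .
qed

lemma card_perfect_matching:
  assumes "M \<in> perfect_matchings (half_edges d n)"
  shows "card M = num_edges d n"
proof -
  have fin: "finite M"
    using assms finite_half_edges[of d n]
    by (auto simp: perfect_matchings_def partition_on_def intro: finite_UnionD)
  have "card (half_edges d n) = (\<Sum>e\<in>M. card e)"
    using assms fin card_Union_disjoint[of M] finite_half_edges[of d n]
    by (auto simp: perfect_matchings_def partition_on_def disjoint_def pairwise_def disjnt_def
        intro: finite_subset)
  also have "\<dots> = 2 * card M"
    using assms by (simp add: perfect_matchings_def)
  finally show ?thesis by (simp add: num_edges_def)
qed

lemma exp_spin_product:
  fixes x \<beta> :: real
  assumes "x = 1 \<or> x = -1"
  shows "exp (\<beta> * x) = cosh \<beta> * (1 + tanh \<beta> * x)"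
proof -
  have "cosh \<beta> * (1 + tanh \<beta> * x) = cosh \<beta> + x * sinh \<beta>"
    by (simp add: tanh_def field_simps)
  then show ?thesis
    using assms by (auto simp: cosh_plus_sinh cosh_minus_sinh)
qed

lemma spin_configs_spin: "\<sigma> \<in> spin_configs n \<Longrightarrow> i \<in> {1..n} \<Longrightarrow> \<sigma> i = 1 \<or> \<sigma> i = -1"
  by (auto simp: spin_configs_def PiE_def Pi_def)

lemma exp_hamiltonian:
  assumes M: "M \<in> perfect_matchings (half_edges d n)" and \<sigma>: "\<sigma> \<in> spin_configs n"
  shows "exp (- hamiltonian \<beta> B n M \<sigma>) =
    exp (B * total_spin n \<sigma>) * (cosh \<beta> ^ num_edges d n *
      (\<Prod>e\<in>M. 1 + tanh \<beta> * (\<Prod>a\<in>e. \<sigma> (fst a))))"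
proof -
  have "exp (- hamiltonian \<beta> B n M \<sigma>) =
     exp (B * total_spin n \<sigma>) * exp (\<Sum>e\<in>M. \<beta> * (\<Prod>a\<in>e. \<sigma> (fst a)))"
    unfolding hamiltonian_def edge_interaction[OF M] total_spin_def sum_distrib_left
    by (simp add: exp_add[symmetric] sum_distrib_left sum_negf)
  also have "exp (\<Sum>e\<in>M. \<beta> * (\<Prod>a\<in>e. \<sigma> (fst a))) = (\<Prod>e\<in>M. exp (\<beta> * (\<Prod>a\<in>e. \<sigma> (fst a))))"
    using M finite_half_edges[of d n] 
    by (intro exp_sum) (auto simp: perfect_matchings_def partition_on_def intro: finite_UnionD)
  also have "\<dots> = (\<Prod>e\<in>M. cosh \<beta> * (1 + tanh \<beta> * (\<Prod>a\<in>e. \<sigma> (fst a))))"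
  proof (rule prod.cong[OF refl], rule exp_spin_product)
    fix e assume "e \<in> M"
    then have "card e = 2" "e \<subseteq> half_edges d n"
      using M by (auto simp: perfect_matchings_def partition_on_def)
    then obtain a b where ab: "e = {a, b}" "a \<noteq> b" "fst a \<in> {1..n}" "fst b \<in> {1..n}"
      by (auto simp: card_2_iff half_edges_def)
    then show "(\<Prod>a\<in>e. \<sigma> (fst a)) = 1 \<or> (\<Prod>a\<in>e. \<sigma> (fst a)) = -1"
      using spin_configs_spin[OF \<sigma>, of "fst a"] spin_configs_spin[OF \<sigma>, of "fst b"] by auto
  qed
  also have "\<dots> = cosh \<beta> ^ num_edges d n * (\<Prod>e\<in>M. 1 + tanh \<beta> * (\<Prod>a\<in>e. \<sigma> (fst a)))"
    by (simp add: prod.distrib card_perfect_matching[OF M])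
  finally show ?thesis .
qed

lemma expectation_config_model:
  fixes f :: "(nat \<times> nat) set set \<Rightarrow> real"
  shows "measure_pmf.expectation (config_model d n) f =
    (\<Sum>M\<in>perfect_matchings (half_edges d n). f M) / card (perfect_matchings (half_edges d n))"
  unfolding config_model_def
  by (rule integral_pmf_of_set)
     (use perfect_matchings_nonempty[OF finite_half_edges card_half_edges_eq]
          finite_perfect_matchings[OF finite_half_edges] in auto)

text \<open>
  The number of perfect matchings of the half-edges, divided by \<open>2 ^ M * fact M / pi\<close>, where \<open>M\<close> is
  the number of edges.
\<close>

definition cos_integral :: "nat \<Rightarrow> nat \<Rightarrow> real" where
  "cos_integral d n = half_circle (\<lambda>\<theta>. cos \<theta> ^ card (half_edges d n))"

lemma cos_integral_pos: "cos_integral d n > 0"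
  unfolding cos_integral_def card_half_edges_eq by (rule half_circle_cos_pos)

text \<open>
  Wick's formula for the weighted sum over matchings, divided by its case \<open>r = 0\<close> for their
  number; the combinatorial constants cancel.
\<close>

lemma annealed_weight:
  assumes \<sigma>: "\<sigma> \<in> spin_configs n" and "\<beta> \<ge> 0"
  shows "measure_pmf.expectation (config_model d n) (\<lambda>M. exp (- hamiltonian \<beta> B n M \<sigma>)) =
    cosh \<beta> ^ num_edges d n / cos_integral d n * (exp (B * total_spin n \<sigma>) *
      half_circle (\<lambda>\<theta>. \<Prod>a\<in>half_edges d n. half_edge_form (sqrt (tanh \<beta>)) (\<sigma> (fst a)) \<theta>))"
proof -
  let ?A = "half_edges d n" and ?c = "2 ^ num_edges d n * fact (num_edges d n) / pi :: real"
  have card: "real (card (perfect_matchings ?A)) = ?c * cos_integral d n"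
    using sum_perfect_matchings_wick[OF finite_half_edges card_half_edges_eq, where r = 0 and s="\<lambda>_. 1"]
    by (simp add: half_edge_form_def cos_integral_def)
  have "(\<Sum>M\<in>perfect_matchings ?A. exp (- hamiltonian \<beta> B n M \<sigma>)) =
     exp (B * total_spin n \<sigma>) * cosh \<beta> ^ num_edges d n *
      (\<Sum>M\<in>perfect_matchings ?A. \<Prod>e\<in>M. 1 + (sqrt (tanh \<beta>))\<^sup>2 * (\<Prod>a\<in>e. \<sigma> (fst a)))"
    unfolding sum_distrib_left
    by (rule sum.cong[OF refl]) (use assms in \<open>simp add: exp_hamiltonian\<close>)
  also have "\<dots> = exp (B * total_spin n \<sigma>) * cosh \<beta> ^ num_edges d n * (?c *
      half_circle (\<lambda>\<theta>. \<Prod>a\<in>?A. half_edge_form (sqrt (tanh \<beta>)) (\<sigma> (fst a)) \<theta>))"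
    by (subst sum_perfect_matchings_wick[OF finite_half_edges card_half_edges_eq]) simp
  finally show ?thesis
    using cos_integral_pos[of d n] unfolding expectation_config_model card by simp
qed

text \<open>
  The two spins of a vertex of degree \<open>D\<close>, summed with the weights \<open>exp z\<close> and \<open>exp (- z)\<close>.
\<close>

definition vertex_weight :: "real \<Rightarrow> nat \<Rightarrow> complex \<Rightarrow> real \<Rightarrow> complex" where
  "vertex_weight r D z \<theta> =
     exp z * of_real (cos \<theta> + r * sin \<theta>) ^ D + exp (- z) * of_real (cos \<theta> - r * sin \<theta>) ^ D"

text \<open>
  The last vertex is kept apart because its degree depends on the parity of \<open>d * n\<close>.
\<close>

definition spin_transform :: "real \<Rightarrow> nat \<Rightarrow> nat \<Rightarrow> complex \<Rightarrow> complex" where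
  "spin_transform r d n z =
     half_circle (\<lambda>\<theta>. vertex_weight r d z \<theta> ^ (n - 1) * vertex_weight r (vertex_degree d n n) z \<theta>)"

lemma half_circle_of_real: "half_circle (\<lambda>\<theta>. complex_of_real (f \<theta>)) = of_real (half_circle f)"
  unfolding half_circle_def by (rule set_integral_complex_of_real)

lemma half_circle_mult_right: "half_circle (\<lambda>\<theta>. c * f \<theta>) = c * half_circle f"
  for c :: "'a :: {real_normed_field, second_countable_topology, euclidean_space}"
  unfolding half_circle_def by simp

lemma finite_spin_configs: "finite (spin_configs n)"
  by (simp add: spin_configs_def finite_PiE)

text \<open>
  For fixed \<open>\<theta>\<close> the summand is a product over the vertices, so the sum over all configurations
  factorises.
\<close>

lemma sum_spin_configs_transform:
  assumes "n \<ge> 1"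
  shows "(\<Sum>\<sigma>\<in>spin_configs n. exp (z * of_real (total_spin n \<sigma>)) *
      of_real (half_circle (\<lambda>\<theta>. \<Prod>a\<in>half_edges d n. half_edge_form r (\<sigma> (fst a)) \<theta>))) =
    spin_transform r d n z" (is "?L = _")
proof -
  have form: "(\<Prod>a\<in>half_edges d n. half_edge_form r (\<sigma> (fst a)) \<theta>) =
     (\<Prod>i\<in>{1..n}. half_edge_form r (\<sigma> i) \<theta> ^ vertex_degree d n i)" for \<sigma> \<theta>
    using prod.Sigma[of "{1..n}" "\<lambda>i. {..<vertex_degree d n i}" "\<lambda>i _. half_edge_form r (\<sigma> i) \<theta>"]
    unfolding half_edges_def by (simp add: case_prod_unfold)
  have ex: "exp (z * of_real (total_spin n \<sigma>)) = (\<Prod>i\<in>{1..n}. exp (z * of_real (\<sigma> i)))" for \<sigma>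
    by (simp add: total_spin_def sum_distrib_left exp_sum)
  have cf: "continuous_on UNIV (half_edge_form r s)" for s
    unfolding half_edge_form_def by (intro continuous_intros)
  have "?L = (\<Sum>\<sigma>\<in>spin_configs n. half_circle (\<lambda>\<theta>. \<Prod>i\<in>{1..n}.
       exp (z * of_real (\<sigma> i)) * of_real (half_edge_form r (\<sigma> i) \<theta>) ^ vertex_degree d n i))"
    unfolding form half_circle_of_real[symmetric] half_circle_mult_right[symmetric] ex prod.distrib
    by simp
  also have "\<dots> = half_circle (\<lambda>\<theta>. \<Sum>\<sigma>\<in>spin_configs n. \<Prod>i\<in>{1..n}.
       exp (z * of_real (\<sigma> i)) * of_real (half_edge_form r (\<sigma> i) \<theta>) ^ vertex_degree d n i)"
    by (subst half_circle_sum) (auto intro!: continuous_intros cf)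
  also have "\<dots> = half_circle (\<lambda>\<theta>. \<Prod>i\<in>{1..n}. \<Sum>s\<in>{-1,1}.
       exp (z * of_real s) * of_real (half_edge_form r s \<theta>) ^ vertex_degree d n i)"
    unfolding spin_configs_def by (subst prod_sum_PiE) auto
  also have "\<dots> = half_circle (\<lambda>\<theta>. \<Prod>i\<in>{1..n}. vertex_weight r (vertex_degree d n i) z \<theta>)"
    by (simp add: half_edge_form_def vertex_weight_def add.commute)
  also have "(\<lambda>\<theta>. \<Prod>i\<in>{1..n}. vertex_weight r (vertex_degree d n i) z \<theta>) =
     (\<lambda>\<theta>. vertex_weight r d z \<theta> ^ (n - 1) * vertex_weight r (vertex_degree d n n) z \<theta>)"
  proof
    fix \<theta>
    have "{1..n} = insert n {1..n - 1}" using assms by auto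
    moreover have "(\<Prod>i\<in>{1..n - 1}. vertex_weight r (vertex_degree d n i) z \<theta>) =
       (\<Prod>i\<in>{1..n - 1}. vertex_weight r d z \<theta>)"
      by (rule prod.cong) (auto simp: vertex_degree_def)
    ultimately show "(\<Prod>i\<in>{1..n}. vertex_weight r (vertex_degree d n i) z \<theta>) =
      vertex_weight r d z \<theta> ^ (n - 1) * vertex_weight r (vertex_degree d n n) z \<theta>"
      using assms by simp
  qed
  finally show ?thesis by (simp add: spin_transform_def)
qed

lemma expectation_partition_function:
  "measure_pmf.expectation (config_model d n) (partition_function \<beta> B n) =
    (\<Sum>\<sigma>\<in>spin_configs n. measure_pmf.expectation (config_model d n) (\<lambda>M. exp (- hamiltonian \<beta> B n M \<sigma>)))"
  unfolding partition_function_def expectation_config_model sum_divide_distrib by (rule sum.swap)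

lemma expectation_partition_function_pos:
  "measure_pmf.expectation (config_model d n) (partition_function \<beta> B n) > 0"
proof -
  let ?A = "perfect_matchings (half_edges d n)"
  have A: "?A \<noteq> {}" "finite ?A"
    using perfect_matchings_nonempty[OF finite_half_edges card_half_edges_eq]
          finite_perfect_matchings[OF finite_half_edges] by auto
  have "spin_configs n \<noteq> {}" by (simp add: spin_configs_def PiE_eq_empty_iff)
  then have "partition_function \<beta> B n M > 0" for M
    unfolding partition_function_def using finite_spin_configs by (intro sum_pos) auto
  then have "(\<Sum>M\<in>?A. partition_function \<beta> B n M) > 0"
    using A by (intro sum_pos) auto
  then show ?thesis
    using A by (simp add: expectation_config_model card_gt_0_iff)
qed

lemma annealed_prob_nonneg: "annealed_prob d \<beta> B n \<sigma> \<ge> 0"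
  unfolding annealed_prob_def
  by (intro divide_nonneg_pos expectation_partition_function_pos)
     (simp add: expectation_config_model sum_nonneg)

lemma sum_annealed_prob: "(\<Sum>\<sigma>\<in>spin_configs n. annealed_prob d \<beta> B n \<sigma>) = 1"
  using expectation_partition_function_pos[of d n \<beta> B]
  unfolding annealed_prob_def sum_divide_distrib[symmetric] expectation_partition_function[symmetric]
  by simp

lemma prob_space_annealed_measure: "prob_space (annealed_measure d \<beta> B n)"
proof
  show "emeasure (annealed_measure d \<beta> B n) (space (annealed_measure d \<beta> B n)) = 1"
    unfolding annealed_measure_def space_point_measure
    by (subst emeasure_point_measure_finite)
       (auto simp: finite_spin_configs sum_ennreal annealed_prob_nonneg sum_annealed_prob)
qed

lemma expectation_annealed_measure:
  fixes f :: "(nat \<Rightarrow> real) \<Rightarrow> 'a :: {banach, second_countable_topology}"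
  shows "(\<integral>\<sigma>. f \<sigma> \<partial>annealed_measure d \<beta> B n) = (\<Sum>\<sigma>\<in>spin_configs n. annealed_prob d \<beta> B n \<sigma> *\<^sub>R f \<sigma>)"
  unfolding annealed_measure_def
  by (rule lebesgue_integral_point_measure_finite) (auto simp: finite_spin_configs annealed_prob_nonneg)

lemma integrable_annealed_measure:
  fixes f :: "(nat \<Rightarrow> real) \<Rightarrow> 'a :: {banach, second_countable_topology}"
  shows "integrable (annealed_measure d \<beta> B n) f"
  unfolding annealed_measure_def
  by (rule integrable_point_measure_finite) (auto simp: finite_spin_configs)

lemma measurable_annealed_measure:
  "f \<in> borel_measurable (annealed_measure d \<beta> B n)"
  unfolding annealed_measure_def by simp

lemma of_real_exp_mult: "complex_of_real (exp (x * y)) = exp (of_real x * of_real y)"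
  by (metis exp_of_real of_real_mult)

lemma partition_function_transform:
  assumes "n \<ge> 1" "\<beta> \<ge> 0"
  shows "of_real (measure_pmf.expectation (config_model d n) (partition_function \<beta> B n)) =
    of_real (cosh \<beta> ^ num_edges d n / cos_integral d n) *
      spin_transform (sqrt (tanh \<beta>)) d n (of_real B)"
  unfolding expectation_partition_function sum_spin_configs_transform[OF assms(1), symmetric]
    sum_distrib_left of_real_sum
  by (rule sum.cong[OF refl]) (simp add: annealed_weight assms(2) of_real_exp_mult)

text \<open>
  Tilting by \<open>exp (z * S)\<close> only shifts the field; all factors that do not depend on the field
  cancel in the quotient.
\<close>

lemma annealed_exponential_moment:
  assumes "n \<ge> 1" "\<beta> \<ge> 0"
  shows "(\<integral>\<sigma>. exp (z * of_real (total_spin n \<sigma>)) \<partial>annealed_measure d \<beta> B n) =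
    spin_transform (sqrt (tanh \<beta>)) d n (of_real B + z) / spin_transform (sqrt (tanh \<beta>)) d n (of_real B)"
proof -
  let ?c = "cosh \<beta> ^ num_edges d n / cos_integral d n"
  let ?Z = "measure_pmf.expectation (config_model d n) (partition_function \<beta> B n)"
  have c: "?c > 0" using cos_integral_pos by (simp add: cosh_real_pos)
  have "(\<integral>\<sigma>. exp (z * of_real (total_spin n \<sigma>)) \<partial>annealed_measure d \<beta> B n) =
    (\<Sum>\<sigma>\<in>spin_configs n. of_real (?c / ?Z) * (exp ((of_real B + z) * of_real (total_spin n \<sigma>)) *
      of_real (half_circle (\<lambda>\<theta>. \<Prod>a\<in>half_edges d n. half_edge_form (sqrt (tanh \<beta>)) (\<sigma> (fst a)) \<theta>))))"
    unfolding expectation_annealed_measure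
    by (rule sum.cong[OF refl])
       (simp add: annealed_prob_def annealed_weight assms(2) of_real_exp_mult exp_add
          scaleR_conv_of_real distrib_right)
  also have "\<dots> = of_real ?c * spin_transform (sqrt (tanh \<beta>)) d n (of_real B + z) / of_real ?Z"
    unfolding sum_distrib_left[symmetric] sum_spin_configs_transform[OF assms(1)] by simp
  also have "\<dots> = spin_transform (sqrt (tanh \<beta>)) d n (of_real B + z) / spin_transform (sqrt (tanh \<beta>)) d n (of_real B)"
    unfolding partition_function_transform[OF assms] using c 
    by (metis (no_types, lifting) less_irrefl mult_divide_mult_cancel_left of_real_eq_0_iff)
  finally show ?thesis .
qed

section \<open>The field as a function of the maximising parameter\<close>

text \<open>
  The field for which \<open>arctan (r * tanh w)\<close>, where \<open>\<tau> = r\<^sup>2\<close>, is a critical point of the weight.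
  Using \<open>w\<close> as the independent variable turns the self-consistency equation of the model into an
  explicit formula, which stays valid for \<open>\<tau> = 0\<close>.
\<close>

definition field_of :: "real \<Rightarrow> nat \<Rightarrow> real \<Rightarrow> real" where
  "field_of \<tau> d w = w - (real d - 1) * artanh (\<tau> * tanh w)"

definition field_slope :: "real \<Rightarrow> nat \<Rightarrow> real \<Rightarrow> real" where
  "field_slope \<tau> d w =
     1 - (real d - 1) * \<tau> * (1 - (tanh w)\<^sup>2) / (1 - \<tau>\<^sup>2 * (tanh w)\<^sup>2)"

text \<open>
  This is \<open>tanh (w + artanh (\<tau> * tanh w))\<close>, the mean spin of a vertex at the critical point.
\<close>

definition mag_of :: "real \<Rightarrow> real \<Rightarrow> real" where
  "mag_of \<tau> w = (1 + \<tau>) * tanh w / (1 + \<tau> * (tanh w)\<^sup>2)"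

definition mag_slope :: "real \<Rightarrow> real \<Rightarrow> real" where
  "mag_slope \<tau> w =
     (1 + \<tau>) * (1 - \<tau> * (tanh w)\<^sup>2) * (1 - (tanh w)\<^sup>2) / (1 + \<tau> * (tanh w)\<^sup>2)\<^sup>2"

text \<open>
  The parameters at which the maximum will be unique and nondegenerate: for \<open>(d - 1) * \<tau> \<ge> 1\<close> a parameter whose sign
  differs from that of its field, or whose field vanishes, has to be excluded.
\<close>

definition regular_param :: "real \<Rightarrow> nat \<Rightarrow> real \<Rightarrow> bool" where
  "regular_param \<tau> d w \<longleftrightarrow>
     (real d - 1) * \<tau> < 1 \<or> (w > 0 \<and> field_of \<tau> d w > 0) \<or> (w < 0 \<and> field_of \<tau> d w < 0)"

lemma tanh_sq_less_1: "(tanh (w::real))\<^sup>2 < 1"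
  using tanh_real_lt_1[of w] tanh_real_gt_neg1[of w]
  by (auto simp: abs_square_less_1 abs_less_iff)

lemma abs_mult_tanh_less_1:
  assumes "0 \<le> \<tau>" "\<tau> < 1" shows "\<bar>\<tau> * tanh (w::real)\<bar> < 1"
proof -
  have "\<tau> * \<bar>tanh w\<bar> \<le> \<tau> * 1"
    using assms(1) tanh_real_lt_1[of w] tanh_real_gt_neg1[of w] by (intro mult_left_mono) auto
  then show ?thesis using assms by (auto simp: abs_mult)
qed

lemma tau_tanh_bounds:
  assumes "0 \<le> \<tau>" "\<tau> < 1"
  shows "1 - \<tau>\<^sup>2 * (tanh (w::real))\<^sup>2 > 0" "1 - \<tau> * (tanh w)\<^sup>2 > 0" "1 + \<tau> * (tanh w)\<^sup>2 > 0"
    "1 + \<tau> * tanh w > 0" "1 - \<tau> * tanh w > 0"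
proof -
  note a = abs_mult_tanh_less_1[OF assms, of w]
  show "1 + \<tau> * tanh w > 0" "1 - \<tau> * tanh w > 0" using a by auto
  have "(\<tau> * tanh w)\<^sup>2 < 1" using a by (simp add: abs_square_less_1)
  then show "1 - \<tau>\<^sup>2 * (tanh w)\<^sup>2 > 0" by (simp add: power_mult_distrib)
  have "\<tau> * (tanh w)\<^sup>2 \<le> \<tau> * 1"
    using assms tanh_sq_less_1[of w] by (intro mult_left_mono) auto
  then show "1 - \<tau> * (tanh w)\<^sup>2 > 0" using assms by simp
  show "1 + \<tau> * (tanh w)\<^sup>2 > 0" using assms by (intro add_pos_nonneg) auto
qed

lemma field_of_0 [simp]: "field_of \<tau> d 0 = 0"
  by (simp add: field_of_def artanh_def)

lemma field_of_minus:
  assumes "0 \<le> \<tau>" "\<tau> < 1" shows "field_of \<tau> d (- w) = - field_of \<tau> d w"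
  using abs_mult_tanh_less_1[OF assms, of w] 
  by (simp add: field_of_def artanh_minus_real algebra_simps)

lemma field_slope_minus: "field_slope \<tau> d (- w) = field_slope \<tau> d w"
  by (simp add: field_slope_def)

lemma field_of_has_derivative:
  assumes "0 \<le> \<tau>" "\<tau> < 1"
  shows "(field_of \<tau> d has_real_derivative field_slope \<tau> d w) (at w)"
proof -
  have "((\<lambda>w. artanh (\<tau> * tanh w)) has_real_derivative
      1 / (1 - (\<tau> * tanh w)\<^sup>2) * (\<tau> * (1 - (tanh w)\<^sup>2))) (at w)"
    by (rule DERIV_chain2[where f = artanh and g = "\<lambda>w. \<tau> * tanh w",
          OF artanh_real_has_field_derivative[OF abs_mult_tanh_less_1[OF assms]]])
       (use cosh_real_nonzero[of w] in \<open>auto intro!: derivative_eq_intros\<close>)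
  from DERIV_diff[OF DERIV_ident DERIV_cmult[OF this, of "real d - 1"]] show ?thesis
    by (simp add: field_of_def[abs_def] field_slope_def power_mult_distrib mult.assoc)
qed

lemma continuous_on_field_of:
  assumes "0 \<le> \<tau>" "\<tau> < 1"
  shows "continuous_on S (field_of \<tau> d)"
  using field_of_has_derivative[OF assms] by (meson DERIV_isCont continuous_at_imp_continuous_on)

lemma mag_of_has_derivative:
  assumes "0 \<le> \<tau>" "\<tau> < 1"
  shows "(mag_of \<tau> has_real_derivative mag_slope \<tau> w) (at w)"
proof -
  let ?t = "tanh w"
  have nz: "1 + \<tau> * ?t\<^sup>2 \<noteq> 0" using tau_tanh_bounds(3)[OF assms, of w] by simp
  have "(mag_of \<tau> has_real_derivative
     ((1 + \<tau>) * (1 - ?t\<^sup>2) * (1 + \<tau> * ?t\<^sup>2) - (1 + \<tau>) * ?t * (\<tau> * (2 * ?t * (1 - ?t\<^sup>2)))) /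
       ((1 + \<tau> * ?t\<^sup>2) * (1 + \<tau> * ?t\<^sup>2))) (at w)"
    unfolding mag_of_def[abs_def]
    using nz cosh_real_nonzero[of w] by (auto intro!: derivative_eq_intros simp: mult_ac)
  also have "(1 + \<tau>) * (1 - ?t\<^sup>2) * (1 + \<tau> * ?t\<^sup>2) - (1 + \<tau>) * ?t * (\<tau> * (2 * ?t * (1 - ?t\<^sup>2)))
     = (1 + \<tau>) * (1 - \<tau> * ?t\<^sup>2) * (1 - ?t\<^sup>2)"
    by algebra
  finally show ?thesis by (simp add: mag_slope_def power2_eq_square)
qed

lemma mag_slope_pos:
  assumes "0 \<le> \<tau>" "\<tau> < 1" shows "mag_slope \<tau> w > 0"
  unfolding mag_slope_def using assms tau_tanh_bounds[OF assms, of w] tanh_sq_less_1[of w]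
  by (intro divide_pos_pos mult_pos_pos) auto

text \<open>
  Convexity of the field on the positive half line.
\<close>

lemma field_slope_mono:
  assumes "0 \<le> \<tau>" "\<tau> < 1" "d \<ge> 1" "0 \<le> v" "v \<le> w"
  shows "field_slope \<tau> d v \<le> field_slope \<tau> d w"
proof -
  have "0 \<le> tanh v" "tanh v \<le> tanh w" using assms by auto
  then have sq: "(tanh v)\<^sup>2 \<le> (tanh w)\<^sup>2" by (intro power_mono) auto
  have "(1 - (tanh w)\<^sup>2) * (1 - \<tau>\<^sup>2 * (tanh v)\<^sup>2) \<le> (1 - (tanh v)\<^sup>2) * (1 - \<tau>\<^sup>2 * (tanh w)\<^sup>2)"
  proof -
    have "(1 - (tanh v)\<^sup>2) * (1 - \<tau>\<^sup>2 * (tanh w)\<^sup>2) - (1 - (tanh w)\<^sup>2) * (1 - \<tau>\<^sup>2 * (tanh v)\<^sup>2)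
       = (1 - \<tau>\<^sup>2) * ((tanh w)\<^sup>2 - (tanh v)\<^sup>2)" by (simp add: algebra_simps)
    moreover have "\<dots> \<ge> 0" using assms sq by (intro mult_nonneg_nonneg) (auto simp: power_le_one)
    ultimately show ?thesis by linarith
  qed
  then have "(1 - (tanh w)\<^sup>2) / (1 - \<tau>\<^sup>2 * (tanh w)\<^sup>2) \<le> (1 - (tanh v)\<^sup>2) / (1 - \<tau>\<^sup>2 * (tanh v)\<^sup>2)"
    unfolding pos_divide_le_eq[OF tau_tanh_bounds(1)[OF assms(1,2), of w]] times_divide_eq_left
      pos_le_divide_eq[OF tau_tanh_bounds(1)[OF assms(1,2), of v]] .
  then have "(real d - 1) * \<tau> * ((1 - (tanh w)\<^sup>2) / (1 - \<tau>\<^sup>2 * (tanh w)\<^sup>2))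
     \<le> (real d - 1) * \<tau> * ((1 - (tanh v)\<^sup>2) / (1 - \<tau>\<^sup>2 * (tanh v)\<^sup>2))"
    using assms by (intro mult_left_mono) auto
  then show ?thesis by (simp add: field_slope_def)
qed

text \<open>
  A convex function that vanishes at \<open>0\<close> and is positive at \<open>w > 0\<close> increases at \<open>w\<close>.
\<close>

lemma field_slope_pos_aux:
  assumes "0 \<le> \<tau>" "\<tau> < 1" "d \<ge> 1" "0 < w" "field_of \<tau> d w > 0"
  shows "field_slope \<tau> d w > 0"
proof -
  obtain \<xi> where \<xi>: "0 < \<xi>" "\<xi> < w" "field_of \<tau> d w - field_of \<tau> d 0 = (w - 0) * field_slope \<tau> d \<xi>"
    using MVT2[OF assms(4), of "field_of \<tau> d" "field_slope \<tau> d"] field_of_has_derivative[OF assms(1,2)]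
    by blast
  then have "w * field_slope \<tau> d \<xi> > 0" using assms(5) by simp
  then have "field_slope \<tau> d \<xi> > 0" using assms(4) by (simp add: zero_less_mult_iff)
  then show ?thesis using field_slope_mono[OF assms(1-3), of \<xi> w] \<xi> by simp
qed

lemma field_slope_pos:
  assumes "0 \<le> \<tau>" "\<tau> < 1" "d \<ge> 1" "regular_param \<tau> d w"
  shows "field_slope \<tau> d w > 0"
  using assms(4) unfolding regular_param_def
proof (elim disjE conjE)
  assume a: "(real d - 1) * \<tau> < 1"
  have q: "(1 - (tanh w)\<^sup>2) / (1 - \<tau>\<^sup>2 * (tanh w)\<^sup>2) \<le> 1"
  proof -
    have "\<tau>\<^sup>2 * (tanh w)\<^sup>2 \<le> 1 * (tanh w)\<^sup>2"
      using assms by (intro mult_right_mono) (auto simp: power_le_one)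
    then show ?thesis using tau_tanh_bounds(1)[OF assms(1,2), of w] by (simp add: divide_le_eq)
  qed
  have "(real d - 1) * \<tau> * ((1 - (tanh w)\<^sup>2) / (1 - \<tau>\<^sup>2 * (tanh w)\<^sup>2)) \<le> (real d - 1) * \<tau> * 1"
    using assms q by (intro mult_left_mono) auto
  then show ?thesis using a by (simp add: field_slope_def)
next
  assume "w < 0" "field_of \<tau> d w < 0"
  then show ?thesis
    using field_slope_pos_aux[of \<tau> d "- w"] assms by (simp add: field_of_minus field_slope_minus)
qed (use field_slope_pos_aux assms in blast)

lemma field_of_strict_mono_aux:
  assumes "0 \<le> \<tau>" "\<tau> < 1" "d \<ge> 1" "0 < v" "field_of \<tau> d v > 0" "v < w"
  shows "field_of \<tau> d v < field_of \<tau> d w"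
proof -
  obtain \<xi> where \<xi>: "v < \<xi>" "\<xi> < w" "field_of \<tau> d w - field_of \<tau> d v = (w - v) * field_slope \<tau> d \<xi>"
    using MVT2[OF assms(6), of "field_of \<tau> d" "field_slope \<tau> d"] field_of_has_derivative[OF assms(1,2)]
    by blast
  have "field_slope \<tau> d \<xi> > 0"
    using field_slope_pos_aux[OF assms(1-5)] field_slope_mono[OF assms(1-3), of v \<xi>] \<xi> assms by simp
  then have "(w - v) * field_slope \<tau> d \<xi> > 0" using assms by simp
  then show ?thesis using \<xi> by simp
qed

lemma field_of_strict_mono_small:
  assumes "0 \<le> \<tau>" "\<tau> < 1" "d \<ge> 1" "(real d - 1) * \<tau> < 1" "v < w"
  shows "field_of \<tau> d v < field_of \<tau> d w"
proof (rule DERIV_pos_imp_increasing[OF assms(5)])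
  fix x
  show "\<exists>y. (field_of \<tau> d has_real_derivative y) (at x) \<and> 0 < y"
    using field_of_has_derivative[OF assms(1,2)] field_slope_pos[OF assms(1-3)] assms(4)
    by (auto simp: regular_param_def)
qed

text \<open>
  Uniqueness of the regular solution of the self-consistency equation.
\<close>

lemma field_of_inj:
  assumes "0 \<le> \<tau>" "\<tau> < 1" "d \<ge> 1" "regular_param \<tau> d v" "regular_param \<tau> d w"
    and eq: "field_of \<tau> d v = field_of \<tau> d w"
  shows "v = w"
proof (cases "(real d - 1) * \<tau> < 1")
  case True
  show ?thesis
  proof (cases v w rule: linorder_cases)
    case less
    then show ?thesis using field_of_strict_mono_small[OF assms(1-3) True less] eq by simp
  next
    case greater
    then show ?thesis using field_of_strict_mono_small[OF assms(1-3) True greater] eq by simp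
  qed
next
  case False
  have pos: "x = y"
    if "x > 0" "y > 0" "field_of \<tau> d x > 0" "field_of \<tau> d x = field_of \<tau> d y" for x y
  proof (cases x y rule: linorder_cases)
    case less
    then show ?thesis using field_of_strict_mono_aux[OF assms(1-3) that(1,3) less] that by simp
  next
    case greater
    then show ?thesis using field_of_strict_mono_aux[OF assms(1-3), of y x] that by simp
  qed
  have sign: "(x > 0 \<and> field_of \<tau> d x > 0) \<or> (x < 0 \<and> field_of \<tau> d x < 0)"
    if "regular_param \<tau> d x" for x
    using False that by (simp add: regular_param_def)
  from sign[OF assms(4)] show ?thesis
  proof
    assume v: "v > 0 \<and> field_of \<tau> d v > 0"
    then have "field_of \<tau> d w > 0" unfolding eq by (rule conjunct2)
    then have "w > 0" using sign[OF assms(5)] by linarith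
    show ?thesis by (rule pos[OF conjunct1[OF v] \<open>w > 0\<close> conjunct2[OF v] eq])
  next
    assume v: "v < 0 \<and> field_of \<tau> d v < 0"
    then have "field_of \<tau> d w < 0" unfolding eq by (rule conjunct2)
    then have "w < 0" using sign[OF assms(5)] by linarith
    have "- v = - w"
    proof (rule pos)
      show "field_of \<tau> d (- v) = field_of \<tau> d (- w)"
        unfolding field_of_minus[OF assms(1,2)] eq ..
    qed (use v \<open>w < 0\<close> in \<open>simp_all add: field_of_minus[OF assms(1,2)]\<close>)
    then show ?thesis by simp
  qed
qed

text \<open>
  The correction to \<open>w\<close> in the field is bounded by \<open>(d - 1) * artanh \<tau>\<close>, so the intermediate
  value theorem applies.
\<close>

lemma field_of_surj_pos:
  assumes "0 \<le> \<tau>" "\<tau> < 1" "d \<ge> 1" "b > 0"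
  shows "\<exists>w>0. field_of \<tau> d w = b"
proof -
  define M where "M = b + (real d - 1) * artanh \<tau>"
  have art: "artanh (\<tau> * tanh w) \<le> artanh \<tau>" if "w \<ge> 0" for w
  proof -
    have "\<tau> * tanh w \<le> \<tau> * 1" using assms tanh_real_lt_1[of w] by (intro mult_left_mono) auto
    moreover have "0 \<le> \<tau> * tanh w" using assms that by simp
    ultimately show ?thesis
      unfolding artanh_def using assms by (auto intro!: divide_right_mono ln_mono frac_le divide_pos_pos)
  qed
  have "0 \<le> artanh \<tau>" using art[of 0] by (simp add: artanh_def)
  then have M: "M > 0" using assms unfolding M_def by (simp add: add_pos_nonneg)
  have "(real d - 1) * artanh (\<tau> * tanh M) \<le> (real d - 1) * artanh \<tau>"
    using art[of M] M assms by (intro mult_left_mono) auto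
  then have "b \<le> field_of \<tau> d M" by (simp add: field_of_def M_def)
  moreover have "isCont (field_of \<tau> d) x" for x
    using field_of_has_derivative[OF assms(1,2)] DERIV_isCont by blast
  ultimately obtain w where "0 \<le> w" "field_of \<tau> d w = b"
    using IVT[of "field_of \<tau> d" 0 b M] M assms by auto
  then show ?thesis using assms(4) by (metis field_of_0 less_eq_real_def less_irrefl)
qed

lemma field_of_surj:
  assumes "0 \<le> \<tau>" "\<tau> < 1" "d \<ge> 1" "b \<noteq> 0 \<or> (real d - 1) * \<tau> < 1"
  shows "\<exists>w. regular_param \<tau> d w \<and> field_of \<tau> d w = b"
proof -
  consider "b > 0" | "b < 0" | "b = 0" "(real d - 1) * \<tau> < 1" using assms(4) by linarith
  then show ?thesis
  proof cases
    case 1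
    then show ?thesis using field_of_surj_pos[OF assms(1-3)] by (auto simp: regular_param_def)
  next
    case 2
    then obtain w where "w > 0" "field_of \<tau> d w = - b" using field_of_surj_pos[OF assms(1-3), of "- b"] by auto
    then have "field_of \<tau> d (- w) = b" by (simp add: field_of_minus assms(1,2))
    with \<open>w > 0\<close> 2 have "regular_param \<tau> d (- w) \<and> field_of \<tau> d (- w) = b"
      by (simp add: regular_param_def)
    then show ?thesis by blast
  next
    case 3
    then have "regular_param \<tau> d 0 \<and> field_of \<tau> d 0 = b" by (simp add: regular_param_def)
    then show ?thesis by blast
  qed
qed

lemma open_regular_param:
  assumes "0 \<le> \<tau>" "\<tau> < 1"
  shows "open {w. regular_param \<tau> d w}"
  unfolding regular_param_def
  by (intro open_Collect_disj open_Collect_conj open_Collect_less continuous_intros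
      continuous_on_field_of assms)

section \<open>The global maximum of the envelope\<close>

text \<open>
  A nonnegative bound for the modulus of the weight. The two agree where both half-edge forms are
  nonnegative, and for odd \<open>D\<close> they can differ elsewhere.
\<close>

definition envelope :: "real \<Rightarrow> nat \<Rightarrow> real \<Rightarrow> real \<Rightarrow> real" where
  "envelope r D b \<theta> =
     exp b * \<bar>cos \<theta> + r * sin \<theta>\<bar> ^ D + exp (- b) * \<bar>cos \<theta> - r * sin \<theta>\<bar> ^ D"

definition opt_angle :: "real \<Rightarrow> real \<Rightarrow> real" where
  "opt_angle r w = arctan (r * tanh w)"

lemma envelope_nonneg: "envelope r D b \<theta> \<ge> 0"
  by (simp add: envelope_def)

lemma continuous_on_envelope: "continuous_on S (envelope r D b)"
  unfolding envelope_def[abs_def] by (intro continuous_intros)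

lemma envelope_periodic: "envelope r D b (\<theta> + pi) = envelope r D b \<theta>"
proof -
  have "\<bar>- cos \<theta> - r * sin \<theta>\<bar> = \<bar>cos \<theta> + r * sin \<theta>\<bar>" "\<bar>- cos \<theta> + r * sin \<theta>\<bar> = \<bar>cos \<theta> - r * sin \<theta>\<bar>"
    by linarith+
  then show ?thesis by (simp add: envelope_def)
qed

lemma envelope_reduce: "\<exists>\<phi>\<in>{-(pi/2)..pi/2}. envelope r D b \<phi> = envelope r D b \<theta>"
proof -
  have per: "envelope r D b (x + of_int k * pi) = envelope r D b x" for x k
  proof (induction k rule: int_induct[where k = 0])
    case (step1 i)
    then show ?case using envelope_periodic[of r D b "x + of_int i * pi"] by (simp add: algebra_simps)
  next
    case (step2 i)
    then show ?case using envelope_periodic[of r D b "x + of_int (i - 1) * pi"] by (simp add: algebra_simps)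
  qed simp
  define k where "k = \<lfloor>\<theta> / pi + 1/2\<rfloor>"
  have "real_of_int k \<le> \<theta> / pi + 1/2" "\<theta> / pi + 1/2 < real_of_int k + 1"
    unfolding k_def by linarith+
  then have "real_of_int k * pi \<le> \<theta> + pi/2" "\<theta> + pi/2 < (real_of_int k + 1) * pi"
    by (simp_all add: field_simps)
  then have "\<theta> + of_int (- k) * pi \<in> {-(pi/2)..pi/2}" by (simp add: algebra_simps)
  then show ?thesis using per[of \<theta> "- k"] by blast
qed

text \<open>
  The envelope is homogeneous of degree \<open>D\<close> in \<open>(cos \<theta>, sin \<theta>)\<close>: a point inside the unit disc
  with forms at least as large in modulus becomes strictly better after it is scaled to the circle.
\<close>

lemma envelope_improve:
  assumes "\<bar>c + r * s\<bar> \<ge> \<bar>cos \<theta> + r * sin \<theta>\<bar>" "\<bar>c - r * s\<bar> \<ge> \<bar>cos \<theta> - r * sin \<theta>\<bar>"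
    and "c\<^sup>2 + s\<^sup>2 < 1" "D \<ge> 1" "envelope r D b \<theta> > 0"
  shows "\<exists>\<phi>. envelope r D b \<phi> > envelope r D b \<theta>"
proof -
  obtain \<rho> \<phi> where p: "c = \<rho> * cos \<phi>" "s = \<rho> * sin \<phi>" using polar_Ex by blast
  have "c\<^sup>2 + s\<^sup>2 = \<rho>\<^sup>2 * ((sin \<phi>)\<^sup>2 + (cos \<phi>)\<^sup>2)" unfolding p by algebra
  then have "\<rho>\<^sup>2 < 1" using assms(3) by simp
  then have rho: "\<bar>\<rho>\<bar> < 1" by (simp add: abs_square_less_1)
  have f: "\<bar>c + r * s\<bar> = \<bar>\<rho>\<bar> * \<bar>cos \<phi> + r * sin \<phi>\<bar>" "\<bar>c - r * s\<bar> = \<bar>\<rho>\<bar> * \<bar>cos \<phi> - r * sin \<phi>\<bar>"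
    unfolding p abs_mult[symmetric] by (simp_all add: algebra_simps)
  have "envelope r D b \<theta> \<le> exp b * \<bar>c + r * s\<bar> ^ D + exp (- b) * \<bar>c - r * s\<bar> ^ D"
    unfolding envelope_def using assms(1,2) by (intro add_mono mult_left_mono power_mono) auto
  also have "\<dots> = \<bar>\<rho>\<bar> ^ D * envelope r D b \<phi>"
    unfolding f envelope_def by (simp add: power_mult_distrib algebra_simps)
  finally have le: "envelope r D b \<theta> \<le> \<bar>\<rho>\<bar> ^ D * envelope r D b \<phi>" .
  have "\<bar>\<rho>\<bar> ^ D < 1" using rho assms(4) by (simp add: power_less_one_iff)
  moreover have "envelope r D b \<phi> > 0"
    using le assms(5) envelope_nonneg[of r D b \<phi>] by (cases "envelope r D b \<phi> = 0") auto
  ultimately have "\<bar>\<rho>\<bar> ^ D * envelope r D b \<phi> < 1 * envelope r D b \<phi>"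
    by (intro mult_strict_right_mono)
  with le show ?thesis by (intro exI[of _ \<phi>]) linarith
qed

text \<open>
  In the coordinates \<open>p = cos \<theta> + r sin \<theta>\<close>, \<open>q = cos \<theta> - r sin \<theta>\<close> the squared radius is a
  quadratic form whose mixed coefficient is negative because \<open>r < 1\<close>. Replacing \<open>p\<close>, \<open>q\<close> by their
  moduli, or a vanishing one by a small positive number, therefore decreases the radius without
  decreasing the envelope.
\<close>

lemma envelope_not_max_if_opposite_signs:
  assumes r: "0 \<le> r" "r < 1" and D: "D \<ge> 1" and pos: "envelope r D b \<theta> > 0"
    and opp: "(cos \<theta> + r * sin \<theta>) * (cos \<theta> - r * sin \<theta>) \<le> 0"
  shows "\<exists>\<phi>. envelope r D b \<phi> > envelope r D b \<theta>"
proof -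
  define p q where "p = \<bar>cos \<theta> + r * sin \<theta>\<bar>" and "q = \<bar>cos \<theta> - r * sin \<theta>\<bar>"
  have cs: "(cos \<theta>)\<^sup>2 + (sin \<theta>)\<^sup>2 = 1" by simp
  have pq: "p * q = - ((cos \<theta> + r * sin \<theta>) * (cos \<theta> - r * sin \<theta>))"
    using opp unfolding p_def q_def abs_mult[symmetric] by simp
  have sq: "p\<^sup>2 = (cos \<theta> + r * sin \<theta>)\<^sup>2" "q\<^sup>2 = (cos \<theta> - r * sin \<theta>)\<^sup>2"
    unfolding p_def q_def by simp_all
  have nn: "p \<ge> 0" "q \<ge> 0" by (simp_all add: p_def q_def)
  have r0: "r > 0"
  proof (rule ccontr)
    assume "\<not> r > 0"
    then have "r = 0" using r by simp
    then have "cos \<theta> = 0" using opp by (auto simp: mult_le_0_iff)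
    then show False using pos D \<open>r = 0\<close> by (simp add: envelope_def power_0_left)
  qed
  have r2: "r\<^sup>2 < 1" using r by (simp add: power_less_one_iff)
  \<comment> \<open>the last hypothesis says that the point with forms \<open>p'\<close>, \<open>q'\<close> lies inside the unit disc\<close>
  have go: ?thesis if "p' \<ge> p" "q' \<ge> q" "r\<^sup>2 * (p' + q')\<^sup>2 + (p' - q')\<^sup>2 < 4 * r\<^sup>2" for p' q'
  proof (rule envelope_improve[where c = "(p' + q') / 2" and s = "(p' - q') / (2 * r)"])
    have eq: "(p' + q') / 2 + r * ((p' - q') / (2 * r)) = p'" "(p' + q') / 2 - r * ((p' - q') / (2 * r)) = q'"
      using r0 by (simp_all add: field_simps)
    show "\<bar>(p' + q') / 2 + r * ((p' - q') / (2 * r))\<bar> \<ge> \<bar>cos \<theta> + r * sin \<theta>\<bar>"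
      "\<bar>(p' + q') / 2 - r * ((p' - q') / (2 * r))\<bar> \<ge> \<bar>cos \<theta> - r * sin \<theta>\<bar>"
      unfolding eq using that p_def q_def by linarith+
    have "((p' + q') / 2)\<^sup>2 + ((p' - q') / (2 * r))\<^sup>2 = (r\<^sup>2 * (p' + q')\<^sup>2 + (p' - q')\<^sup>2) / (4 * r\<^sup>2)"
      using r0 by (simp only: power_divide power_mult_distrib) (simp add: field_simps)
    then show "((p' + q') / 2)\<^sup>2 + ((p' - q') / (2 * r))\<^sup>2 < 1"
      using that(3) r0 by simp
  qed (use D pos in auto)
  have base: "r\<^sup>2 * (p - q)\<^sup>2 + (p + q)\<^sup>2 = 4 * r\<^sup>2"
  proof -
    have "r\<^sup>2 * (p - q)\<^sup>2 + (p + q)\<^sup>2 = (1 + r\<^sup>2) * (p\<^sup>2 + q\<^sup>2) + 2 * (1 - r\<^sup>2) * (p * q)"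
      by algebra
    also have "\<dots> = 4 * r\<^sup>2 * ((cos \<theta>)\<^sup>2 + (sin \<theta>)\<^sup>2)"
      unfolding sq pq by algebra
    finally show ?thesis unfolding cs by simp
  qed
  consider "p * q > 0" | "q = 0" "p > 0" | "p = 0" "q > 0" | "p = 0" "q = 0"
    using nn by (metis less_eq_real_def mult_pos_pos)
  then show ?thesis
  proof cases
    case 1
    have "r\<^sup>2 * (p + q)\<^sup>2 + (p - q)\<^sup>2 = 4 * r\<^sup>2 - 4 * (1 - r\<^sup>2) * (p * q)"
      unfolding base[symmetric] by algebra
    moreover have "(1 - r\<^sup>2) * (p * q) > 0" using 1 r2 by simp
    ultimately have "r\<^sup>2 * (p + q)\<^sup>2 + (p - q)\<^sup>2 < 4 * r\<^sup>2" by linarith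
    then show ?thesis by (rule go[OF order_refl order_refl])
  next
    case 2
    \<comment> \<open>the minimiser of the squared radius in the second coordinate\<close>
    define e where "e = p * (1 - r\<^sup>2) / (1 + r\<^sup>2)"
    have e: "e > 0" "(1 + r\<^sup>2) * e = p * (1 - r\<^sup>2)" 
      using 2 r2 by (auto simp: e_def add_pos_nonneg field_simps add_nonneg_eq_0_iff)
    have "r\<^sup>2 * (p + e)\<^sup>2 + (p - e)\<^sup>2 = r\<^sup>2 * p\<^sup>2 + p\<^sup>2 + e * ((1 + r\<^sup>2) * e - 2 * (p * (1 - r\<^sup>2)))"
      by algebra
    also have "\<dots> < r\<^sup>2 * p\<^sup>2 + p\<^sup>2"
      unfolding e(2) using 2 r2 e(1) by (simp add: mult_pos_neg)
    also have "\<dots> = 4 * r\<^sup>2" using base 2 by simp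
    finally show ?thesis using 2 e by (intro go[of p e]) auto
  next
    case 3
    define e where "e = q * (1 - r\<^sup>2) / (1 + r\<^sup>2)"
    have e: "e > 0" "(1 + r\<^sup>2) * e = q * (1 - r\<^sup>2)" 
      using 3 r2 by (auto simp: e_def add_pos_nonneg field_simps add_nonneg_eq_0_iff)
    have "r\<^sup>2 * (e + q)\<^sup>2 + (e - q)\<^sup>2 = r\<^sup>2 * q\<^sup>2 + q\<^sup>2 + e * ((1 + r\<^sup>2) * e - 2 * (q * (1 - r\<^sup>2)))"
      by algebra
    also have "\<dots> < r\<^sup>2 * q\<^sup>2 + q\<^sup>2"
      unfolding e(2) using 3 r2 e(1) by (simp add: mult_pos_neg)
    also have "\<dots> = 4 * r\<^sup>2" using base 3 by simp
    finally show ?thesis using 3 e by (intro go[of e q]) auto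
  next
    case 4
    then show ?thesis using base r0 by simp
  qed
qed

lemma tanh_artanh_eq:
  fixes x :: real
  assumes "\<bar>x\<bar> < 1" shows "tanh (artanh x) = x"
proof -
  define y where "y = (1 + x) / (1 - x)"
  have y: "y > 0" using assms by (auto simp: y_def)
  have "artanh x = ln (sqrt y)" using y by (simp add: artanh_def y_def ln_sqrt)
  then have "tanh (artanh x) = (y - 1) / (y + 1)" using y by (simp add: tanh_ln_real)
  also have "\<dots> = x" using assms by (auto simp: y_def field_simps)
  finally show ?thesis .
qed

text \<open>
  At a maximum both forms are positive, so the envelope is smooth there and its derivative
  vanishes; with \<open>tan \<theta> = r * tanh w\<close> the logarithm of this equation is \<open>field_of (r\<^sup>2) d w = b\<close>.
  The sign of \<open>w\<close> follows by comparing \<open>\<theta>\<close> with \<open>- \<theta>\<close>.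
\<close>

lemma envelope_max_critical:
  assumes r: "0 \<le> r" "r < 1" and d: "d \<ge> 2"
    and max: "\<And>\<phi>. envelope r d b \<phi> \<le> envelope r d b \<theta>"
    and th: "\<theta> \<in> {-(pi/2)..pi/2}"
  shows "\<exists>w. field_of (r\<^sup>2) d w = b \<and> \<theta> = opt_angle r w \<and> (b > 0 \<and> r > 0 \<longrightarrow> w \<ge> 0) \<and> (b < 0 \<and> r > 0 \<longrightarrow> w \<le> 0)"
proof -
  have "envelope r d b 0 > 0" by (simp add: envelope_def add_pos_pos)
  then have pos: "envelope r d b \<theta> > 0" using max[of 0] by simp
  define x y where "x = cos \<theta> + r * sin \<theta>" and "y = cos \<theta> - r * sin \<theta>"
  have "x * y > 0"
    using envelope_not_max_if_opposite_signs[OF r _ pos] max d unfolding x_def y_def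
    by (metis linorder_not_less order.strict_trans2 one_le_numeral order_trans)
  moreover have c0: "cos \<theta> \<ge> 0" using th by (intro cos_ge_zero) auto
  then have "x + y \<ge> 0" by (simp add: x_def y_def)
  ultimately have xy: "x > 0" "y > 0" by (auto simp: zero_less_mult_iff)
  then have c: "cos \<theta> > 0" unfolding x_def y_def by linarith
  then have "\<theta> \<noteq> pi/2" "\<theta> \<noteq> -(pi/2)" by (metis cos_pi_half cos_minus less_irrefl)+
  then have th': "-(pi/2) < \<theta>" "\<theta> < pi/2"
    using th by auto
  \<comment> \<open>near \<open>\<theta>\<close> both forms are positive and the envelope is the smooth function \<open>Q\<close>\<close>
  define Q where "Q = (\<lambda>\<phi>. exp b * (cos \<phi> + r * sin \<phi>) ^ d + exp (- b) * (cos \<phi> - r * sin \<phi>) ^ d)"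
  define Q' where "Q' = exp b * (real d * x ^ (d - 1) * (- sin \<theta> + r * cos \<theta>))
     + exp (- b) * (real d * y ^ (d - 1) * (- sin \<theta> - r * cos \<theta>))"
  have Q': "(Q has_real_derivative Q') (at \<theta>)"
    unfolding Q_def Q'_def x_def y_def
    by (auto intro!: derivative_eq_intros simp: algebra_simps)
  have "open {\<phi>. cos \<phi> + r * sin \<phi> > 0 \<and> cos \<phi> - r * sin \<phi> > 0}"
    by (intro open_Collect_conj open_Collect_less continuous_intros)
  then obtain e where e: "e > 0" "\<And>\<phi>. dist \<phi> \<theta> < e \<Longrightarrow> cos \<phi> + r * sin \<phi> > 0 \<and> cos \<phi> - r * sin \<phi> > 0"
    using xy unfolding open_dist x_def y_def by blast
  have QA: "Q \<phi> = envelope r d b \<phi>" if "dist \<phi> \<theta> < e" for \<phi>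
    using e(2)[OF that] by (simp add: Q_def envelope_def)
  have "Q' = 0"
  proof (rule DERIV_local_max[OF Q' e(1)])
    show "\<forall>\<phi>. \<bar>\<theta> - \<phi>\<bar> < e \<longrightarrow> Q \<phi> \<le> Q \<theta>"
      using max QA e(1) by (simp add: dist_real_def abs_minus_commute)
  qed
  define v where "v = tan \<theta>"
  have s: "sin \<theta> = cos \<theta> * v" using c by (simp add: v_def tan_def)
  have xv: "x = cos \<theta> * (1 + r * v)" "y = cos \<theta> * (1 - r * v)"
    by (simp_all add: x_def y_def s algebra_simps)
  have rv: "1 + r * v > 0" "1 - r * v > 0" using xy c unfolding xv by (simp_all add: zero_less_mult_iff)
  have crit: "exp b * (1 + r * v) ^ (d - 1) * (r - v) = exp (- b) * (1 - r * v) ^ (d - 1) * (r + v)"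
  proof -
    have "Q' = real d * cos \<theta> ^ (d - 1) * cos \<theta> *
      (exp b * (1 + r * v) ^ (d - 1) * (r - v) - exp (- b) * (1 - r * v) ^ (d - 1) * (r + v))"
      unfolding Q'_def xv s power_mult_distrib by (simp add: algebra_simps)
    then show ?thesis using \<open>Q' = 0\<close> c d by simp
  qed
  have thv: "\<theta> = arctan v" unfolding v_def using th' by (simp add: arctan_tan)
  show ?thesis
  proof (cases "r = 0")
    case True
    then have "exp b * (- v) = exp (- b) * v" using crit by simp
    then have "(exp b + exp (- b)) * v = 0" by (simp add: algebra_simps)
    moreover have "exp b + exp (- b) > 0" by (simp add: add_pos_pos)
    ultimately have "v = 0" by simp
    then show ?thesis using True thv by (auto simp: field_of_def opt_angle_def artanh_def)
  next
    case False
    with r have r0: "r > 0" by simp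
    have E: "exp b * (1 + r * v) ^ (d - 1) > 0" "exp (- b) * (1 - r * v) ^ (d - 1) > 0" using rv by auto
    have vr: "r - v > 0" "r + v > 0"
    proof -
      have "r - v > 0 \<longleftrightarrow> r + v > 0"
        using crit E by (metis zero_less_mult_iff not_less_iff_gr_or_eq)
      then show "r - v > 0" "r + v > 0" using r0 by linarith+
    qed
    define w where "w = artanh (v / r)"
    have vra: "\<bar>v / r\<bar> < 1" using vr r0 by (auto simp: abs_less_iff field_simps)
    have tw: "tanh w = v / r" unfolding w_def using vra by (rule tanh_artanh_eq)
    have v: "v = r * tanh w" using tw r0 by simp
    have e1: "ln ((r + v) / (r - v)) = 2 * b + real (d - 1) * ln ((1 + r * v) / (1 - r * v))"
    proof -
      have "ln (exp b * (1 + r * v) ^ (d - 1) * (r - v)) = b + real (d - 1) * ln (1 + r * v) + ln (r - v)"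
        using rv vr by (simp add: ln_mult ln_realpow)
      moreover have "ln (exp (- b) * (1 - r * v) ^ (d - 1) * (r + v)) = - b + real (d - 1) * ln (1 - r * v) + ln (r + v)"
        using rv vr by (simp add: ln_mult ln_realpow)
      ultimately show ?thesis using crit rv vr by (simp add: ln_div algebra_simps)
    qed
    have "(1 + v / r) / (1 - v / r) = (r + v) / (r - v)" using r0 vr by (simp add: field_simps)
    then have w2: "w = ln ((r + v) / (r - v)) / 2" by (simp add: w_def artanh_def)
    have "r\<^sup>2 * tanh w = r * v" using tw r0 by (simp add: power2_eq_square)
    then have "field_of (r\<^sup>2) d w = w - real (d - 1) * (ln ((1 + r * v) / (1 - r * v)) / 2)"
      using d by (simp add: field_of_def artanh_def of_nat_diff)
    also have "\<dots> = b" unfolding w2 e1 by (simp add: add_divide_distrib)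
    finally have fw: "field_of (r\<^sup>2) d w = b" .
    \<comment> \<open>\<open>\<theta>\<close> is at least as good as \<open>- \<theta>\<close>\<close>
    have ref: "(exp b - exp (- b)) * (y ^ d - x ^ d) \<le> 0"
    proof -
      have "envelope r d b (- \<theta>) - envelope r d b \<theta> = (exp b - exp (- b)) * (y ^ d - x ^ d)"
        using xy by (simp add: envelope_def algebra_simps flip: x_def y_def)
      then show ?thesis using max[of "- \<theta>"] by simp
    qed
    have yx: "y - x = - 2 * r * cos \<theta> * v" by (simp add: xv algebra_simps)
    have rc: "r * cos \<theta> > 0" using r0 c by simp
    have "w \<ge> 0" if "b > 0"
    proof -
      have "y ^ d \<le> x ^ d" using ref that by (simp add: mult_le_0_iff)
      then have "y \<le> x" using xy d by (simp add: power_mono_iff)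
      then have "r * cos \<theta> * v \<ge> 0" using yx by simp
      then have "v \<ge> 0" using rc by (auto simp: zero_le_mult_iff)
      then show ?thesis using v r0 by (simp add: zero_le_mult_iff)
    qed
    moreover have "w \<le> 0" if "b < 0"
    proof -
      have "x ^ d \<le> y ^ d" using ref that by (simp add: mult_le_0_iff)
      then have "x \<le> y" using xy d by (simp add: power_mono_iff)
      then have "r * cos \<theta> * v \<le> 0" using yx by simp
      then have "v \<le> 0" using mult_pos_pos[OF rc, of v] by linarith
      then show ?thesis using v r0 by (simp add: mult_le_0_iff)
    qed
    ultimately show ?thesis using fw thv v by (auto simp: opt_angle_def)
  qed
qed

text \<open>
  A maximiser exists by compactness, and every maximiser has a regular parameter with the given
  field.
\<close>

lemma envelope_unique_max:
  assumes r: "0 \<le> r" "r < 1" and d: "d \<ge> 2" and reg: "regular_param (r\<^sup>2) d w"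
    and th: "\<theta> \<in> {-(pi/2)..pi/2}" "\<theta> \<noteq> opt_angle r w"
  shows "envelope r d (field_of (r\<^sup>2) d w) \<theta> < envelope r d (field_of (r\<^sup>2) d w) (opt_angle r w)"
proof -
  let ?b = "field_of (r\<^sup>2) d w"
  have r2: "0 \<le> r\<^sup>2" "r\<^sup>2 < 1" using r by (auto simp: power_less_one_iff)
  have unique: "\<phi> = opt_angle r w"
    if phi: "\<phi> \<in> {-(pi/2)..pi/2}" "\<And>\<psi>. envelope r d ?b \<psi> \<le> envelope r d ?b \<phi>" for \<phi>
  proof -
    obtain v where v: "field_of (r\<^sup>2) d v = ?b" "\<phi> = opt_angle r v"
        "?b > 0 \<and> r > 0 \<longrightarrow> v \<ge> 0" "?b < 0 \<and> r > 0 \<longrightarrow> v \<le> 0"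
      using envelope_max_critical[OF r d phi(2,1)] by blast
    have "regular_param (r\<^sup>2) d v"
    proof (cases "(real d - 1) * r\<^sup>2 < 1")
      case False
      then have "r \<noteq> 0" by auto
      moreover have "v \<noteq> 0" if "?b \<noteq> 0" using v(1) that field_of_0 by metis
      ultimately show ?thesis using reg v False r unfolding regular_param_def v(1) by force
    qed (simp add: regular_param_def)
    then have "v = w" using field_of_inj[OF r2 _ _ reg v(1)] d by simp
    then show ?thesis using v by simp
  qed
  obtain \<phi> where \<phi>: "\<phi> \<in> {-(pi/2)..pi/2}" "\<And>\<psi>. \<psi> \<in> {-(pi/2)..pi/2} \<Longrightarrow> envelope r d ?b \<psi> \<le> envelope r d ?b \<phi>"
    using continuous_attains_sup[of "{-(pi/2)..pi/2}" "envelope r d ?b"] continuous_on_envelope by auto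
  have all: "envelope r d ?b \<psi> \<le> envelope r d ?b \<phi>" for \<psi>
    using envelope_reduce[of r d ?b \<psi>] \<phi>(2) by force
  have eq: "\<phi> = opt_angle r w" using unique[OF \<phi>(1) all] .
  show ?thesis
  proof (rule ccontr)
    assume "\<not> ?thesis"
    then have "envelope r d ?b \<psi> \<le> envelope r d ?b \<theta>" for \<psi> using all[of \<psi>] unfolding eq by linarith
    then show False using unique[OF th(1)] th(2) by blast
  qed
qed

section \<open>Second-order expansions\<close>

text \<open>
  The expansion \<open>f \<epsilon> = 1 + a * \<epsilon> + b * \<epsilon>\<^sup>2 + o(\<epsilon>\<^sup>2)\<close>. It is stable under products and affine
  combinations, which avoids second derivatives of the weight.
\<close>

definition second_order :: "(real \<Rightarrow> complex) \<Rightarrow> complex \<Rightarrow> complex \<Rightarrow> bool" where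
  "second_order f a b \<longleftrightarrow>
     ((\<lambda>\<epsilon>. (f \<epsilon> - 1 - a * of_real \<epsilon>) / (of_real \<epsilon>)\<^sup>2) \<longlongrightarrow> b) (at 0)"

lemma second_order_linear_comb:
  assumes "second_order f a b" "second_order g a' b'" "p + q = 1"
  shows "second_order (\<lambda>\<epsilon>. p * f \<epsilon> + q * g \<epsilon>) (p * a + q * a') (p * b + q * b')"
proof -
  have "((\<lambda>\<epsilon>. p * ((f \<epsilon> - 1 - a * of_real \<epsilon>) / (of_real \<epsilon>)\<^sup>2) + q * ((g \<epsilon> - 1 - a' * of_real \<epsilon>) / (of_real \<epsilon>)\<^sup>2))
      \<longlongrightarrow> p * b + q * b') (at 0)"
    using assms unfolding second_order_def by (intro tendsto_intros)
  moreover have "p * ((f \<epsilon> - 1 - a * of_real \<epsilon>) / (of_real \<epsilon>)\<^sup>2) + q * ((g \<epsilon> - 1 - a' * of_real \<epsilon>) / (of_real \<epsilon>)\<^sup>2)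
    = (p * f \<epsilon> + q * g \<epsilon> - 1 - (p * a + q * a') * of_real \<epsilon>) / (of_real \<epsilon>)\<^sup>2" for \<epsilon>
  proof -
    have "p * f \<epsilon> + q * g \<epsilon> - 1 - (p * a + q * a') * of_real \<epsilon>
      = p * (f \<epsilon> - 1 - a * of_real \<epsilon>) + q * (g \<epsilon> - 1 - a' * of_real \<epsilon>) + (p + q - 1)"
      by (simp add: algebra_simps)
    then show ?thesis using assms(3) by (simp add: add_divide_distrib)
  qed
  ultimately show ?thesis unfolding second_order_def by simp
qed

lemma second_order_mult:
  assumes "second_order f a b" "second_order g a' b'"
  shows "second_order (\<lambda>\<epsilon>. f \<epsilon> * g \<epsilon>) (a + a') (b + b' + a * a')"
proof -
  define F G where "F = (\<lambda>\<epsilon>::real. (f \<epsilon> - 1 - a * of_real \<epsilon>) / (of_real \<epsilon>)\<^sup>2)"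
    and "G = (\<lambda>\<epsilon>::real. (g \<epsilon> - 1 - a' * of_real \<epsilon>) / (of_real \<epsilon>)\<^sup>2)"
  have lim: "(F \<longlongrightarrow> b) (at 0)" "(G \<longlongrightarrow> b') (at 0)"
    using assms by (simp_all add: second_order_def F_def G_def)
  have id: "((\<lambda>\<epsilon>. complex_of_real \<epsilon>) \<longlongrightarrow> 0) (at 0)"
    by (auto intro!: tendsto_eq_intros)
  have "((\<lambda>\<epsilon>. F \<epsilon> + G \<epsilon> + a * a' + of_real \<epsilon> * (a * G \<epsilon> + a' * F \<epsilon>) + of_real \<epsilon> * of_real \<epsilon> * (F \<epsilon> * G \<epsilon>))
     \<longlongrightarrow> b + b' + a * a' + 0 * (a * b' + a' * b) + 0 * 0 * (b * b')) (at 0)"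
    by (intro tendsto_intros lim id)
  moreover have "F \<epsilon> + G \<epsilon> + a * a' + of_real \<epsilon> * (a * G \<epsilon> + a' * F \<epsilon>) + of_real \<epsilon> * of_real \<epsilon> * (F \<epsilon> * G \<epsilon>)
    = (f \<epsilon> * g \<epsilon> - 1 - (a + a') * of_real \<epsilon>) / (of_real \<epsilon>)\<^sup>2" if "\<epsilon> \<noteq> 0" for \<epsilon>
  proof -
    define e where "e = complex_of_real \<epsilon>"
    have e: "e \<noteq> 0" using that by (simp add: e_def)
    have f: "f \<epsilon> = 1 + a * e + e\<^sup>2 * F \<epsilon>" and g: "g \<epsilon> = 1 + a' * e + e\<^sup>2 * G \<epsilon>"
      using e by (simp_all add: F_def G_def e_def[symmetric])
    have "f \<epsilon> * g \<epsilon> - 1 - (a + a') * e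
      = (F \<epsilon> + G \<epsilon> + a * a' + e * (a * G \<epsilon> + a' * F \<epsilon>) + e * e * (F \<epsilon> * G \<epsilon>)) * e\<^sup>2"
      unfolding f g by algebra
    then show ?thesis using e by (simp add: e_def)
  qed
  then have "\<forall>\<^sub>F \<epsilon> in at 0. F \<epsilon> + G \<epsilon> + a * a' + of_real \<epsilon> * (a * G \<epsilon> + a' * F \<epsilon>) + of_real \<epsilon> * of_real \<epsilon> * (F \<epsilon> * G \<epsilon>)
    = (f \<epsilon> * g \<epsilon> - 1 - (a + a') * of_real \<epsilon>) / (of_real \<epsilon>)\<^sup>2"
    by (auto simp: eventually_at_filter)
  ultimately show ?thesis
    unfolding second_order_def by (auto elim: Lim_transform_eventually)
qed

lemma second_order_power:
  assumes "second_order f a b"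
  shows "second_order (\<lambda>\<epsilon>. f \<epsilon> ^ n) (of_nat n * a) (of_nat n * b + of_nat (n * (n - 1)) / 2 * a\<^sup>2)"
proof (induction n)
  case 0
  then show ?case by (simp add: second_order_def)
next
  case (Suc n)
  have eq: "of_nat (n * (n - 1)) / 2 + of_nat n = (of_nat (Suc n * n) / 2 :: complex)"
    by (cases n) (simp_all add: algebra_simps add_divide_distrib)
  have "b + (of_nat n * b + of_nat (n * (n - 1)) / 2 * a\<^sup>2) + a * (of_nat n * a)
     = of_nat (Suc n) * b + (of_nat (n * (n - 1)) / 2 + of_nat n) * a\<^sup>2"
    by (simp add: algebra_simps power2_eq_square)
  also have "\<dots> = of_nat (Suc n) * b + of_nat (Suc n * (Suc n - 1)) / 2 * a\<^sup>2"
    unfolding eq by simp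
  finally have "b + (of_nat n * b + of_nat (n * (n - 1)) / 2 * a\<^sup>2) + a * (of_nat n * a) =
    of_nat (Suc n) * b + of_nat (Suc n * (Suc n - 1)) / 2 * a\<^sup>2" .
  moreover have "a + of_nat n * a = of_nat (Suc n) * a" by (simp add: algebra_simps)
  ultimately show ?case
    using second_order_mult[OF assms Suc.IH] by (simp only: power_Suc)
qed

lemma second_order_exp: "second_order (\<lambda>\<epsilon>. exp (\<alpha> * of_real \<epsilon>)) \<alpha> (\<alpha>\<^sup>2 / 2)"
  unfolding second_order_def
proof (rule LIM_zero_cancel, rule Lim_null_comparison)
  show "\<forall>\<^sub>F \<epsilon> in at (0::real). norm ((exp (\<alpha> * of_real \<epsilon>) - 1 - \<alpha> * of_real \<epsilon>) / (of_real \<epsilon>)\<^sup>2 - \<alpha>\<^sup>2 / 2)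
      \<le> exp (norm \<alpha> * \<bar>\<epsilon>\<bar>) * norm \<alpha> ^ 3 / 2 * \<bar>\<epsilon>\<bar>"
    unfolding eventually_at_filter
  proof (rule always_eventually, intro allI impI)
    fix \<epsilon> :: real assume "\<epsilon> \<noteq> 0"
    then have e: "complex_of_real \<epsilon> \<noteq> 0" by simp
    have "norm (exp (\<alpha> * of_real \<epsilon>) - (\<Sum>k\<le>2. (\<alpha> * of_real \<epsilon>) ^ k / fact k)) \<le>
       exp (norm (\<alpha> * of_real \<epsilon>)) * norm (\<alpha> * of_real \<epsilon>) ^ 3 / 2"
      using Taylor_exp_field[of "\<alpha> * of_real \<epsilon>" 2] by (simp add: eval_nat_numeral)
    also have "(\<Sum>k\<le>2. (\<alpha> * of_real \<epsilon>) ^ k / fact k) = 1 + \<alpha> * of_real \<epsilon> + \<alpha>\<^sup>2 / 2 * (of_real \<epsilon>)\<^sup>2"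
      by (simp add: eval_nat_numeral power_mult_distrib)
    finally have le: "norm (exp (\<alpha> * of_real \<epsilon>) - (1 + \<alpha> * of_real \<epsilon> + \<alpha>\<^sup>2 / 2 * (of_real \<epsilon>)\<^sup>2)) \<le>
       exp (norm \<alpha> * \<bar>\<epsilon>\<bar>) * norm \<alpha> ^ 3 / 2 * \<bar>\<epsilon>\<bar> * \<bar>\<epsilon>\<bar>\<^sup>2"
      by (simp add: norm_mult power_mult_distrib eval_nat_numeral mult_ac)
    have "(exp (\<alpha> * of_real \<epsilon>) - 1 - \<alpha> * of_real \<epsilon>) / (of_real \<epsilon>)\<^sup>2 - \<alpha>\<^sup>2 / 2
      = (exp (\<alpha> * of_real \<epsilon>) - (1 + \<alpha> * of_real \<epsilon> + \<alpha>\<^sup>2 / 2 * (of_real \<epsilon>)\<^sup>2)) / (of_real \<epsilon>)\<^sup>2"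
      using e by (simp add: diff_divide_distrib add_divide_distrib)
    then have "norm ((exp (\<alpha> * of_real \<epsilon>) - 1 - \<alpha> * of_real \<epsilon>) / (of_real \<epsilon>)\<^sup>2 - \<alpha>\<^sup>2 / 2)
      = norm (exp (\<alpha> * of_real \<epsilon>) - (1 + \<alpha> * of_real \<epsilon> + \<alpha>\<^sup>2 / 2 * (of_real \<epsilon>)\<^sup>2)) / \<bar>\<epsilon>\<bar>\<^sup>2"
      by (simp only: norm_divide norm_power norm_of_real)
    also have "\<dots> \<le> exp (norm \<alpha> * \<bar>\<epsilon>\<bar>) * norm \<alpha> ^ 3 / 2 * \<bar>\<epsilon>\<bar>"
      using le \<open>\<epsilon> \<noteq> 0\<close> by (simp add: divide_le_eq)
    finally show "norm ((exp (\<alpha> * of_real \<epsilon>) - 1 - \<alpha> * of_real \<epsilon>) / (of_real \<epsilon>)\<^sup>2 - \<alpha>\<^sup>2 / 2)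
      \<le> exp (norm \<alpha> * \<bar>\<epsilon>\<bar>) * norm \<alpha> ^ 3 / 2 * \<bar>\<epsilon>\<bar>" .
  qed
  show "((\<lambda>\<epsilon>. exp (norm \<alpha> * \<bar>\<epsilon>\<bar>) * norm \<alpha> ^ 3 / 2 * \<bar>\<epsilon>\<bar>) \<longlongrightarrow> 0) (at 0)"
    by (auto intro!: tendsto_eq_intros)
qed

text \<open>
  The rotation is an affine combination of two exponentials.
\<close>

lemma second_order_rotation:
  "second_order (\<lambda>\<epsilon>. of_real (cos (x * \<epsilon>) + \<kappa> * sin (x * \<epsilon>))) (of_real (\<kappa> * x)) (of_real (- (x\<^sup>2 / 2)))"
proof -
  define p q where "p = (1 - \<i> * of_real \<kappa>) / 2" and "q = (1 + \<i> * of_real \<kappa>) / 2"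
  have "second_order (\<lambda>\<epsilon>. p * exp (\<i> * of_real x * of_real \<epsilon>) + q * exp (- (\<i> * of_real x) * of_real \<epsilon>))
     (p * (\<i> * of_real x) + q * (- (\<i> * of_real x)))
     (p * ((\<i> * of_real x)\<^sup>2 / 2) + q * ((- (\<i> * of_real x))\<^sup>2 / 2))"
    by (intro second_order_linear_comb second_order_exp) (simp add: p_def q_def field_simps)
  moreover have "p * exp (\<i> * of_real x * of_real \<epsilon>) + q * exp (- (\<i> * of_real x) * of_real \<epsilon>)
      = of_real (cos (x * \<epsilon>) + \<kappa> * sin (x * \<epsilon>))" for \<epsilon>
    using Euler[of "\<i> * of_real x * of_real \<epsilon>"] Euler[of "- (\<i> * of_real x) * of_real \<epsilon>"]
    by (simp add: p_def q_def complex_eq_iff exp_of_real field_simps)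
  moreover have "p * (\<i> * of_real x) + q * (- (\<i> * of_real x)) = of_real (\<kappa> * x)"
    by (simp add: p_def q_def field_simps)
  moreover have "p * ((\<i> * of_real x)\<^sup>2 / 2) + q * ((- (\<i> * of_real x))\<^sup>2 / 2) = of_real (- (x\<^sup>2 / 2))"
    by (simp add: p_def q_def power_mult_distrib field_simps)
  ultimately show ?thesis by simp
qed

text \<open>
  Take logarithms: \<open>Ln u / (u - 1)\<close> extends continuously to \<open>u = 1\<close>.
\<close>

lemma tendsto_power_exp:
  fixes a :: "nat \<Rightarrow> complex"
  assumes "(\<lambda>n. of_nat n * (a n - 1)) \<longlonglongrightarrow> c"
  shows "(\<lambda>n. a n ^ n) \<longlonglongrightarrow> exp c" "a \<longlonglongrightarrow> 1"
proof -
  have "(\<lambda>n. of_nat n * (a n - 1) * (1 / of_nat n)) \<longlonglongrightarrow> c * 0"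
    by (intro tendsto_mult assms lim_1_over_n)
  moreover have "\<forall>\<^sub>F n in sequentially. of_nat n * (a n - 1) * (1 / of_nat n) = a n - 1"
    using eventually_gt_at_top[of 0] by eventually_elim simp
  ultimately have "(\<lambda>n. a n - 1) \<longlonglongrightarrow> 0"
    by (auto elim: Lim_transform_eventually)
  then show a1: "a \<longlonglongrightarrow> 1" by (simp add: LIM_zero_iff)
  define \<phi> where "\<phi> = (\<lambda>u::complex. if u = 1 then 1 else Ln u / (u - 1))"
  have "(Ln has_field_derivative 1) (at 1)"
    using has_field_derivative_Ln[of 1] by (simp add: complex_nonpos_Reals_iff)
  then have "((\<lambda>u. (Ln u - Ln 1) / (u - 1)) \<longlongrightarrow> 1) (at 1)"
    by (simp add: has_field_derivative_iff)
  then have "(\<phi> \<longlongrightarrow> \<phi> 1) (at 1)"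
    by (rule Lim_transform_eventually[OF tendsto_eq_rhs]) (auto simp: \<phi>_def eventually_at_filter)
  then have "isCont \<phi> 1" by (simp add: isCont_def)
  then have "(\<lambda>n. \<phi> (a n)) \<longlonglongrightarrow> \<phi> 1" using a1 by (rule isCont_tendsto_compose)
  then have "(\<lambda>n. exp (of_nat n * (a n - 1) * \<phi> (a n))) \<longlonglongrightarrow> exp (c * \<phi> 1)"
    by (intro tendsto_intros assms)
  moreover have "\<forall>\<^sub>F n in sequentially. exp (of_nat n * (a n - 1) * \<phi> (a n)) = a n ^ n"
  proof -
    have "\<forall>\<^sub>F n in sequentially. a n \<noteq> 0"
      using a1 by (intro tendsto_imp_eventually_ne) auto
    then show ?thesis
    proof eventually_elim
      case (elim n)
      have "(a n - 1) * \<phi> (a n) = Ln (a n)" by (simp add: \<phi>_def)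
      then have "exp (of_nat n * (a n - 1) * \<phi> (a n)) = exp (of_nat n * Ln (a n))"
        by (simp add: mult.assoc)
      then show ?case using elim by (simp add: exp_of_nat_mult)
    qed
  qed
  ultimately show "(\<lambda>n. a n ^ n) \<longlonglongrightarrow> exp c"
    by (auto simp: \<phi>_def elim: Lim_transform_eventually)
qed

text \<open>
  Evaluated at \<open>\<epsilon> = 1 / sqrt n\<close>, the base is \<open>1 + b / n + o(1 / n)\<close>. The exponent \<open>n - 1\<close> is the
  number of vertices before the last one.
\<close>

lemma second_order_power_limit:
  assumes "second_order f 0 b"
  shows "(\<lambda>n. f (1 / sqrt (real n)) ^ (n - 1)) \<longlonglongrightarrow> exp b"
proof -
  let ?a = "\<lambda>n. f (1 / sqrt (real n))"
  have "filterlim (\<lambda>n. 1 / sqrt (real n)) (at 0) sequentially"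
    unfolding filterlim_at
    by (auto intro!: real_tendsto_divide_at_top filterlim_compose[OF sqrt_at_top] filterlim_real_sequentially
        eventually_mono[OF eventually_gt_at_top[of 0]])
  then have "(\<lambda>n. (?a n - 1) / (of_real (1 / sqrt (real n)))\<^sup>2) \<longlonglongrightarrow> b"
    using assms unfolding second_order_def by (auto dest: filterlim_compose)
  moreover have "(?a n - 1) / (of_real (1 / sqrt (real n)))\<^sup>2 = of_nat n * (?a n - 1)" for n
  proof -
    have "(complex_of_real (1 / sqrt (real n)))\<^sup>2 = of_real (1 / real n)"
      unfolding of_real_power[symmetric] by (simp add: power_divide)
    then show ?thesis by simp
  qed
  ultimately have lim: "(\<lambda>n. of_nat n * (?a n - 1)) \<longlonglongrightarrow> b" by simp
  have "(\<lambda>n. ?a n ^ n / ?a n) \<longlonglongrightarrow> exp b / 1"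
    by (intro tendsto_divide tendsto_power_exp[OF lim]) auto
  moreover have "\<forall>\<^sub>F n in sequentially. ?a n ^ n / ?a n = ?a n ^ (n - 1)"
  proof -
    have "\<forall>\<^sub>F n in sequentially. ?a n \<noteq> 0"
      using tendsto_power_exp(2)[OF lim] by (intro tendsto_imp_eventually_ne) auto
    then show ?thesis using eventually_gt_at_top[of 0]
    proof eventually_elim
      case (elim n)
      then show ?case by (cases n) auto
    qed
  qed
  ultimately show ?thesis by (auto elim: Lim_transform_eventually)
qed

section \<open>The weight near its maximum\<close>

text \<open>
  The weight with field \<open>b + z\<close>, for spins shifted by their mean \<open>m\<close>.
\<close>

definition centered_weight :: "real \<Rightarrow> nat \<Rightarrow> real \<Rightarrow> real \<Rightarrow> complex \<Rightarrow> real \<Rightarrow> complex" where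
  "centered_weight r D b m z \<theta> = exp (- (of_real m * z)) * vertex_weight r D (of_real b + z) \<theta>"

definition opt_weight :: "real \<Rightarrow> nat \<Rightarrow> nat \<Rightarrow> real \<Rightarrow> real" where
  "opt_weight r d D w = envelope r D (field_of (r\<^sup>2) d w) (opt_angle r w)"

text \<open>
  The quadratic Taylor polynomial, in field and angle together, of the logarithm of the weight at
  its maximum.
\<close>

definition local_form :: "real \<Rightarrow> nat \<Rightarrow> real \<Rightarrow> complex \<Rightarrow> real \<Rightarrow> complex" where
  "local_form r d w z x =
    (of_real (1 - (mag_of (r\<^sup>2) w)\<^sup>2) * z\<^sup>2
     + 2 * of_real (real d * r * (1 - (tanh w)\<^sup>2) / (1 + r\<^sup>2 * (tanh w)\<^sup>2) * x) * z
     - of_real (real d * field_slope (r\<^sup>2) d w * x\<^sup>2)) / 2"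

locale optimum =
  fixes r :: real and d :: nat and w :: real
  assumes r_nonneg: "0 \<le> r" and r_less: "r < 1" and d_ge: "d \<ge> 2"
    and regular: "regular_param (r\<^sup>2) d w"
begin

abbreviation "\<tau> \<equiv> r\<^sup>2"
abbreviation "t \<equiv> tanh w"
abbreviation "b \<equiv> field_of \<tau> d w"
abbreviation "m \<equiv> mag_of \<tau> w"
abbreviation "\<theta>\<^sub>0 \<equiv> opt_angle r w"
abbreviation "slope \<equiv> field_slope \<tau> d w"

lemma tau: "0 \<le> \<tau>" "\<tau> < 1"
  using r_nonneg r_less by (auto simp: power_less_one_iff)

lemmas bounds = tau_tanh_bounds[OF tau, of w]

lemma slope_pos: "slope > 0"
  using field_slope_pos[OF tau _ regular] d_ge by simp

lemma opt_angle_range: "- (pi/2) < \<theta>\<^sub>0" "\<theta>\<^sub>0 < pi/2"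
  unfolding opt_angle_def by (rule arctan_lbound, rule arctan_ubound)

lemma cos_opt: "cos \<theta>\<^sub>0 > 0" and sin_opt: "sin \<theta>\<^sub>0 = cos \<theta>\<^sub>0 * (r * t)"
  using cos_gt_zero_pi[OF opt_angle_range] by (simp_all add: opt_angle_def cos_arctan sin_arctan)

lemma half_edge_opt:
  "cos \<theta>\<^sub>0 + r * sin \<theta>\<^sub>0 = cos \<theta>\<^sub>0 * (1 + \<tau> * t)" "cos \<theta>\<^sub>0 - r * sin \<theta>\<^sub>0 = cos \<theta>\<^sub>0 * (1 - \<tau> * t)"
  by (simp_all add: sin_opt power2_eq_square algebra_simps)

lemma half_edge_opt_pos: "cos \<theta>\<^sub>0 + r * sin \<theta>\<^sub>0 > 0" "cos \<theta>\<^sub>0 - r * sin \<theta>\<^sub>0 > 0"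
  unfolding half_edge_opt using cos_opt bounds by auto

lemma mag_forms: "1 + m = (1 + t) * (1 + \<tau> * t) / (1 + \<tau> * t\<^sup>2)" "1 - m = (1 - t) * (1 - \<tau> * t) / (1 + \<tau> * t\<^sup>2)"
  using bounds(3) by (simp_all add: mag_of_def field_simps power2_eq_square)

lemma abs_mag_less: "\<bar>m\<bar> < 1"
proof -
  have "1 + m > 0" "1 - m > 0"
    unfolding mag_forms using bounds tanh_real_lt_1[of w] tanh_real_gt_neg1[of w]
    by (auto intro!: divide_pos_pos mult_pos_pos)
  then show ?thesis by linarith
qed

text \<open>
  At the maximum the spins \<open>1\<close> and \<open>-1\<close> have the weights \<open>(1 + m) / 2\<close> and \<open>(1 - m) / 2\<close>. The
  equation is the exponential of the definition of the field.
\<close>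

lemma opt_balance:
  "exp b * (cos \<theta>\<^sub>0 + r * sin \<theta>\<^sub>0) ^ d * (1 - m) = exp (- b) * (cos \<theta>\<^sub>0 - r * sin \<theta>\<^sub>0) ^ d * (1 + m)"
proof -
  let ?u = "\<tau> * t"
  have tb: "1 + t > 0" "1 - t > 0" using tanh_real_lt_1[of w] tanh_real_gt_neg1[of w] by auto
  have a: "artanh ?u = (ln (1 + ?u) - ln (1 - ?u)) / 2"
    using bounds by (simp add: artanh_def ln_div)
  have w: "w = (ln (1 + t) - ln (1 - t)) / 2"
    using tb artanh_tanh_real[of w] by (simp add: artanh_def ln_div)
  have bw: "b = w - real (d - 1) * artanh ?u" using d_ge by (simp add: field_of_def of_nat_diff)
  have "b + real (d - 1) * ln (1 + ?u) + ln (1 - t) = - b + real (d - 1) * ln (1 - ?u) + ln (1 + t)"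
    unfolding bw a using w by (simp add: field_simps)
  then have "exp (b + real (d - 1) * ln (1 + ?u) + ln (1 - t)) = exp (- b + real (d - 1) * ln (1 - ?u) + ln (1 + t))"
    by simp
  then have key: "exp b * (1 + ?u) ^ (d - 1) * (1 - t) = exp (- b) * (1 - ?u) ^ (d - 1) * (1 + t)"
    using bounds tb by (simp only: exp_add exp_of_nat_mult exp_ln)
  have pw: "y ^ d = y ^ (d - 1) * y" for y :: real using d_ge by (cases d) auto
  have "exp b * (cos \<theta>\<^sub>0 + r * sin \<theta>\<^sub>0) ^ d * (1 - m)
     = (exp b * (1 + ?u) ^ (d - 1) * (1 - t)) * (cos \<theta>\<^sub>0 ^ d * (1 + ?u) * (1 - ?u) / (1 + \<tau> * t\<^sup>2))"
    unfolding half_edge_opt mag_forms power_mult_distrib pw[of "1 + ?u"] by (simp add: mult_ac)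
  also have "\<dots> = exp (- b) * (cos \<theta>\<^sub>0 - r * sin \<theta>\<^sub>0) ^ d * (1 + m)"
    unfolding half_edge_opt mag_forms power_mult_distrib pw[of "1 - ?u"] key by (simp add: mult_ac)
  finally show ?thesis .
qed

lemma opt_weight_eq: "opt_weight r d D w =
    exp b * (cos \<theta>\<^sub>0 + r * sin \<theta>\<^sub>0) ^ D + exp (- b) * (cos \<theta>\<^sub>0 - r * sin \<theta>\<^sub>0) ^ D"
  using half_edge_opt_pos by (simp add: opt_weight_def envelope_def)

lemma opt_weight_pos: "opt_weight r d D w > 0"
  unfolding opt_weight_eq using half_edge_opt_pos by (simp add: add_pos_pos)

lemma opt_split:
  "exp b * (cos \<theta>\<^sub>0 + r * sin \<theta>\<^sub>0) ^ d = opt_weight r d d w * ((1 + m) / 2)"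
  "exp (- b) * (cos \<theta>\<^sub>0 - r * sin \<theta>\<^sub>0) ^ d = opt_weight r d d w * ((1 - m) / 2)"
  using opt_balance unfolding opt_weight_eq by (simp_all add: field_simps)

text \<open>
  The relative speeds at which the two half-edge forms change when the angle moves away from the
  maximum.
\<close>

definition "rot_plus = r * (1 - t) / (1 + \<tau> * t)"
definition "rot_minus = - (r * (1 + t) / (1 - \<tau> * t))"

lemma half_edge_rotate:
  "cos (\<theta>\<^sub>0 + y) + r * sin (\<theta>\<^sub>0 + y) = (cos \<theta>\<^sub>0 + r * sin \<theta>\<^sub>0) * (cos y + rot_plus * sin y)"
  "cos (\<theta>\<^sub>0 + y) - r * sin (\<theta>\<^sub>0 + y) = (cos \<theta>\<^sub>0 - r * sin \<theta>\<^sub>0) * (cos y + rot_minus * sin y)"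
proof -
  have cancel: "c * A * (B / A) = c * B" if "A > 0" for c A B :: real
    using that by simp
  have 1: "(cos \<theta>\<^sub>0 + r * sin \<theta>\<^sub>0) * rot_plus = r * cos \<theta>\<^sub>0 - sin \<theta>\<^sub>0"
    unfolding half_edge_opt rot_plus_def cancel[OF bounds(4)] unfolding sin_opt by (simp add: algebra_simps)
  have 2: "(cos \<theta>\<^sub>0 - r * sin \<theta>\<^sub>0) * rot_minus = - (r * cos \<theta>\<^sub>0) - sin \<theta>\<^sub>0"
    unfolding half_edge_opt rot_minus_def mult_minus_right cancel[OF bounds(5)] unfolding sin_opt
    by (simp add: algebra_simps)
  have "(cos \<theta>\<^sub>0 + r * sin \<theta>\<^sub>0) * (cos y + rot_plus * sin y) =
     (cos \<theta>\<^sub>0 + r * sin \<theta>\<^sub>0) * cos y + ((cos \<theta>\<^sub>0 + r * sin \<theta>\<^sub>0) * rot_plus) * sin y" by algebra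
  then show "cos (\<theta>\<^sub>0 + y) + r * sin (\<theta>\<^sub>0 + y) = (cos \<theta>\<^sub>0 + r * sin \<theta>\<^sub>0) * (cos y + rot_plus * sin y)"
    unfolding 1 by (simp add: cos_add sin_add algebra_simps)
  have "(cos \<theta>\<^sub>0 - r * sin \<theta>\<^sub>0) * (cos y + rot_minus * sin y) =
     (cos \<theta>\<^sub>0 - r * sin \<theta>\<^sub>0) * cos y + ((cos \<theta>\<^sub>0 - r * sin \<theta>\<^sub>0) * rot_minus) * sin y" by algebra
  then show "cos (\<theta>\<^sub>0 + y) - r * sin (\<theta>\<^sub>0 + y) = (cos \<theta>\<^sub>0 - r * sin \<theta>\<^sub>0) * (cos y + rot_minus * sin y)"
    unfolding 2 by (simp add: cos_add sin_add algebra_simps)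
qed

text \<open>
  The first-order condition at the maximum.
\<close>

lemma rot_mean: "(1 + m) / 2 * rot_plus + (1 - m) / 2 * rot_minus = 0"
proof -
  have "A * U / S / 2 * (r * B / U) + B * V / S / 2 * (- (r * A / V)) = 0" if "U > 0" "V > 0"
    for A B S U V :: real using that by (simp add: mult_ac)
  from this[OF bounds(4,5)] show ?thesis
    unfolding mag_forms rot_plus_def rot_minus_def .
qed

lemma rot_square: "(1 + m) / 2 * rot_plus\<^sup>2 + (1 - m) / 2 * rot_minus\<^sup>2 = \<tau> * (1 - t\<^sup>2) / (1 - \<tau>\<^sup>2 * t\<^sup>2)"
proof -
  have f: "1 - \<tau>\<^sup>2 * t\<^sup>2 = (1 + \<tau> * t) * (1 - \<tau> * t)" by algebra
  have cancel: "A * U / S / 2 * (r * B / U)\<^sup>2 = \<tau> * A * B\<^sup>2 / (2 * S * U)" if "U > 0" for A B S U :: real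
    using that by (simp add: power2_eq_square mult_ac)
  have 1: "(1 + m) / 2 * rot_plus\<^sup>2 = \<tau> * (1 + t) * (1 - t)\<^sup>2 / (2 * (1 + \<tau> * t\<^sup>2) * (1 + \<tau> * t))"
    unfolding mag_forms rot_plus_def by (rule cancel[OF bounds(4)])
  have 2: "(1 - m) / 2 * rot_minus\<^sup>2 = \<tau> * (1 - t) * (1 + t)\<^sup>2 / (2 * (1 + \<tau> * t\<^sup>2) * (1 - \<tau> * t))"
    unfolding mag_forms rot_minus_def power2_minus by (rule cancel[OF bounds(5)])
  have "\<tau> * (1 + t) * (1 - t)\<^sup>2 / (2 * (1 + \<tau> * t\<^sup>2) * (1 + \<tau> * t)) + \<tau> * (1 - t) * (1 + t)\<^sup>2 / (2 * (1 + \<tau> * t\<^sup>2) * (1 - \<tau> * t))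
    = \<tau> * (1 - t\<^sup>2) * (2 * (1 + \<tau> * t\<^sup>2)) / (2 * (1 + \<tau> * t\<^sup>2) * ((1 + \<tau> * t) * (1 - \<tau> * t)))"
  proof -
    have "A / (C * D) + B / (C * E) = (A * E + B * D) / (C * (D * E))" if "C \<noteq> 0" "D \<noteq> 0" "E \<noteq> 0" for A B C D E :: real
      using that by (simp add: field_simps)
    moreover have "\<tau> * (1 + t) * (1 - t)\<^sup>2 * (1 - \<tau> * t) + \<tau> * (1 - t) * (1 + t)\<^sup>2 * (1 + \<tau> * t) = \<tau> * (1 - t\<^sup>2) * (2 * (1 + \<tau> * t\<^sup>2))"
      by algebra
    ultimately show ?thesis using bounds by simp
  qed
  also have "\<dots> = \<tau> * (1 - t\<^sup>2) / (1 - \<tau>\<^sup>2 * t\<^sup>2)"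
    unfolding f using bounds(3) by simp
  finally show ?thesis unfolding 1 2 .
qed

lemma rot_diff: "(1 - m\<^sup>2) / 2 * (rot_plus - rot_minus) = r * (1 - t\<^sup>2) / (1 + \<tau> * t\<^sup>2)"
proof -
  have "1 - m\<^sup>2 = (1 + m) * (1 - m)" by algebra
  also have "\<dots> = (1 - t\<^sup>2) * ((1 + \<tau> * t) * (1 - \<tau> * t)) / (1 + \<tau> * t\<^sup>2)\<^sup>2"
    unfolding mag_forms by (simp add: power2_eq_square algebra_simps)
  finally have 1: "1 - m\<^sup>2 = (1 - t\<^sup>2) * ((1 + \<tau> * t) * (1 - \<tau> * t)) / (1 + \<tau> * t\<^sup>2)\<^sup>2" .
  have "rot_plus - rot_minus = (r * (1 - t) * (1 - \<tau> * t) + r * (1 + t) * (1 + \<tau> * t)) / ((1 + \<tau> * t) * (1 - \<tau> * t))"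
    unfolding rot_plus_def rot_minus_def using bounds by (simp add: add_frac_eq)
  also have "r * (1 - t) * (1 - \<tau> * t) + r * (1 + t) * (1 + \<tau> * t) = 2 * r * (1 + \<tau> * t\<^sup>2)" by algebra
  finally have 2: "rot_plus - rot_minus = 2 * r * (1 + \<tau> * t\<^sup>2) / ((1 + \<tau> * t) * (1 - \<tau> * t))" .
  have "A * P / S\<^sup>2 / 2 * (2 * r * S / P) = r * A / S" if "P > 0" "S > 0" for A P S :: real
    using that by (simp add: power2_eq_square)
  from this[OF mult_pos_pos[OF bounds(4,5)] bounds(3)] show ?thesis unfolding 1 2 .
qed

lemma centered_weight_rotate:
  "centered_weight r d b m z (\<theta>\<^sub>0 + y) / of_real (opt_weight r d d w) =
     of_real ((1 + m) / 2) * (exp (of_real (1 - m) * z) * of_real (cos y + rot_plus * sin y) ^ d)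
     + of_real ((1 - m) / 2) * (exp (- (of_real (1 + m) * z)) * of_real (cos y + rot_minus * sin y) ^ d)"
proof -
  let ?p = "cos y + rot_plus * sin y" and ?q = "cos y + rot_minus * sin y"
  have "centered_weight r d b m z (\<theta>\<^sub>0 + y) =
     exp (of_real (1 - m) * z) * of_real (exp b * (cos \<theta>\<^sub>0 + r * sin \<theta>\<^sub>0) ^ d) * of_real ?p ^ d
     + exp (- (of_real (1 + m) * z)) * of_real (exp (- b) * (cos \<theta>\<^sub>0 - r * sin \<theta>\<^sub>0) ^ d) * of_real ?q ^ d"
  proof -
    have E: "exp (- (of_real m * z)) * exp (of_real b + z) = exp (of_real (1 - m) * z) * of_real (exp b)"
      "exp (- (of_real m * z)) * exp (- (of_real b + z)) = exp (- (of_real (1 + m) * z)) * of_real (exp (- b))"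
      by (simp_all add: exp_add[symmetric] exp_of_real[symmetric] algebra_simps)
    have "centered_weight r d b m z (\<theta>\<^sub>0 + y) =
      (exp (- (of_real m * z)) * exp (of_real b + z)) * of_real ((cos \<theta>\<^sub>0 + r * sin \<theta>\<^sub>0) * ?p) ^ d
      + (exp (- (of_real m * z)) * exp (- (of_real b + z))) * of_real ((cos \<theta>\<^sub>0 - r * sin \<theta>\<^sub>0) * ?q) ^ d"
      unfolding centered_weight_def vertex_weight_def half_edge_rotate by (simp only: distrib_left mult.assoc)
    then show ?thesis
      unfolding E by (simp only: of_real_mult of_real_power power_mult_distrib mult.assoc)
  qed
  also have "\<dots> / of_real (opt_weight r d d w) =
     of_real ((1 + m) / 2) * (exp (of_real (1 - m) * z) * of_real ?p ^ d)
     + of_real ((1 - m) / 2) * (exp (- (of_real (1 + m) * z)) * of_real ?q ^ d)"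
    unfolding opt_split using opt_weight_pos[of d]
    by (simp add: add_divide_distrib)
  finally show ?thesis .
qed

lemma second_order_tilted_rotation:
  "second_order (\<lambda>\<epsilon>. exp (a * z * of_real \<epsilon>) * of_real (cos (x * \<epsilon>) + \<kappa> * sin (x * \<epsilon>)) ^ d)
    (a * z + of_nat d * of_real \<kappa> * of_real x)
    (a\<^sup>2 * z\<^sup>2 * (1/2) + (of_nat d * (of_nat d - 1) * (1/2) * (of_real \<kappa>)\<^sup>2 * (of_real x)\<^sup>2
      - of_nat d * (1/2) * (of_real x)\<^sup>2) + a * z * (of_nat d * of_real \<kappa> * of_real x))"
proof -
  have dn: "(of_nat (d * (d - 1)) :: complex) = of_nat d * (of_nat d - 1)"
    using d_ge by (simp add: of_nat_diff)
  have lin: "a * z + of_nat d * of_real (\<kappa> * x) = a * z + of_nat d * of_real \<kappa> * of_real x"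
    by simp
  have quad: "(a * z)\<^sup>2 / 2 + (of_nat d * of_real (- (x\<^sup>2 / 2)) + of_nat d * (of_nat d - 1) / 2 * (of_real (\<kappa> * x))\<^sup>2)
      + a * z * (of_nat d * of_real (\<kappa> * x)) =
    a\<^sup>2 * z\<^sup>2 * (1/2) + (of_nat d * (of_nat d - 1) * (1/2) * (of_real \<kappa>)\<^sup>2 * (of_real x)\<^sup>2
      - of_nat d * (1/2) * (of_real x)\<^sup>2) + a * z * (of_nat d * of_real \<kappa> * of_real x)"
    by (simp add: power_mult_distrib)
  show ?thesis
    using second_order_mult[OF second_order_exp[of "a * z"] second_order_power[OF second_order_rotation[of x \<kappa>], of d]]
    unfolding dn quad lin .
qed

text \<open>
  The weight is a mixture of two products of an exponential in \<open>z\<close> and a power of a rotation. The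
  terms of first order cancel, those in \<open>z\<close> because \<open>m\<close> is the mean spin and those in \<open>x\<close> by
  \<open>rot_mean\<close>; the terms of second order are variances and a covariance of the mixture.
\<close>

lemma second_order_centered_weight:
  "second_order (\<lambda>\<epsilon>. centered_weight r d b m (z * of_real \<epsilon>) (\<theta>\<^sub>0 + x * \<epsilon>) / of_real (opt_weight r d d w))
     0 (local_form r d w z x)"
proof -
  define P Q a a' where "P = complex_of_real ((1 + m) / 2)" and "Q = complex_of_real ((1 - m) / 2)"
    and "a = complex_of_real (1 - m)" and "a' = complex_of_real (- (1 + m))"
  define k k' X D where "k = complex_of_real rot_plus" and "k' = complex_of_real rot_minus"
    and "X = complex_of_real x" and "D = (of_nat d :: complex)"
  have PQ: "P + Q = 1" unfolding P_def Q_def of_real_add[symmetric] by (simp add: add_divide_distrib[symmetric])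
  have c1: "P * a + Q * a' = 0"
  proof -
    have "(1 + m) / 2 * (1 - m) + (1 - m) / 2 * (- (1 + m)) = 0" by (simp add: field_simps)
    then show ?thesis
      unfolding P_def Q_def a_def a'_def of_real_add[symmetric] of_real_mult[symmetric] by simp
  qed
  have c2: "P * k + Q * k' = 0"
    unfolding P_def Q_def k_def k'_def of_real_add[symmetric] of_real_mult[symmetric] rot_mean by simp
  have c3: "P * a\<^sup>2 + Q * a'\<^sup>2 = of_real (1 - m\<^sup>2)"
  proof -
    have "(1 + m) / 2 * (1 - m)\<^sup>2 + (1 - m) / 2 * (- (1 + m))\<^sup>2 = 1 - m\<^sup>2"
      by (simp add: field_simps power2_eq_square)
    then show ?thesis
      unfolding P_def Q_def a_def a'_def of_real_power[symmetric] of_real_add[symmetric] of_real_mult[symmetric] by simp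
  qed
  have c4: "P * a * k + Q * a' * k' = of_real (r * (1 - t\<^sup>2) / (1 + \<tau> * t\<^sup>2))"
  proof -
    have "(1 + m) / 2 * (1 - m) * rot_plus + (1 - m) / 2 * (- (1 + m)) * rot_minus = (1 - m\<^sup>2) / 2 * (rot_plus - rot_minus)"
      by (simp add: field_simps power2_eq_square)
    then show ?thesis
      unfolding P_def Q_def a_def a'_def k_def k'_def of_real_mult[symmetric] of_real_add[symmetric] rot_diff by simp
  qed
  have c5: "P * k\<^sup>2 + Q * k'\<^sup>2 = of_real (\<tau> * (1 - t\<^sup>2) / (1 - \<tau>\<^sup>2 * t\<^sup>2))"
    unfolding P_def Q_def k_def k'_def of_real_power[symmetric] of_real_mult[symmetric] of_real_add[symmetric] rot_square ..
  have lin: "P * (a * z + D * k * X) + Q * (a' * z + D * k' * X) = 0"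
  proof -
    have "P * (a * z + D * k * X) + Q * (a' * z + D * k' * X) = (P * a + Q * a') * z + D * X * (P * k + Q * k')"
      by algebra
    then show ?thesis unfolding c1 c2 by simp
  qed
  have quad: "P * (a\<^sup>2 * z\<^sup>2 * (1/2) + (D * (D - 1) * (1/2) * k\<^sup>2 * X\<^sup>2 - D * (1/2) * X\<^sup>2) + a * z * (D * k * X))
    + Q * (a'\<^sup>2 * z\<^sup>2 * (1/2) + (D * (D - 1) * (1/2) * k'\<^sup>2 * X\<^sup>2 - D * (1/2) * X\<^sup>2) + a' * z * (D * k' * X))
    = local_form r d w z x" (is "?L = _")
  proof -
    have "P * (a\<^sup>2 * z\<^sup>2 * h + (D * (D - 1) * h * k\<^sup>2 * X\<^sup>2 - D * h * X\<^sup>2) + a * z * (D * k * X))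
    + Q * (a'\<^sup>2 * z\<^sup>2 * h + (D * (D - 1) * h * k'\<^sup>2 * X\<^sup>2 - D * h * X\<^sup>2) + a' * z * (D * k' * X))
      = (P * a\<^sup>2 + Q * a'\<^sup>2) * h * z\<^sup>2 + D * X * (P * a * k + Q * a' * k') * z
        + D * X\<^sup>2 * h * ((D - 1) * (P * k\<^sup>2 + Q * k'\<^sup>2) - (P + Q))" for h :: complex
      by algebra
    from this[of "1/2"] have "?L = of_real (1 - m\<^sup>2) * (1/2) * z\<^sup>2 + of_real (real d * x * (r * (1 - t\<^sup>2) / (1 + \<tau> * t\<^sup>2))) * z
      + of_real (real d * x\<^sup>2 * (1/2) * ((real d - 1) * (\<tau> * (1 - t\<^sup>2) / (1 - \<tau>\<^sup>2 * t\<^sup>2)) - 1))"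
      unfolding c3 c4 c5 PQ X_def D_def by simp
    also have "real d * x * (r * (1 - t\<^sup>2) / (1 + \<tau> * t\<^sup>2)) = real d * r * (1 - t\<^sup>2) / (1 + \<tau> * t\<^sup>2) * x"
      by simp
    also have "real d * x\<^sup>2 * (1/2) * ((real d - 1) * (\<tau> * (1 - t\<^sup>2) / (1 - \<tau>\<^sup>2 * t\<^sup>2)) - 1) = (- 1/2) * (real d * slope * x\<^sup>2)"
    proof -
      have "real d * x\<^sup>2 * (1/2) * ((real d - 1) * Y - 1) = (- 1/2) * (real d * (1 - (real d - 1) * Y) * x\<^sup>2)" for Y
        by (simp add: field_simps)
      moreover have "slope = 1 - (real d - 1) * (\<tau> * (1 - t\<^sup>2) / (1 - \<tau>\<^sup>2 * t\<^sup>2))"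
        by (simp add: field_slope_def mult.assoc)
      ultimately show ?thesis by (simp only:)
    qed
    also have "of_real ((- 1/2) * (real d * slope * x\<^sup>2)) = (- 1/2) * complex_of_real (real d * slope * x\<^sup>2)"
      by (simp only: of_real_mult of_real_divide of_real_minus of_real_1 of_real_numeral)
    finally have "?L = of_real (1 - m\<^sup>2) * (1/2) * z\<^sup>2 + of_real (real d * r * (1 - t\<^sup>2) / (1 + \<tau> * t\<^sup>2) * x) * z
      + (- 1/2) * of_real (real d * slope * x\<^sup>2)" .
    moreover have "A * (1/2) * z\<^sup>2 + u * z + (- 1/2) * v = (A * z\<^sup>2 + 2 * u * z - v) / 2" for A u v :: complex
      by (simp add: diff_divide_distrib add_divide_distrib)
    ultimately show ?thesis unfolding local_form_def by simp
  qed
  have expand: "centered_weight r d b m (z * of_real \<epsilon>) (\<theta>\<^sub>0 + x * \<epsilon>) / of_real (opt_weight r d d w) =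
    P * (exp (a * z * of_real \<epsilon>) * of_real (cos (x * \<epsilon>) + rot_plus * sin (x * \<epsilon>)) ^ d)
    + Q * (exp (a' * z * of_real \<epsilon>) * of_real (cos (x * \<epsilon>) + rot_minus * sin (x * \<epsilon>)) ^ d)" for \<epsilon>
    unfolding centered_weight_rotate P_def Q_def a_def a'_def of_real_minus mult_minus_left mult.assoc ..
  show ?thesis
    using second_order_linear_comb[OF second_order_tilted_rotation[of a z x rot_plus]
        second_order_tilted_rotation[of a' z x rot_minus] PQ]
    unfolding expand k_def[symmetric] k'_def[symmetric] X_def[symmetric] D_def[symmetric] lin quad .
qed

end

section \<open>Gaussian domination of the weight\<close>

lemma exp_le_quadratic:
  fixes x :: real assumes "\<bar>x\<bar> \<le> 1" shows "exp x \<le> 1 + x + x\<^sup>2"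
proof (cases "x \<ge> 0")
  case True
  then show ?thesis using exp_bound[of x] assms by simp
next
  case False
  define y where "y = - x"
  have y: "y > 0" using False by (simp add: y_def)
  have "1 + y \<le> exp y" by (rule exp_ge_add_one_self)
  then have "exp (- y) \<le> 1 / (1 + y)" using y by (simp add: exp_minus field_simps)
  also have "\<dots> \<le> 1 - y + y\<^sup>2"
  proof -
    have "(1 - y + y\<^sup>2) * (1 + y) = 1 + y ^ 3" by algebra
    then have "1 \<le> (1 - y + y\<^sup>2) * (1 + y)" using y by simp
    then show ?thesis using y by (simp add: divide_le_eq)
  qed
  finally show ?thesis by (simp add: y_def)
qed

lemma half_edge_lipschitz:
  fixes r \<theta> \<phi> :: real
  assumes "\<bar>r\<bar> \<le> 1"
  shows "\<bar>(cos \<theta> + r * sin \<theta>) - (cos \<phi> + r * sin \<phi>)\<bar> \<le> 2 * \<bar>\<theta> - \<phi>\<bar>"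
proof -
  have bd: "\<bar>2 * u * sin v\<bar> \<le> 2 * \<bar>v\<bar>" if "\<bar>u\<bar> \<le> 1" for u v :: real
  proof -
    have "\<bar>2 * u * sin v\<bar> = 2 * (\<bar>u\<bar> * \<bar>sin v\<bar>)" by (simp add: abs_mult)
    also have "\<dots> \<le> 2 * (1 * \<bar>v\<bar>)"
      using that abs_sin_x_le_abs_x[of v] by (intro mult_left_mono mult_mono) auto
    finally show ?thesis by simp
  qed
  have "cos \<theta> - cos \<phi> = 2 * sin ((\<theta> + \<phi>) / 2) * sin ((\<phi> - \<theta>) / 2)" by (rule cos_diff_cos)
  then have 1: "\<bar>cos \<theta> - cos \<phi>\<bar> \<le> \<bar>\<theta> - \<phi>\<bar>"
    using bd[of "sin ((\<theta> + \<phi>) / 2)" "(\<phi> - \<theta>) / 2"] by simp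
  have "sin \<theta> - sin \<phi> = 2 * cos ((\<theta> + \<phi>) / 2) * sin ((\<theta> - \<phi>) / 2)" by (simp add: sin_diff_sin)
  then have 2: "\<bar>sin \<theta> - sin \<phi>\<bar> \<le> \<bar>\<theta> - \<phi>\<bar>"
    using bd[of "cos ((\<theta> + \<phi>) / 2)" "(\<theta> - \<phi>) / 2"] by simp
  have "\<bar>r * (sin \<theta> - sin \<phi>)\<bar> \<le> 1 * \<bar>\<theta> - \<phi>\<bar>"
    unfolding abs_mult using assms 2 by (intro mult_mono) auto
  then show ?thesis using 1 by (simp add: algebra_simps abs_le_iff)
qed

lemma abs_half_edge_le:
  fixes r \<theta> :: real
  assumes "\<bar>r\<bar> \<le> 1" shows "\<bar>cos \<theta> + r * sin \<theta>\<bar> \<le> 2"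
proof -
  have "\<bar>r * sin \<theta>\<bar> \<le> 1 * 1" unfolding abs_mult using assms by (intro mult_mono) auto
  moreover have "\<bar>cos \<theta>\<bar> \<le> 1" by simp
  ultimately show ?thesis by linarith
qed

lemma abs_power_diff_le:
  fixes x y :: real
  assumes "\<bar>x\<bar> \<le> 2" "\<bar>y\<bar> \<le> 2"
  shows "\<bar>\<bar>x\<bar> ^ n - \<bar>y\<bar> ^ n\<bar> \<le> 2 ^ n * real n * \<bar>x - y\<bar>"
proof -
  have "\<bar>x\<bar> ^ n - \<bar>y\<bar> ^ n = 2 ^ n * ((\<bar>x\<bar> / 2) ^ n - (\<bar>y\<bar> / 2) ^ n)"
    by (simp add: power_divide field_simps)
  then have "\<bar>\<bar>x\<bar> ^ n - \<bar>y\<bar> ^ n\<bar> = 2 ^ n * \<bar>(\<bar>x\<bar> / 2) ^ n - (\<bar>y\<bar> / 2) ^ n\<bar>"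
    by (simp add: abs_mult)
  also have "\<bar>(\<bar>x\<bar> / 2) ^ n - (\<bar>y\<bar> / 2) ^ n\<bar> \<le> real n * \<bar>\<bar>x\<bar> / 2 - \<bar>y\<bar> / 2\<bar>"
    using norm_power_diff[of "\<bar>x\<bar> / 2" "\<bar>y\<bar> / 2" n] assms by simp
  also have "real n * \<bar>\<bar>x\<bar> / 2 - \<bar>y\<bar> / 2\<bar> \<le> real n * \<bar>x - y\<bar>"
    by (intro mult_left_mono) auto
  finally show ?thesis by (simp add: mult.assoc)
qed

lemma norm_centered_weight_le:
  "norm (centered_weight r D b m z \<theta>) \<le>
    exp (Re z * (1 - m)) * (exp b * \<bar>cos \<theta> + r * sin \<theta>\<bar> ^ D)
    + exp (- (Re z * (1 + m))) * (exp (- b) * \<bar>cos \<theta> - r * sin \<theta>\<bar> ^ D)"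
proof -
  have eq: "centered_weight r D b m z \<theta> =
      exp (of_real (1 - m) * z + of_real b) * of_real (cos \<theta> + r * sin \<theta>) ^ D
      + exp (- (of_real (1 + m) * z) - of_real b) * of_real (cos \<theta> - r * sin \<theta>) ^ D"
    unfolding centered_weight_def vertex_weight_def distrib_left mult.assoc[symmetric] exp_add[symmetric]
    by (simp add: algebra_simps)
  have "Re (of_real (1 - m) * z) = Re z * (1 - m)"
    "Re (- (of_real (1 + m) * z) - of_real b) = - (Re z * (1 + m)) + - b"
    by (simp_all add: mult.commute)
  note Re_eq = this
  have "norm (centered_weight r D b m z \<theta>) \<le>
     norm (exp (of_real (1 - m) * z + of_real b) * of_real (cos \<theta> + r * sin \<theta>) ^ D)
     + norm (exp (- (of_real (1 + m) * z) - of_real b) * of_real (cos \<theta> - r * sin \<theta>) ^ D)"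
    unfolding eq by (rule norm_triangle_ineq)
  then show ?thesis
    by (simp only: norm_mult norm_power norm_exp_eq_Re norm_of_real Re_eq Re_complex_of_real exp_add mult.assoc)
qed

lemma continuous_on_centered_weight [continuous_intros]:
  fixes f :: "'a::t2_space \<Rightarrow> complex" and g :: "'a \<Rightarrow> real"
  assumes "continuous_on S f" "continuous_on S g"
  shows "continuous_on S (\<lambda>x. centered_weight r D b m (f x) (g x))"
  unfolding centered_weight_def vertex_weight_def by (intro continuous_intros continuous_on_cos continuous_on_sin assms)

context optimum
begin

lemma abs_r: "\<bar>r\<bar> \<le> 1" "\<bar>- r\<bar> \<le> 1" using r_nonneg r_less by auto

lemma centered_weight_0_eq_envelope:
  assumes "cos \<theta> + r * sin \<theta> \<ge> 0" "cos \<theta> - r * sin \<theta> \<ge> 0"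
  shows "centered_weight r D b m 0 \<theta> = of_real (envelope r D b \<theta>)"
  using assms by (simp add: centered_weight_def vertex_weight_def envelope_def exp_of_real flip: of_real_minus)

lemma envelope_quotient_limit:
  "((\<lambda>\<epsilon>. (1 - envelope r d b (\<theta>\<^sub>0 + \<epsilon>) / opt_weight r d d w) / \<epsilon>\<^sup>2) \<longlongrightarrow> real d * slope / 2) (at 0)"
proof -
  have "((\<lambda>\<epsilon>. (centered_weight r d b m (0 * of_real \<epsilon>) (\<theta>\<^sub>0 + 1 * \<epsilon>) / of_real (opt_weight r d d w) - 1 - 0 * of_real \<epsilon>)
      / (of_real \<epsilon>)\<^sup>2) \<longlongrightarrow> local_form r d w 0 1) (at 0)"
    using second_order_centered_weight[of 0 1] unfolding second_order_def .
  from tendsto_minus[OF tendsto_Re[OF this]]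
  have lim: "((\<lambda>\<epsilon>. - Re ((centered_weight r d b m 0 (\<theta>\<^sub>0 + \<epsilon>) / of_real (opt_weight r d d w) - 1) / of_real (\<epsilon>\<^sup>2)))
       \<longlongrightarrow> real d * slope / 2) (at 0)"
    by (simp add: local_form_def)
  have "open {\<epsilon>. cos (\<theta>\<^sub>0 + \<epsilon>) + r * sin (\<theta>\<^sub>0 + \<epsilon>) > 0 \<and> cos (\<theta>\<^sub>0 + \<epsilon>) - r * sin (\<theta>\<^sub>0 + \<epsilon>) > 0}"
    by (intro open_Collect_conj open_Collect_less continuous_intros)
  then have "\<forall>\<^sub>F \<epsilon> in at 0. \<epsilon> \<in> {\<epsilon>. cos (\<theta>\<^sub>0 + \<epsilon>) + r * sin (\<theta>\<^sub>0 + \<epsilon>) > 0 \<and> cos (\<theta>\<^sub>0 + \<epsilon>) - r * sin (\<theta>\<^sub>0 + \<epsilon>) > 0}"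
    using half_edge_opt_pos by (intro eventually_at_in_open') auto
  then have "\<forall>\<^sub>F \<epsilon> in at 0. - Re ((centered_weight r d b m 0 (\<theta>\<^sub>0 + \<epsilon>) / of_real (opt_weight r d d w) - 1) / of_real (\<epsilon>\<^sup>2))
     = (1 - envelope r d b (\<theta>\<^sub>0 + \<epsilon>) / opt_weight r d d w) / \<epsilon>\<^sup>2"
  proof eventually_elim
    case (elim \<epsilon>)
    then have "centered_weight r d b m 0 (\<theta>\<^sub>0 + \<epsilon>) = of_real (envelope r d b (\<theta>\<^sub>0 + \<epsilon>))"
      by (intro centered_weight_0_eq_envelope) auto
    then have "(centered_weight r d b m 0 (\<theta>\<^sub>0 + \<epsilon>) / of_real (opt_weight r d d w) - 1) / of_real (\<epsilon>\<^sup>2)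
       = of_real ((envelope r d b (\<theta>\<^sub>0 + \<epsilon>) / opt_weight r d d w - 1) / \<epsilon>\<^sup>2)" by simp
    then show ?case unfolding Re_complex_of_real by (simp only: Re_complex_of_real) (simp add: diff_divide_distrib)
  qed
  then show ?thesis by (rule Lim_transform_eventually[OF lim])
qed

text \<open>
  The quotient of \<open>1 - envelope / maximum\<close> by the squared distance to the maximiser extends
  continuously by half the (positive) curvature, so it is positive on a compact interval and has a
  positive minimum.
\<close>

lemma envelope_quadratic_decay:
  "\<exists>c>0. \<forall>\<theta>\<in>{-(pi/2)..pi/2}. envelope r d b \<theta> \<le> opt_weight r d d w * (1 - c * (\<theta> - \<theta>\<^sub>0)\<^sup>2)"
proof -
  let ?A = "opt_weight r d d w"
  define h where "h = (\<lambda>\<theta>. if \<theta> = \<theta>\<^sub>0 then real d * slope / 2 else (1 - envelope r d b \<theta> / ?A) / (\<theta> - \<theta>\<^sub>0)\<^sup>2)"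
  have "((\<lambda>\<theta>. (1 - envelope r d b (\<theta>\<^sub>0 + (\<theta> - \<theta>\<^sub>0)) / ?A) / (\<theta> - \<theta>\<^sub>0)\<^sup>2) \<longlongrightarrow> real d * slope / 2) (at \<theta>\<^sub>0)"
    by (rule filterlim_compose[OF envelope_quotient_limit])
       (auto simp: filterlim_at eventually_at_filter intro!: tendsto_eq_intros)
  then have "(h \<longlongrightarrow> h \<theta>\<^sub>0) (at \<theta>\<^sub>0)"
    by (rule Lim_transform_eventually[OF tendsto_eq_rhs]) (auto simp: h_def eventually_at_filter)
  then have c0: "isCont h \<theta>\<^sub>0" by (simp add: isCont_def)
  have c1: "continuous_on (- {\<theta>\<^sub>0}) h"
  proof (rule continuous_on_cong[THEN iffD1])
    show "continuous_on (- {\<theta>\<^sub>0}) (\<lambda>\<theta>. (1 - envelope r d b \<theta> / ?A) / (\<theta> - \<theta>\<^sub>0)\<^sup>2)"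
      using opt_weight_pos[of d] by (intro continuous_intros continuous_on_envelope) auto
  qed (auto simp: h_def)
  have "isCont h \<theta>" for \<theta>
    using c0 c1 by (cases "\<theta> = \<theta>\<^sub>0") (auto simp: continuous_on_eq_continuous_at[OF open_Compl[OF closed_singleton]])
  then have "continuous_on {-(pi/2)..pi/2} h" by (simp add: continuous_at_imp_continuous_on)
  then obtain \<theta>\<^sub>1 where \<theta>\<^sub>1: "\<theta>\<^sub>1 \<in> {-(pi/2)..pi/2}" "\<And>\<theta>. \<theta> \<in> {-(pi/2)..pi/2} \<Longrightarrow> h \<theta>\<^sub>1 \<le> h \<theta>"
    using continuous_attains_inf[of "{-(pi/2)..pi/2}" h] by auto
  have pos: "h \<theta> > 0" if "\<theta> \<in> {-(pi/2)..pi/2}" for \<theta>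
  proof (cases "\<theta> = \<theta>\<^sub>0")
    case True
    then show ?thesis using slope_pos d_ge by (simp add: h_def)
  next
    case False
    then have "envelope r d b \<theta> < ?A"
      using envelope_unique_max[OF r_nonneg r_less d_ge regular that] by (simp add: opt_weight_def)
    then show ?thesis using False opt_weight_pos[of d] by (simp add: h_def)
  qed
  have "envelope r d b \<theta> \<le> ?A * (1 - h \<theta>\<^sub>1 * (\<theta> - \<theta>\<^sub>0)\<^sup>2)" if "\<theta> \<in> {-(pi/2)..pi/2}" for \<theta>
  proof (cases "\<theta> = \<theta>\<^sub>0")
    case False
    then have "h \<theta>\<^sub>1 * (\<theta> - \<theta>\<^sub>0)\<^sup>2 \<le> 1 - envelope r d b \<theta> / ?A"
      using \<theta>\<^sub>1(2)[OF that] by (simp add: h_def pos_le_divide_eq)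
    then have "envelope r d b \<theta> / ?A \<le> 1 - h \<theta>\<^sub>1 * (\<theta> - \<theta>\<^sub>0)\<^sup>2" by simp
    then show ?thesis using opt_weight_pos[of d] by (simp add: pos_divide_le_eq mult.commute)
  qed (simp add: opt_weight_def)
  then show ?thesis using pos[OF \<theta>\<^sub>1(1)] by blast
qed

text \<open>
  The tilt \<open>z\<close> is expanded to second order. Its linear term is Lipschitz in the angle and vanishes
  at the maximum, so it is at most a constant times \<open>norm z * \<bar>\<theta> - \<theta>\<^sub>0\<bar>\<close>; half of the quadratic
  decay of the envelope absorbs this product.
\<close>

lemma centered_weight_decay:
  "\<exists>c>0. \<exists>C\<ge>0. \<forall>z. \<forall>\<theta>\<in>{-(pi/2)..pi/2}. norm z \<le> 1/2 \<longrightarrow>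
     norm (centered_weight r d b m z \<theta>) \<le> opt_weight r d d w * exp (C * (norm z)\<^sup>2 - c * (\<theta> - \<theta>\<^sub>0)\<^sup>2)"
proof -
  let ?A = "opt_weight r d d w"
  obtain c where c: "c > 0" "\<And>\<theta>. \<theta> \<in> {-(pi/2)..pi/2} \<Longrightarrow> envelope r d b \<theta> \<le> ?A * (1 - c * (\<theta> - \<theta>\<^sub>0)\<^sup>2)"
    using envelope_quadratic_decay by blast
  define P where "P = (\<lambda>\<theta>. exp b * \<bar>cos \<theta> + r * sin \<theta>\<bar> ^ d)"
  define Q where "Q = (\<lambda>\<theta>. exp (- b) * \<bar>cos \<theta> - r * sin \<theta>\<bar> ^ d)"
  define L where "L = (exp b + exp (- b)) * (2 ^ d * real d * 4) / ?A"
  have A: "?A > 0" by (rule opt_weight_pos)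
  have L: "L \<ge> 0" using A by (simp add: L_def)
  have PQ: "P \<theta> + Q \<theta> = envelope r d b \<theta>" for \<theta> by (simp add: P_def Q_def envelope_def)
  have nn: "P \<theta> \<ge> 0" "Q \<theta> \<ge> 0" for \<theta> by (simp_all add: P_def Q_def)
  have half: "\<bar>\<bar>cos \<theta> + r' * sin \<theta>\<bar> ^ d - \<bar>cos \<theta>\<^sub>0 + r' * sin \<theta>\<^sub>0\<bar> ^ d\<bar> \<le> 2 ^ d * real d * (2 * \<bar>\<theta> - \<theta>\<^sub>0\<bar>)"
    if r': "\<bar>r'\<bar> \<le> 1" for r' \<theta>
  proof -
    have "\<bar>\<bar>cos \<theta> + r' * sin \<theta>\<bar> ^ d - \<bar>cos \<theta>\<^sub>0 + r' * sin \<theta>\<^sub>0\<bar> ^ d\<bar>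
        \<le> 2 ^ d * real d * \<bar>(cos \<theta> + r' * sin \<theta>) - (cos \<theta>\<^sub>0 + r' * sin \<theta>\<^sub>0)\<bar>"
      by (rule abs_power_diff_le) (use abs_half_edge_le r' in auto)
    also have "\<dots> \<le> 2 ^ d * real d * (2 * \<bar>\<theta> - \<theta>\<^sub>0\<bar>)"
      by (intro mult_left_mono half_edge_lipschitz r') auto
    finally show ?thesis .
  qed
  have lipP: "\<bar>P \<theta> - P \<theta>\<^sub>0\<bar> \<le> exp b * (2 ^ d * real d * (2 * \<bar>\<theta> - \<theta>\<^sub>0\<bar>))" for \<theta>
    unfolding P_def right_diff_distrib[symmetric] abs_mult abs_exp_cancel
    by (intro mult_left_mono half[OF abs_r(1)]) auto
  have lipQ: "\<bar>Q \<theta> - Q \<theta>\<^sub>0\<bar> \<le> exp (- b) * (2 ^ d * real d * (2 * \<bar>\<theta> - \<theta>\<^sub>0\<bar>))" for \<theta>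
    unfolding Q_def right_diff_distrib[symmetric] abs_mult abs_exp_cancel
    by (intro mult_left_mono) (use half[OF abs_r(2), of \<theta>] in auto)
  have zero: "(1 - m) * P \<theta>\<^sub>0 - (1 + m) * Q \<theta>\<^sub>0 = 0"
    using opt_balance half_edge_opt_pos by (simp add: P_def Q_def mult_ac)
  have rho: "\<bar>(1 - m) * P \<theta> - (1 + m) * Q \<theta>\<bar> \<le> ?A * (L * \<bar>\<theta> - \<theta>\<^sub>0\<bar>)" for \<theta>
  proof -
    have "(1 - m) * P \<theta> - (1 + m) * Q \<theta> = (1 - m) * (P \<theta> - P \<theta>\<^sub>0) - (1 + m) * (Q \<theta> - Q \<theta>\<^sub>0)"
      using zero by (simp add: algebra_simps)
    also have "\<bar>\<dots>\<bar> \<le> \<bar>(1 - m) * (P \<theta> - P \<theta>\<^sub>0)\<bar> + \<bar>(1 + m) * (Q \<theta> - Q \<theta>\<^sub>0)\<bar>" by (rule abs_triangle_ineq4)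
    also have "\<dots> \<le> 2 * (exp b * (2 ^ d * real d * (2 * \<bar>\<theta> - \<theta>\<^sub>0\<bar>))) + 2 * (exp (- b) * (2 ^ d * real d * (2 * \<bar>\<theta> - \<theta>\<^sub>0\<bar>)))"
      unfolding abs_mult using abs_mag_less lipP[of \<theta>] lipQ[of \<theta>] by (intro add_mono mult_mono) auto
    also have "\<dots> = ?A * (L * \<bar>\<theta> - \<theta>\<^sub>0\<bar>)"
    proof -
      have "?A * L = (exp b + exp (- b)) * (2 ^ d * real d * 4)" using A by (simp add: L_def)
      then show ?thesis unfolding mult.assoc[symmetric, of ?A L] by (simp add: algebra_simps)
    qed
    finally show ?thesis .
  qed
  define C where "C = L\<^sup>2 / (2 * c) + 4"
  have C: "C \<ge> 0" using c by (simp add: C_def)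
  have "norm (centered_weight r d b m z \<theta>) \<le> ?A * exp (C * (norm z)\<^sup>2 - c / 2 * (\<theta> - \<theta>\<^sub>0)\<^sup>2)"
    if th: "\<theta> \<in> {-(pi/2)..pi/2}" and z: "norm z \<le> 1/2" for z \<theta>
  proof -
    define s where "s = Re z"
    define y where "y = \<bar>\<theta> - \<theta>\<^sub>0\<bar>"
    have s: "\<bar>s\<bar> \<le> norm z" "\<bar>s\<bar> \<le> 1/2" using abs_Re_le_cmod[of z] z by (auto simp: s_def)
    have tilt: "exp (s * a) \<le> 1 + s * a + 4 * s\<^sup>2" if "\<bar>a\<bar> \<le> 2" for a
    proof -
      have "\<bar>s * a\<bar> \<le> 1/2 * 2" unfolding abs_mult using s that by (intro mult_mono) auto
      then have "exp (s * a) \<le> 1 + s * a + (s * a)\<^sup>2" by (intro exp_le_quadratic) simp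
      also have "(s * a)\<^sup>2 \<le> s\<^sup>2 * 2\<^sup>2"
        unfolding power_mult_distrib using that abs_le_square_iff[of a 2] by (intro mult_left_mono) auto
      finally show ?thesis by simp
    qed
    have "norm (centered_weight r d b m z \<theta>) \<le> exp (s * (1 - m)) * P \<theta> + exp (s * (- (1 + m))) * Q \<theta>"
      unfolding P_def Q_def s_def mult_minus_right by (rule norm_centered_weight_le)
    also have "\<dots> \<le> (1 + s * (1 - m) + 4 * s\<^sup>2) * P \<theta> + (1 + s * (- (1 + m)) + 4 * s\<^sup>2) * Q \<theta>"
      using abs_mag_less nn by (intro add_mono mult_right_mono tilt) auto
    also have "\<dots> = envelope r d b \<theta> + s * ((1 - m) * P \<theta> - (1 + m) * Q \<theta>) + 4 * s\<^sup>2 * envelope r d b \<theta>"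
      unfolding PQ[symmetric] by (simp add: algebra_simps)
    also have "\<dots> \<le> ?A * (1 - c * y\<^sup>2) + \<bar>s\<bar> * (?A * (L * y)) + 4 * s\<^sup>2 * ?A"
    proof (intro add_mono)
      show "envelope r d b \<theta> \<le> ?A * (1 - c * y\<^sup>2)" using c(2)[OF th] by (simp add: y_def)
      have "s * ((1 - m) * P \<theta> - (1 + m) * Q \<theta>) \<le> \<bar>s * ((1 - m) * P \<theta> - (1 + m) * Q \<theta>)\<bar>" by (rule abs_ge_self)
      also have "\<dots> \<le> \<bar>s\<bar> * (?A * (L * y))"
        unfolding abs_mult y_def by (intro mult_left_mono rho) auto
      finally show "s * ((1 - m) * P \<theta> - (1 + m) * Q \<theta>) \<le> \<bar>s\<bar> * (?A * (L * y))" .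
      have "envelope r d b \<theta> \<le> ?A * (1 - c * (\<theta> - \<theta>\<^sub>0)\<^sup>2)" by (rule c(2)[OF th])
      also have "\<dots> \<le> ?A * 1" using A c(1) by (intro mult_left_mono) auto
      finally show "4 * s\<^sup>2 * envelope r d b \<theta> \<le> 4 * s\<^sup>2 * ?A" by (intro mult_left_mono) auto
    qed
    also have "\<dots> = ?A * (1 + (\<bar>s\<bar> * L * y - c * y\<^sup>2 + 4 * s\<^sup>2))" by (simp add: algebra_simps)
    also have "\<dots> \<le> ?A * (1 + (C * s\<^sup>2 - c / 2 * y\<^sup>2))"
    proof -
      \<comment> \<open>half of the quadratic decay absorbs the mixed term\<close>
      have "0 \<le> (\<bar>s\<bar> * L - c * y)\<^sup>2 / (2 * c)" using c by simp
      also have "(\<bar>s\<bar> * L - c * y)\<^sup>2 / (2 * c) = L\<^sup>2 / (2 * c) * s\<^sup>2 - \<bar>s\<bar> * L * y + c / 2 * y\<^sup>2"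
        using c by (simp add: power2_diff power_mult_distrib field_simps power2_eq_square)
      finally have "\<bar>s\<bar> * L * y - c * y\<^sup>2 + 4 * s\<^sup>2 \<le> C * s\<^sup>2 - c / 2 * y\<^sup>2"
        by (simp add: C_def algebra_simps)
      then show ?thesis using A by (intro mult_left_mono) auto
    qed
    also have "\<dots> \<le> ?A * exp (C * s\<^sup>2 - c / 2 * y\<^sup>2)"
      using A by (intro mult_left_mono) (auto simp: exp_ge_add_one_self)
    also have "\<dots> \<le> ?A * exp (C * (norm z)\<^sup>2 - c / 2 * (\<theta> - \<theta>\<^sub>0)\<^sup>2)"
    proof -
      have "s\<^sup>2 \<le> (norm z)\<^sup>2" using s(1) by (simp add: abs_le_square_iff[symmetric])
      then have "C * s\<^sup>2 \<le> C * (norm z)\<^sup>2" using C by (rule mult_left_mono)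
      then show ?thesis using A by (simp add: y_def)
    qed
    finally show ?thesis .
  qed
  then show ?thesis using c C by (intro exI[of _ "c / 2"]) auto
qed

lemma centered_weight_bounded:
  "\<exists>K. \<forall>z \<theta>. norm z \<le> 1/2 \<longrightarrow> norm (centered_weight r D b m z \<theta>) \<le> K"
proof -
  have "norm (centered_weight r D b m z \<theta>) \<le> exp 1 * (exp b * 2 ^ D) + exp 1 * (exp (- b) * 2 ^ D)"
    if z: "norm z \<le> 1/2" for z \<theta>
  proof -
    have s: "\<bar>Re z\<bar> \<le> 1/2" using abs_Re_le_cmod[of z] z by linarith
    have "\<bar>Re z * a\<bar> \<le> 1/2 * 2" if "\<bar>a\<bar> \<le> 2" for a
      unfolding abs_mult using s that by (intro mult_mono) auto
    from this[of "1 - m"] this[of "1 + m"] have bd: "Re z * (1 - m) \<le> 1" "- (Re z * (1 + m)) \<le> 1"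
      using abs_mag_less by (auto simp: abs_less_iff abs_le_iff)
    show ?thesis
      by (rule order_trans[OF norm_centered_weight_le])
         (use bd abs_half_edge_le[OF abs_r(1), of \<theta>] abs_half_edge_le[OF abs_r(2), of \<theta>] in
           \<open>intro add_mono mult_mono power_mono; simp\<close>)
  qed
  then show ?thesis by blast
qed

end

section \<open>Laplace's method\<close>

lemma integrable_gaussian:
  assumes "a > (0::real)" shows "integrable lborel (\<lambda>x. exp (- (a * x\<^sup>2)))"
proof -
  define \<sigma> where "\<sigma> = 1 / sqrt (2 * a)"
  have s: "\<sigma> > 0" using assms by (simp add: \<sigma>_def)
  have s2: "\<sigma>\<^sup>2 = 1 / (2 * a)" using assms by (simp add: \<sigma>_def power_divide)
  have "exp (- (a * x\<^sup>2)) = sqrt (2 * pi * \<sigma>\<^sup>2) * normal_density 0 \<sigma> x" for x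
    using s assms unfolding normal_density_def s2 by simp
  moreover have "integrable lborel (\<lambda>x. sqrt (2 * pi * \<sigma>\<^sup>2) * normal_density 0 \<sigma> x)"
    using s by (intro integrable_mult_right integrable_normal_density)
  ultimately show ?thesis by simp
qed

lemma gaussian_fourier_integral:
  "(\<integral>x. exp (\<i> * of_real (t * x) - of_real (x\<^sup>2 / 2)) \<partial>lborel) = of_real (sqrt (2 * pi) * exp (- (t\<^sup>2 / 2)))"
proof -
  have "of_real (exp (- (t\<^sup>2) / 2)) = (CLINT x|std_normal_distribution. iexp (t * x))"
    using char_std_normal_distribution unfolding char_def by metis
  also have "\<dots> = (\<integral>x. std_normal_density x *\<^sub>R iexp (t * x) \<partial>lborel)"
    by (subst integral_density) auto
  also have "\<dots> = (\<integral>x. of_real (1 / sqrt (2 * pi)) * exp (\<i> * of_real (t * x) - of_real (x\<^sup>2 / 2)) \<partial>lborel)"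
  proof (rule Bochner_Integration.integral_cong[OF refl])
    fix x :: real
    have "exp (\<i> * of_real (t * x) - of_real (x\<^sup>2 / 2)) = iexp (t * x) * of_real (exp (- (x\<^sup>2 / 2)))"
      by (metis diff_conv_add_uminus exp_add exp_of_real of_real_minus)
    then show "std_normal_density x *\<^sub>R iexp (t * x) =
        of_real (1 / sqrt (2 * pi)) * exp (\<i> * of_real (t * x) - of_real (x\<^sup>2 / 2))"
      by (simp add: std_normal_density_def scaleR_conv_of_real)
  qed
  also have "\<dots> = of_real (1 / sqrt (2 * pi)) * (\<integral>x. exp (\<i> * of_real (t * x) - of_real (x\<^sup>2 / 2)) \<partial>lborel)"
    by (rule integral_mult_right_zero)
  finally show ?thesis by (simp add: field_simps)
qed

text \<open>
  Completing the square in the real part of \<open>u\<close> reduces the integral to the characteristic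
  function of the standard normal distribution.
\<close>

lemma gaussian_integral_complex:
  fixes u :: complex and s :: real
  assumes s: "s > 0"
  shows "(\<integral>x. exp (u * of_real x - of_real (s * x\<^sup>2 / 2)) \<partial>lborel) = of_real (sqrt (2 * pi / s)) * exp (u\<^sup>2 / of_real (2 * s))"
proof -
  define a c where "a = Re u" and "c = Im u"
  define q where "q = sqrt s"
  have q: "q > 0" "s = q\<^sup>2" using s by (simp_all add: q_def)
  have u: "u = of_real a + \<i> * of_real c" by (simp add: a_def c_def complex_eq_iff)
  let ?f = "\<lambda>x. exp (u * of_real x - of_real (s * x\<^sup>2 / 2))"
  have "(\<integral>x. ?f x \<partial>lborel) = \<bar>1 / q\<bar> *\<^sub>R (\<integral>x. ?f (a / s + 1 / q * x) \<partial>lborel)"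
    by (rule lborel_integral_real_affine) (use q in simp)
  also have "(\<lambda>x. ?f (a / s + 1 / q * x)) = (\<lambda>x. exp (of_real (a\<^sup>2 / (2 * s)) + \<i> * of_real (a * c / s))
      * exp (\<i> * of_real (c / q * x) - of_real (x\<^sup>2 / 2)))"
  proof
    fix x
    have "u * of_real (a / s + 1 / q * x) - of_real (s * (a / s + 1 / q * x)\<^sup>2 / 2)
      = of_real (a * (a / s + 1 / q * x) - s * (a / s + 1 / q * x)\<^sup>2 / 2) + \<i> * of_real (c * (a / s + 1 / q * x))"
      unfolding u by (simp add: algebra_simps)
    also have "a * (a / s + 1 / q * x) - s * (a / s + 1 / q * x)\<^sup>2 / 2 = a\<^sup>2 / (2 * s) - x\<^sup>2 / 2"
      unfolding q(2) using q(1) by (simp add: field_simps power2_eq_square)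
    also have "c * (a / s + 1 / q * x) = a * c / s + c / q * x"
      by (simp add: algebra_simps)
    also have "of_real (a\<^sup>2 / (2 * s) - x\<^sup>2 / 2) + \<i> * of_real (a * c / s + c / q * x) =
       (of_real (a\<^sup>2 / (2 * s)) + \<i> * of_real (a * c / s)) + (\<i> * of_real (c / q * x) - of_real (x\<^sup>2 / 2))"
      unfolding of_real_add of_real_diff distrib_left by simp
    finally show "?f (a / s + 1 / q * x) = exp (of_real (a\<^sup>2 / (2 * s)) + \<i> * of_real (a * c / s))
      * exp (\<i> * of_real (c / q * x) - of_real (x\<^sup>2 / 2))"
      unfolding exp_add[symmetric] by (simp only:)
  qed
  also have "\<bar>1 / q\<bar> *\<^sub>R (\<integral>x. exp (of_real (a\<^sup>2 / (2 * s)) + \<i> * of_real (a * c / s))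
      * exp (\<i> * of_real (c / q * x) - of_real (x\<^sup>2 / 2)) \<partial>lborel)
    = of_real (1 / q) * (exp (of_real (a\<^sup>2 / (2 * s)) + \<i> * of_real (a * c / s)) *
        of_real (sqrt (2 * pi) * exp (- ((c / q)\<^sup>2 / 2))))"
    unfolding integral_mult_right_zero gaussian_fourier_integral using q by (simp add: scaleR_conv_of_real)
  also have "\<dots> = of_real (1 / q * sqrt (2 * pi)) *
      (exp (of_real (a\<^sup>2 / (2 * s)) + \<i> * of_real (a * c / s)) * exp (of_real (- ((c / q)\<^sup>2 / 2))))"
    unfolding exp_of_real of_real_mult by (simp only: mult_ac)
  also have "1 / q * sqrt (2 * pi) = sqrt (2 * pi / s)"
    by (simp add: q_def real_sqrt_divide)
  also have "exp (of_real (a\<^sup>2 / (2 * s)) + \<i> * of_real (a * c / s)) * exp (of_real (- ((c / q)\<^sup>2 / 2))) = exp (u\<^sup>2 / of_real (2 * s))"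
  proof -
    have "u\<^sup>2 = of_real (a\<^sup>2 - c\<^sup>2) + \<i> * of_real (2 * a * c)"
      unfolding u by (simp add: power2_eq_square algebra_simps)
    then have "u\<^sup>2 / of_real (2 * s) = of_real ((a\<^sup>2 - c\<^sup>2) / (2 * s)) + \<i> * of_real (2 * a * c / (2 * s))"
      by (simp add: add_divide_distrib)
    also have "(a\<^sup>2 - c\<^sup>2) / (2 * s) = a\<^sup>2 / (2 * s) + - ((c / q)\<^sup>2 / 2)"
      unfolding q(2) by (simp add: diff_divide_distrib power_divide)
    also have "2 * a * c / (2 * s) = a * c / s" by simp
    finally have E: "u\<^sup>2 / of_real (2 * s) = of_real (a\<^sup>2 / (2 * s) + - ((c / q)\<^sup>2 / 2)) + \<i> * of_real (a * c / s)" .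
    show ?thesis unfolding exp_add[symmetric] E of_real_add by (simp only: add_ac)
  qed
  finally show ?thesis .
qed

context optimum
begin

text \<open>
  The derivative of the magnetization with respect to the field, taken along the parameter \<open>w\<close>.
\<close>

definition "chi = mag_slope \<tau> w / slope"

lemma chi_pos: "chi > 0"
  unfolding chi_def by (intro divide_pos_pos mag_slope_pos tau slope_pos)

text \<open>
  Fluctuations of the spins for a fixed angle, plus those caused by the fluctuations of the angle.
\<close>

lemma chi_eq: "chi = (1 - m\<^sup>2) + (real d * r * (1 - t\<^sup>2) / (1 + \<tau> * t\<^sup>2))\<^sup>2 / (real d * slope)"
proof -
  define S E where "S = 1 + \<tau> * t\<^sup>2" and "E = 1 - \<tau>\<^sup>2 * t\<^sup>2"
  have SE: "S > 0" "E > 0" using bounds by (simp_all add: S_def E_def)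
  have "1 - m\<^sup>2 = (1 + m) * (1 - m)" by algebra
  also have "\<dots> = (1 - t\<^sup>2) * E / S\<^sup>2"
    unfolding mag_forms S_def E_def by (simp add: power2_eq_square algebra_simps)
  finally have 1: "1 - m\<^sup>2 = (1 - t\<^sup>2) * E / S\<^sup>2" .
  have sE: "slope * E = E - (real d - 1) * \<tau> * (1 - t\<^sup>2)"
  proof -
    have "slope = 1 - (real d - 1) * \<tau> * (1 - t\<^sup>2) / E" by (simp add: field_slope_def E_def)
    moreover have "(1 - K / E) * E = E - K" for K using SE by (simp add: field_simps)
    ultimately show ?thesis by (simp only:)
  qed
  have "(real d * r * (1 - t\<^sup>2) / S)\<^sup>2 / (real d * slope) = real d * \<tau> * (1 - t\<^sup>2)\<^sup>2 / (S\<^sup>2 * slope)"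
    using d_ge slope_pos SE by (simp add: power_divide power_mult_distrib power2_eq_square mult_ac)
  then have "(1 - m\<^sup>2) + (real d * r * (1 - t\<^sup>2) / S)\<^sup>2 / (real d * slope)
     = (1 - t\<^sup>2) * E / S\<^sup>2 + real d * \<tau> * (1 - t\<^sup>2)\<^sup>2 / (S\<^sup>2 * slope)" by (simp add: 1)
  also have "\<dots> = (1 - t\<^sup>2) * (slope * E + real d * \<tau> * (1 - t\<^sup>2)) / (S\<^sup>2 * slope)"
    using slope_pos SE by (simp add: field_simps power2_eq_square)
  also have "slope * E + real d * \<tau> * (1 - t\<^sup>2) = (1 + \<tau>) * (1 - \<tau> * t\<^sup>2)"
    unfolding sE unfolding E_def by (simp add: algebra_simps power2_eq_square)
  also have "(1 - t\<^sup>2) * ((1 + \<tau>) * (1 - \<tau> * t\<^sup>2)) / (S\<^sup>2 * slope) = chi"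
    unfolding chi_def mag_slope_def S_def by (simp add: mult_ac)
  finally show ?thesis unfolding S_def by simp
qed

lemma integral_local_form:
  "(\<integral>x. exp (local_form r d w z x) \<partial>lborel) =
    of_real (sqrt (2 * pi / (real d * slope))) * exp (of_real chi * z\<^sup>2 / 2)"
proof -
  define G s where "G = real d * r * (1 - t\<^sup>2) / (1 + \<tau> * t\<^sup>2)" and "s = real d * slope"
  have s: "s > 0" using slope_pos d_ge by (simp add: s_def)
  have "exp (local_form r d w z x) = exp (of_real (1 - m\<^sup>2) * z\<^sup>2 / 2) * exp ((of_real G * z) * of_real x - of_real (s * x\<^sup>2 / 2))" for x
  proof -
    have "local_form r d w z x = of_real (1 - m\<^sup>2) * z\<^sup>2 / 2 + ((of_real G * z) * of_real x - of_real (s * x\<^sup>2 / 2))"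
      unfolding local_form_def G_def[symmetric] s_def[symmetric]
      by (simp add: diff_divide_distrib add_divide_distrib)
    then show ?thesis unfolding exp_add[symmetric] by simp
  qed
  then have "(\<integral>x. exp (local_form r d w z x) \<partial>lborel) =
     exp (of_real (1 - m\<^sup>2) * z\<^sup>2 / 2) * (of_real (sqrt (2 * pi / s)) * exp ((of_real G * z)\<^sup>2 / of_real (2 * s)))"
    by (simp only: integral_mult_right_zero gaussian_integral_complex[OF s])
  also have "\<dots> = of_real (sqrt (2 * pi / s)) * exp (of_real (1 - m\<^sup>2) * z\<^sup>2 / 2 + (of_real G * z)\<^sup>2 / of_real (2 * s))"
    by (simp add: exp_add)
  also have "of_real (1 - m\<^sup>2) * z\<^sup>2 / 2 + (of_real G * z)\<^sup>2 / of_real (2 * s) = of_real (1 - m\<^sup>2 + G\<^sup>2 / s) * z\<^sup>2 / 2"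
    by (simp add: power_mult_distrib distrib_right add_divide_distrib del: of_real_diff)
  also have "1 - m\<^sup>2 + G\<^sup>2 / s = chi" unfolding chi_eq G_def s_def ..
  finally show ?thesis by (simp add: s_def)
qed

definition centered_transform :: "nat \<Rightarrow> complex \<Rightarrow> complex" where
  "centered_transform n z = half_circle (\<lambda>\<theta>. centered_weight r d b m z \<theta> ^ (n - 1) *
     centered_weight r (vertex_degree d n n) b m z \<theta>)"

definition "laplace_scale n = opt_weight r d d w ^ (n - 1) * opt_weight r d (vertex_degree d n n) w"

lemma laplace_scale_pos: "laplace_scale n > 0"
  unfolding laplace_scale_def using opt_weight_pos by simp

text \<open>
  The integrand of the transform at the angle \<open>\<theta>\<^sub>0 + x / sqrt n\<close>, divided by its size at the maximum.
\<close>

definition rescaled_integrand :: "complex \<Rightarrow> nat \<Rightarrow> real \<Rightarrow> complex" where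
  "rescaled_integrand z n x =
     indicator {-(pi/2)..pi/2} (\<theta>\<^sub>0 + 1 / sqrt (real n) * x) *\<^sub>R
      ((centered_weight r d b m (z / of_real (sqrt (real n))) (\<theta>\<^sub>0 + 1 / sqrt (real n) * x) / of_real (opt_weight r d d w)) ^ (n - 1)
       * (centered_weight r (vertex_degree d n n) b m (z / of_real (sqrt (real n))) (\<theta>\<^sub>0 + 1 / sqrt (real n) * x)
           / of_real (opt_weight r d (vertex_degree d n n) w)))"

lemma rescaled_integral:
  assumes "n \<ge> 1"
  shows "of_real (sqrt (real n)) * centered_transform n (z / of_real (sqrt (real n))) / of_real (laplace_scale n) =
    (\<integral>x. rescaled_integrand z n x \<partial>lborel)"
proof -
  let ?z = "z / of_real (sqrt (real n))" and ?D = "vertex_degree d n n"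
  let ?f = "\<lambda>\<theta>. indicator {-(pi/2)..pi/2} \<theta> *\<^sub>R (centered_weight r d b m ?z \<theta> ^ (n - 1) * centered_weight r ?D b m ?z \<theta>)"
  have n: "sqrt (real n) > 0" using assms by simp
  have "centered_transform n ?z = \<bar>1 / sqrt (real n)\<bar> *\<^sub>R (\<integral>x. ?f (\<theta>\<^sub>0 + 1 / sqrt (real n) * x) \<partial>lborel)"
    unfolding centered_transform_def half_circle_def set_lebesgue_integral_def
    by (rule lborel_integral_real_affine) (use n in simp)
  then have "of_real (sqrt (real n)) * centered_transform n ?z = (\<integral>x. ?f (\<theta>\<^sub>0 + 1 / sqrt (real n) * x) \<partial>lborel)"
    using n by (simp add: scaleR_conv_of_real)
  then have "of_real (sqrt (real n)) * centered_transform n ?z / of_real (laplace_scale n) =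
     (\<integral>x. ?f (\<theta>\<^sub>0 + 1 / sqrt (real n) * x) / of_real (laplace_scale n) \<partial>lborel)"
    by simp
  also have "(\<lambda>x. ?f (\<theta>\<^sub>0 + 1 / sqrt (real n) * x) / of_real (laplace_scale n)) = rescaled_integrand z n"
    by (rule ext) (simp add: rescaled_integrand_def laplace_scale_def power_divide scaleR_conv_of_real)
  finally show ?thesis .
qed

lemma inverse_sqrt_tendsto_0: "(\<lambda>n. 1 / sqrt (real n)) \<longlonglongrightarrow> 0"
  by (intro real_tendsto_divide_at_top[OF tendsto_const] filterlim_compose[OF sqrt_at_top] filterlim_real_sequentially)

lemma rescaled_integrand_tendsto:
  "(\<lambda>n. rescaled_integrand z n x) \<longlonglongrightarrow> exp (local_form r d w z x)"
proof -
  let ?e = "\<lambda>n. 1 / sqrt (real n)"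
  have zz: "z / of_real (sqrt (real n)) = z * of_real (?e n)" for n by simp
  have th: "(\<lambda>n. \<theta>\<^sub>0 + ?e n * x) \<longlonglongrightarrow> \<theta>\<^sub>0 + 0 * x"
    by (intro tendsto_intros inverse_sqrt_tendsto_0)
  have ind: "(\<lambda>n. indicator {-(pi/2)..pi/2} (\<theta>\<^sub>0 + ?e n * x) :: real) \<longlonglongrightarrow> 1"
  proof (rule tendsto_eventually)
    have "\<forall>\<^sub>F n in sequentially. \<theta>\<^sub>0 + ?e n * x > -(pi/2)" "\<forall>\<^sub>F n in sequentially. \<theta>\<^sub>0 + ?e n * x < pi/2"
      using order_tendstoD[OF th, of "-(pi/2)"] order_tendstoD[OF th, of "pi/2"] opt_angle_range by auto
    then show "\<forall>\<^sub>F n in sequentially. indicator {-(pi/2)..pi/2} (\<theta>\<^sub>0 + ?e n * x) = (1::real)"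
      by eventually_elim (simp add: indicator_def)
  qed
  have main: "(\<lambda>n. (centered_weight r d b m (z / of_real (sqrt (real n))) (\<theta>\<^sub>0 + ?e n * x) / of_real (opt_weight r d d w)) ^ (n - 1))
     \<longlonglongrightarrow> exp (local_form r d w z x)"
    using second_order_power_limit[OF second_order_centered_weight[of z x]]
    unfolding zz by (simp only: mult.commute[of x])
  have one: "(\<lambda>n. centered_weight r D b m (z / of_real (sqrt (real n))) (\<theta>\<^sub>0 + ?e n * x) / of_real (opt_weight r d D w)) \<longlonglongrightarrow> 1" for D
  proof -
    have "isCont (\<lambda>\<epsilon>. centered_weight r D b m (z * of_real \<epsilon>) (\<theta>\<^sub>0 + \<epsilon> * x)) 0"
      using continuous_on_centered_weight[of UNIV "\<lambda>\<epsilon>. z * of_real \<epsilon>" "\<lambda>\<epsilon>. \<theta>\<^sub>0 + \<epsilon> * x" r D b m]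
      by (auto simp: continuous_on_eq_continuous_at intro!: continuous_intros)
    from isCont_tendsto_compose[OF this inverse_sqrt_tendsto_0]
    have "(\<lambda>n. centered_weight r D b m (z * of_real (?e n)) (\<theta>\<^sub>0 + ?e n * x)) \<longlonglongrightarrow> centered_weight r D b m 0 \<theta>\<^sub>0"
      by simp
    moreover have "centered_weight r D b m 0 \<theta>\<^sub>0 = of_real (opt_weight r d D w)"
      using half_edge_opt_pos by (subst centered_weight_0_eq_envelope) (auto simp: opt_weight_def)
    ultimately have "(\<lambda>n. centered_weight r D b m (z * of_real (?e n)) (\<theta>\<^sub>0 + ?e n * x) / of_real (opt_weight r d D w))
       \<longlonglongrightarrow> of_real (opt_weight r d D w) / of_real (opt_weight r d D w)"
      using opt_weight_pos[of D] by (intro tendsto_divide) auto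
    then show ?thesis unfolding zz using opt_weight_pos[of D] by simp
  qed
  have "(\<lambda>n. if odd (d * n)
        then centered_weight r (d + 1) b m (z / of_real (sqrt (real n))) (\<theta>\<^sub>0 + ?e n * x) / of_real (opt_weight r d (d + 1) w)
        else centered_weight r d b m (z / of_real (sqrt (real n))) (\<theta>\<^sub>0 + ?e n * x) / of_real (opt_weight r d d w)) \<longlonglongrightarrow> 1"
    by (intro filterlim_If) (rule tendsto_mono[OF inf_le1 one])+
  then have extra: "(\<lambda>n. centered_weight r (vertex_degree d n n) b m (z / of_real (sqrt (real n))) (\<theta>\<^sub>0 + ?e n * x) / of_real (opt_weight r d (vertex_degree d n n) w)) \<longlonglongrightarrow> 1"
    by (rule Lim_transform_eventually) (simp add: vertex_degree_def)
  have "(\<lambda>n. rescaled_integrand z n x) \<longlonglongrightarrow> 1 *\<^sub>R (exp (local_form r d w z x) * 1)"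
    unfolding rescaled_integrand_def by (intro tendsto_intros ind main extra)
  then show ?thesis by simp
qed

lemma rescaled_integrand_bound:
  "\<exists>g N. integrable lborel g \<and> (\<forall>n\<ge>N. \<forall>x. norm (rescaled_integrand z n x) \<le> g x)"
proof -
  obtain c C where c: "c > 0" and C: "C \<ge> 0" and decay: "\<And>z \<theta>. \<theta> \<in> {-(pi/2)..pi/2} \<Longrightarrow> norm z \<le> 1/2 \<Longrightarrow>
     norm (centered_weight r d b m z \<theta>) \<le> opt_weight r d d w * exp (C * (norm z)\<^sup>2 - c * (\<theta> - \<theta>\<^sub>0)\<^sup>2)"
    using centered_weight_decay by metis
  obtain K where K: "\<And>z \<theta>. norm z \<le> 1/2 \<Longrightarrow> norm (centered_weight r d b m z \<theta>) \<le> K"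
    using centered_weight_bounded by metis
  obtain K' where K': "\<And>z \<theta>. norm z \<le> 1/2 \<Longrightarrow> norm (centered_weight r (d + 1) b m z \<theta>) \<le> K'"
    using centered_weight_bounded by metis
  define R where "R = max (K / opt_weight r d d w) (K' / opt_weight r d (d + 1) w)"
  have R: "norm (centered_weight r (vertex_degree d n n) b m y \<theta> / of_real (opt_weight r d (vertex_degree d n n) w)) \<le> R"
    if "norm y \<le> 1/2" for n y \<theta>
    using K[OF that, of \<theta>] K'[OF that, of \<theta>] opt_weight_pos[of d] opt_weight_pos[of "d + 1"]
    unfolding R_def vertex_degree_def
    by (auto simp: norm_divide le_max_iff_disj intro: divide_right_mono)
  have Rnn: "R \<ge> 0" by (rule order_trans[OF norm_ge_zero R[of 0 0 0]]) simp
  define g where "g = (\<lambda>x::real. exp (C * (norm z)\<^sup>2) * R * exp (- (c / 2 * x\<^sup>2)))"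
  have "integrable lborel g"
    unfolding g_def using c by (intro integrable_mult_right integrable_gaussian) simp
  moreover have "norm (rescaled_integrand z n x) \<le> g x"
    \<comment> \<open>the first bound gives \<open>(n - 1) / n \<ge> 1/2\<close>, the second \<open>norm (z / sqrt n) \<le> 1/2\<close>\<close>
    if n: "n \<ge> max 2 (nat \<lceil>4 * (norm z)\<^sup>2\<rceil>)" for n x
  proof (cases "\<theta>\<^sub>0 + 1 / sqrt (real n) * x \<in> {-(pi/2)..pi/2}")
    case False
    then show ?thesis using Rnn by (simp add: rescaled_integrand_def g_def)
  next
    case True
    have n2: "real n \<ge> 2" using n by simp
    have n4: "4 * (norm z)\<^sup>2 \<le> real n" using n by linarith
    let ?y = "z / of_real (sqrt (real n))" and ?\<theta> = "\<theta>\<^sub>0 + 1 / sqrt (real n) * x"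
    have ny2: "(norm ?y)\<^sup>2 = (norm z)\<^sup>2 / real n" by (simp add: norm_divide power_divide)
    have "(norm ?y)\<^sup>2 \<le> (1/2)\<^sup>2" unfolding ny2 using n4 n2 by (simp add: power_divide divide_le_eq)
    then have ny: "norm ?y \<le> 1/2" by (rule power2_le_imp_le) simp
    have th2: "(?\<theta> - \<theta>\<^sub>0)\<^sup>2 = x\<^sup>2 / real n" by (simp add: power_divide power_mult_distrib)
    have "norm (centered_weight r d b m ?y ?\<theta> / of_real (opt_weight r d d w)) \<le> exp (C * ((norm z)\<^sup>2 / real n) - c * (x\<^sup>2 / real n))"
      using decay[OF True ny] opt_weight_pos[of d] unfolding ny2 th2
      by (simp add: norm_divide divide_le_eq mult.commute)
    then have "norm (centered_weight r d b m ?y ?\<theta> / of_real (opt_weight r d d w)) ^ (n - 1) \<le> exp (C * ((norm z)\<^sup>2 / real n) - c * (x\<^sup>2 / real n)) ^ (n - 1)"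
      by (intro power_mono) auto
    also have "\<dots> = exp (real (n - 1) * (C * ((norm z)\<^sup>2 / real n) - c * (x\<^sup>2 / real n)))"
      by (simp add: exp_of_nat_mult)
    also have "\<dots> \<le> exp (C * (norm z)\<^sup>2 - c / 2 * x\<^sup>2)"
    proof -
      define \<rho> where "\<rho> = real (n - 1) / real n"
      have \<rho>: "1/2 \<le> \<rho>" "\<rho> \<le> 1" using n2 by (simp_all add: \<rho>_def field_simps of_nat_diff)
      have "real (n - 1) * (C * ((norm z)\<^sup>2 / real n) - c * (x\<^sup>2 / real n)) = \<rho> * (C * (norm z)\<^sup>2) - \<rho> * (c * x\<^sup>2)"
        by (simp add: \<rho>_def algebra_simps)
      also have "\<dots> \<le> 1 * (C * (norm z)\<^sup>2) - 1/2 * (c * x\<^sup>2)"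
        using \<rho> C c by (intro diff_mono mult_right_mono) auto
      finally show ?thesis by simp
    qed
    finally have main: "norm (centered_weight r d b m ?y ?\<theta> / of_real (opt_weight r d d w)) ^ (n - 1)
      \<le> exp (C * (norm z)\<^sup>2 - c / 2 * x\<^sup>2)" .
    have "norm (rescaled_integrand z n x) \<le> exp (C * (norm z)\<^sup>2 - c / 2 * x\<^sup>2) * R"
      unfolding rescaled_integrand_def indicator_simps(1)[OF True] scaleR_one norm_mult norm_power
      by (intro mult_mono main R[OF ny]) auto
    also have "\<dots> = g x" 
      unfolding g_def diff_conv_add_uminus[of "C * (norm z)\<^sup>2"] exp_add by (simp only: mult_ac)
    finally show ?thesis .
  qed
  ultimately show ?thesis by blast
qed

text \<open>
  Dominated convergence for the integral in the variable \<open>x = sqrt n * (\<theta> - \<theta>\<^sub>0)\<close>.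
\<close>

lemma laplace_limit:
  "(\<lambda>n. of_real (sqrt (real n)) * centered_transform n (z / of_real (sqrt (real n))) / of_real (laplace_scale n))
     \<longlonglongrightarrow> of_real (sqrt (2 * pi / (real d * slope))) * exp (of_real chi * z\<^sup>2 / 2)"
proof -
  obtain g N where g: "integrable lborel g" "\<And>n x. n \<ge> N \<Longrightarrow> norm (rescaled_integrand z n x) \<le> g x"
    using rescaled_integrand_bound by metis
  have meas: "rescaled_integrand z n \<in> borel_measurable lborel" for n
    unfolding rescaled_integrand_def
  proof (rule borel_measurable_scaleR)
    show "(\<lambda>x. indicat_real {-(pi/2)..pi/2} (\<theta>\<^sub>0 + 1 / sqrt (real n) * x)) \<in> borel_measurable lborel"
      by simp
    show "(\<lambda>x. (centered_weight r d b m (z / of_real (sqrt (real n))) (\<theta>\<^sub>0 + 1 / sqrt (real n) * x) / of_real (opt_weight r d d w)) ^ (n - 1)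
       * (centered_weight r (vertex_degree d n n) b m (z / of_real (sqrt (real n))) (\<theta>\<^sub>0 + 1 / sqrt (real n) * x)
           / of_real (opt_weight r d (vertex_degree d n n) w))) \<in> borel_measurable lborel"
    proof -
      have nz: "complex_of_real (opt_weight r d D w) \<noteq> 0" for D
        using opt_weight_pos[of D] by simp
      show ?thesis
        unfolding measurable_lborel2
        by (intro borel_measurable_continuous_onI continuous_intros ballI nz)
    qed
  qed
  have meas': "(\<lambda>x. exp (local_form r d w z x)) \<in> borel_measurable lborel"
    unfolding local_form_def measurable_lborel2 by (intro borel_measurable_continuous_onI continuous_intros) auto
  have "(\<lambda>n. \<integral>x. rescaled_integrand z (n + N) x \<partial>lborel) \<longlonglongrightarrow> (\<integral>x. exp (local_form r d w z x) \<partial>lborel)"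
    by (rule integral_dominated_convergence[OF meas' meas g(1)])
       (use g(2) LIMSEQ_ignore_initial_segment[OF rescaled_integrand_tendsto] in auto)
  then have "(\<lambda>n. \<integral>x. rescaled_integrand z n x \<partial>lborel) \<longlonglongrightarrow>
      of_real (sqrt (2 * pi / (real d * slope))) * exp (of_real chi * z\<^sup>2 / 2)"
    unfolding integral_local_form by (rule LIMSEQ_offset)
  moreover have "\<forall>\<^sub>F n in sequentially. (\<integral>x. rescaled_integrand z n x \<partial>lborel) =
     of_real (sqrt (real n)) * centered_transform n (z / of_real (sqrt (real n))) / of_real (laplace_scale n)"
    using eventually_ge_at_top[of 1] by eventually_elim (simp only: rescaled_integral)
  ultimately show ?thesis by (rule Lim_transform_eventually)
qed

end

section \<open>Moments and the central limit theorem\<close>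

lemma two_cosh_ge: "2 + x\<^sup>2 \<le> exp x + exp (- x)" for x :: real
proof -
  define y where "y = x / 2"
  have "\<bar>y\<bar> \<le> \<bar>(exp y - exp (- y)) / 2\<bar>"
    using real_le_abs_sinh[of y] by (simp add: exp_minus)
  then have "y\<^sup>2 \<le> ((exp y - exp (- y)) / 2)\<^sup>2" by (simp only: abs_le_square_iff)
  also have "\<dots> = ((exp y)\<^sup>2 + (exp (- y))\<^sup>2 - 2) / 4"
  proof -
    have "exp y * exp (- y) = 1" by (simp add: exp_add[symmetric])
    then show ?thesis by (simp add: power_divide power2_diff)
  qed
  also have "\<dots> = (exp x + exp (- x) - 2) / 4"
    by (simp add: y_def power2_eq_square exp_add[symmetric])
  finally show ?thesis by (simp add: y_def power_divide)
qed

lemma one_minus_cos_le: "1 - cos x \<le> x\<^sup>2 / 2" for x :: real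
proof -
  have "1 - cos x = 2 * (sin (x / 2))\<^sup>2"
    using cos_double_sin[of "x / 2"] by simp
  also have "(sin (x / 2))\<^sup>2 \<le> (x / 2)\<^sup>2"
    using abs_sin_x_le_abs_x[of "x / 2"] by (simp only: abs_le_square_iff)
  finally show ?thesis by (simp add: power_divide)
qed

text \<open>
  A squeeze with bounds that only become sharp as an auxiliary parameter tends to \<open>0\<close>.
\<close>

lemma tendsto_squeeze_parametric:
  fixes x :: "nat \<Rightarrow> real" and l u :: "real \<Rightarrow> real"
  assumes "\<And>h n. h > 0 \<Longrightarrow> L h n \<le> x n" "\<And>h n. h > 0 \<Longrightarrow> x n \<le> U h n"
    and "\<And>h. h > 0 \<Longrightarrow> L h \<longlonglongrightarrow> l h" "\<And>h. h > 0 \<Longrightarrow> U h \<longlonglongrightarrow> u h"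
    and "(l \<longlongrightarrow> a) (at_right 0)" "(u \<longlongrightarrow> a) (at_right 0)"
  shows "x \<longlonglongrightarrow> a"
proof (rule order_tendstoI)
  fix y assume "y < a"
  then have "\<forall>\<^sub>F h in at_right 0. y < l h \<and> h > 0"
    using order_tendstoD(1)[OF assms(5)] eventually_at_right_less[of 0] by (intro eventually_conj) auto
  then obtain h where "y < l h" "h > 0"
    using eventually_happens'[OF trivial_limit_at_right_real] by blast
  then have "\<forall>\<^sub>F n in sequentially. y < L h n" using order_tendstoD(1)[OF assms(3)] by blast
  then show "\<forall>\<^sub>F n in sequentially. y < x n"
    by eventually_elim (rule less_le_trans[OF _ assms(1)[OF \<open>h > 0\<close>]])
next
  fix y assume "a < y"
  then have "\<forall>\<^sub>F h in at_right 0. u h < y \<and> h > 0"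
    using order_tendstoD(2)[OF assms(6)] eventually_at_right_less[of 0] by (intro eventually_conj) auto
  then obtain h where "u h < y" "h > 0"
    using eventually_happens'[OF trivial_limit_at_right_real] by blast
  then have "\<forall>\<^sub>F n in sequentially. U h n < y" using order_tendstoD(2)[OF assms(4)] by blast
  then show "\<forall>\<^sub>F n in sequentially. x n < y"
    by eventually_elim (rule le_less_trans[OF assms(2)[OF \<open>h > 0\<close>]])
qed

text \<open>
  The bounds \<open>1 + h * y \<le> exp (h * y)\<close>, \<open>2 + (h * y)\<^sup>2 \<le> exp (h * y) + exp (- h * y)\<close> and
  \<open>1 - cos (h * y) \<le> (h * y)\<^sup>2 / 2\<close> control the first two moments by exponential moments at \<open>h\<close>,
  \<open>- h\<close> and \<open>\<i> * h\<close>; they are sharp as \<open>h\<close> tends to \<open>0\<close>.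
\<close>

lemma moments_from_exponential_moments:
  fixes M :: "nat \<Rightarrow> 'a measure" and Y :: "nat \<Rightarrow> 'a \<Rightarrow> real"
  assumes prob: "\<And>n. prob_space (M n)"
    and int: "\<And>n (f :: 'a \<Rightarrow> real). integrable (M n) f" and intc: "\<And>n (f :: 'a \<Rightarrow> complex). integrable (M n) f"
    and "v > 0"
    and lim: "\<And>z :: complex. (\<lambda>n. \<integral>\<sigma>. exp (z * of_real (Y n \<sigma>)) \<partial>M n) \<longlonglongrightarrow> exp (of_real v * z\<^sup>2 / 2)"
  shows "(\<lambda>n. \<integral>\<sigma>. Y n \<sigma> \<partial>M n) \<longlonglongrightarrow> 0" "(\<lambda>n. \<integral>\<sigma>. (Y n \<sigma>)\<^sup>2 \<partial>M n) \<longlonglongrightarrow> v"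
proof -
  define E where "E = (\<lambda>h n. \<integral>\<sigma>. exp (h * Y n \<sigma>) \<partial>M n)"
  define C where "C = (\<lambda>h n. \<integral>\<sigma>. cos (h * Y n \<sigma>) \<partial>M n)"
  have E: "E h \<longlonglongrightarrow> exp (v * h\<^sup>2 / 2)" for h
  proof -
    have "(\<integral>\<sigma>. exp (of_real h * of_real (Y n \<sigma>)) \<partial>M n) = complex_of_real (E h n)" for n
      unfolding E_def of_real_mult[symmetric] exp_of_real by (rule integral_complex_of_real)
    then have "(\<lambda>n. complex_of_real (E h n)) \<longlonglongrightarrow> of_real (exp (v * h\<^sup>2 / 2))"
      using lim[of "of_real h"] by (simp add: exp_of_real[symmetric])
    then show ?thesis by (simp only: tendsto_of_real_iff)
  qed
  have C: "C h \<longlonglongrightarrow> exp (- (v * h\<^sup>2 / 2))" for h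
  proof -
    have "Re (\<integral>\<sigma>. exp (\<i> * of_real h * of_real (Y n \<sigma>)) \<partial>M n) = C h n" for n
      unfolding C_def
      by (subst integral_Re[OF intc, symmetric]) (simp add: Re_exp)
    moreover have "Re (exp (of_real v * (\<i> * of_real h)\<^sup>2 / 2)) = exp (- (v * h\<^sup>2 / 2))"
    proof -
      have "of_real v * (\<i> * of_real h)\<^sup>2 / 2 = complex_of_real (- (v * h\<^sup>2 / 2))"
        by (simp add: power_mult_distrib)
      then show ?thesis by (simp only: exp_of_real Re_complex_of_real)
    qed
    ultimately show ?thesis using tendsto_Re[OF lim[of "\<i> * of_real h"]] by simp
  qed
  show "(\<lambda>n. \<integral>\<sigma>. Y n \<sigma> \<partial>M n) \<longlonglongrightarrow> 0"
  proof (rule tendsto_squeeze_parametric[where L = "\<lambda>h n. (1 - E (- h) n) / h" and U = "\<lambda>h n. (E h n - 1) / h"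
        and l = "\<lambda>h. (1 - exp (v * h\<^sup>2 / 2)) / h" and u = "\<lambda>h. (exp (v * h\<^sup>2 / 2) - 1) / h"])
    have le: "1 + h * (\<integral>\<sigma>. Y n \<sigma> \<partial>M n) \<le> E h n" for h n
    proof -
      have "(\<integral>\<sigma>. 1 + h * Y n \<sigma> \<partial>M n) \<le> E h n"
        unfolding E_def by (intro integral_mono int exp_ge_add_one_self)
      then show ?thesis by (simp add: int prob_space.prob_space[OF prob])
    qed
    show "(1 - E (- h) n) / h \<le> (\<integral>\<sigma>. Y n \<sigma> \<partial>M n)" if "h > 0" for h n
      using le[of "- h" n] that by (simp add: divide_le_eq mult.commute)
    show "(\<integral>\<sigma>. Y n \<sigma> \<partial>M n) \<le> (E h n - 1) / h" if "h > 0" for h n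
      using le[of h n] that by (simp add: le_divide_eq mult.commute)
    show "(\<lambda>n. (1 - E (- h) n) / h) \<longlonglongrightarrow> (1 - exp (v * h\<^sup>2 / 2)) / h" if "h > 0" for h
      using E[of "- h"] that by (intro tendsto_intros) auto
    show "(\<lambda>n. (E h n - 1) / h) \<longlonglongrightarrow> (exp (v * h\<^sup>2 / 2) - 1) / h" if "h > 0" for h
      using E[of h] that by (intro tendsto_intros) auto
    show "((\<lambda>h. (1 - exp (v * h\<^sup>2 / 2)) / h) \<longlongrightarrow> 0) (at_right 0)" using \<open>v > 0\<close> by real_asymp
    show "((\<lambda>h. (exp (v * h\<^sup>2 / 2) - 1) / h) \<longlongrightarrow> 0) (at_right 0)" using \<open>v > 0\<close> by real_asymp
  qed
  show "(\<lambda>n. \<integral>\<sigma>. (Y n \<sigma>)\<^sup>2 \<partial>M n) \<longlonglongrightarrow> v"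
  proof (rule tendsto_squeeze_parametric[where L = "\<lambda>h n. 2 * (1 - C h n) / h\<^sup>2" and U = "\<lambda>h n. (E h n + E (- h) n - 2) / h\<^sup>2"
        and l = "\<lambda>h. 2 * (1 - exp (- (v * h\<^sup>2 / 2))) / h\<^sup>2" and u = "\<lambda>h. (exp (v * h\<^sup>2 / 2) + exp (v * h\<^sup>2 / 2) - 2) / h\<^sup>2"])
    fix h :: real and n assume h: "h > 0"
    have "(\<integral>\<sigma>. 1 - cos (h * Y n \<sigma>) \<partial>M n) \<le> (\<integral>\<sigma>. (h * Y n \<sigma>)\<^sup>2 / 2 \<partial>M n)"
      by (intro integral_mono int one_minus_cos_le)
    then have "1 - C h n \<le> h\<^sup>2 * (\<integral>\<sigma>. (Y n \<sigma>)\<^sup>2 \<partial>M n) / 2"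
      by (simp add: int prob_space.prob_space[OF prob] C_def power_mult_distrib)
    then show "2 * (1 - C h n) / h\<^sup>2 \<le> (\<integral>\<sigma>. (Y n \<sigma>)\<^sup>2 \<partial>M n)"
      using h by (simp add: divide_le_eq mult.commute)
    have "(\<integral>\<sigma>. 2 + (h * Y n \<sigma>)\<^sup>2 \<partial>M n) \<le> (\<integral>\<sigma>. exp (h * Y n \<sigma>) + exp (- (h * Y n \<sigma>)) \<partial>M n)"
      by (intro integral_mono int two_cosh_ge)
    moreover have "(\<integral>\<sigma>. (2::real) \<partial>M n) = 2" using prob_space.prob_space[OF prob[of n]] by simp
    ultimately have "2 + h\<^sup>2 * (\<integral>\<sigma>. (Y n \<sigma>)\<^sup>2 \<partial>M n) \<le> E h n + E (- h) n"
      by (simp add: int E_def power_mult_distrib)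
    then show "(\<integral>\<sigma>. (Y n \<sigma>)\<^sup>2 \<partial>M n) \<le> (E h n + E (- h) n - 2) / h\<^sup>2"
      using h by (simp add: le_divide_eq mult.commute)
  next
    fix h :: real assume h: "h > 0"
    show "(\<lambda>n. 2 * (1 - C h n) / h\<^sup>2) \<longlonglongrightarrow> 2 * (1 - exp (- (v * h\<^sup>2 / 2))) / h\<^sup>2"
      using h by (intro tendsto_intros C) auto
    show "(\<lambda>n. (E h n + E (- h) n - 2) / h\<^sup>2) \<longlonglongrightarrow> (exp (v * h\<^sup>2 / 2) + exp (v * h\<^sup>2 / 2) - 2) / h\<^sup>2"
      using h E[of h] E[of "- h"] by (intro tendsto_intros) auto
  next
    show "((\<lambda>h. 2 * (1 - exp (- (v * h\<^sup>2 / 2))) / h\<^sup>2) \<longlongrightarrow> v) (at_right 0)" using \<open>v > 0\<close> by real_asymp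
    show "((\<lambda>h. (exp (v * h\<^sup>2 / 2) + exp (v * h\<^sup>2 / 2) - 2) / h\<^sup>2) \<longlongrightarrow> v) (at_right 0)" using \<open>v > 0\<close> by real_asymp
  qed
qed

lemma char_centered_gaussian:
  assumes "v > 0" shows "char (centered_gaussian v) s = exp (- (of_real v * (of_real s)\<^sup>2 / 2))"
proof -
  have "char (centered_gaussian v) s = (\<integral>x. normal_density 0 (sqrt v) x *\<^sub>R iexp (s * x) \<partial>lborel)"
    using assms unfolding char_def centered_gaussian_def by (simp add: integral_density)
  also have "\<dots> = (\<integral>x. of_real (1 / sqrt (2 * pi * v)) * exp (\<i> * of_real s * of_real x - of_real (1 / v * x\<^sup>2 / 2)) \<partial>lborel)"
  proof (rule Bochner_Integration.integral_cong[OF refl])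
    fix x :: real
    have "exp (\<i> * of_real s * of_real x - of_real (1 / v * x\<^sup>2 / 2)) = iexp (s * x) * of_real (exp (- (1 / v * x\<^sup>2 / 2)))"
      unfolding diff_conv_add_uminus exp_add of_real_minus[symmetric] exp_of_real of_real_mult mult.assoc ..
    moreover have "normal_density 0 (sqrt v) x = 1 / sqrt (2 * pi * v) * exp (- (1 / v * x\<^sup>2 / 2))"
      using assms by (simp add: normal_density_def)
    ultimately show "normal_density 0 (sqrt v) x *\<^sub>R iexp (s * x) =
        of_real (1 / sqrt (2 * pi * v)) * exp (\<i> * of_real s * of_real x - of_real (1 / v * x\<^sup>2 / 2))"
      by (simp add: scaleR_conv_of_real)
  qed
  also have "\<dots> = of_real (1 / sqrt (2 * pi * v)) * (of_real (sqrt (2 * pi / (1 / v))) * exp ((\<i> * of_real s)\<^sup>2 / of_real (2 * (1 / v))))"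
    unfolding integral_mult_right_zero using assms by (subst gaussian_integral_complex) auto
  also have "(\<i> * of_real s)\<^sup>2 / of_real (2 * (1 / v)) = - (of_real v * (of_real s)\<^sup>2 / 2)"
    by (simp add: power_mult_distrib)
  finally show ?thesis using assms by simp
qed

lemma real_distribution_centered_gaussian:
  assumes "v > 0" shows "real_distribution (centered_gaussian v)"
proof -
  have "prob_space (density lborel (normal_density 0 (sqrt v)))"
    using assms by (intro prob_space_normal_density) simp
  then have "prob_space (centered_gaussian v)" using assms by (simp add: centered_gaussian_def)
  moreover have "sets (centered_gaussian v) = sets borel" using assms by (simp add: centered_gaussian_def)
  ultimately show ?thesis by (simp add: real_distribution_def real_distribution_axioms_def)
qed

locale annealed_optimum =
  fixes \<beta> :: real and d :: nat and w :: real
  assumes \<beta>_nonneg: "\<beta> \<ge> 0" and d_ge_2: "d \<ge> 2" and regular_w: "regular_param (tanh \<beta>) d w"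
begin

abbreviation "B \<equiv> field_of (tanh \<beta>) d w"
abbreviation "\<mu> n \<equiv> annealed_measure d \<beta> B n"

lemma tanh_\<beta>: "0 \<le> tanh \<beta>" "tanh \<beta> < 1" "(sqrt (tanh \<beta>))\<^sup>2 = tanh \<beta>"
  using \<beta>_nonneg by (auto simp: tanh_real_lt_1)

sublocale optimum "sqrt (tanh \<beta>)" d w
  by unfold_locales (use tanh_\<beta> d_ge_2 regular_w in auto)

definition fluctuation :: "nat \<Rightarrow> (nat \<Rightarrow> real) \<Rightarrow> real" where
  "fluctuation n \<sigma> = (total_spin n \<sigma> - real n * mag_of (tanh \<beta>) w) / sqrt (real n)"

lemma centered_transform_eq:
  assumes "n \<ge> 1"
  shows "centered_transform n y = exp (- (of_real (real n * mag_of (tanh \<beta>) w) * y)) *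
    spin_transform (sqrt (tanh \<beta>)) d n (of_real B + y)"
proof -
  let ?k = "exp (- (of_real (mag_of (tanh \<beta>) w) * y))"
  have "?k ^ (n - 1) * ?k = ?k ^ n" using assms by (cases n) auto
  also have "\<dots> = exp (- (of_real (real n * mag_of (tanh \<beta>) w) * y))"
    by (simp add: exp_of_nat_mult[symmetric] mult.assoc)
  finally have k: "?k ^ (n - 1) * ?k = exp (- (of_real (real n * mag_of (tanh \<beta>) w) * y))" .
  have shuffle: "(a * u) ^ (n - 1) * (a * v) = (a ^ (n - 1) * a) * (u ^ (n - 1) * v)" for a u v :: complex
    by (simp add: power_mult_distrib mult_ac)
  show ?thesis
    unfolding centered_transform_def spin_transform_def centered_weight_def tanh_\<beta>(3) k[symmetric]
      half_circle_mult_right[symmetric] shuffle ..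
qed

lemma fluctuation_exponential_moment:
  assumes "n \<ge> 1"
  shows "(\<integral>\<sigma>. exp (z * of_real (fluctuation n \<sigma>)) \<partial>\<mu> n) =
    centered_transform n (z / of_real (sqrt (real n))) / centered_transform n 0"
proof -
  let ?y = "z / of_real (sqrt (real n))" and ?m = "mag_of (tanh \<beta>) w"
  have "exp (z * of_real (fluctuation n \<sigma>)) = exp (- (of_real (real n * ?m) * ?y)) * exp (?y * of_real (total_spin n \<sigma>))" for \<sigma>
    unfolding exp_add[symmetric] fluctuation_def
    by (simp add: diff_divide_distrib algebra_simps)
  then have "(\<integral>\<sigma>. exp (z * of_real (fluctuation n \<sigma>)) \<partial>\<mu> n) =
    exp (- (of_real (real n * ?m) * ?y)) * (\<integral>\<sigma>. exp (?y * of_real (total_spin n \<sigma>)) \<partial>\<mu> n)"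
    by (simp only: integral_mult_right_zero)
  also have "\<dots> = exp (- (of_real (real n * ?m) * ?y)) * (spin_transform (sqrt (tanh \<beta>)) d n (of_real B + ?y) /
       spin_transform (sqrt (tanh \<beta>)) d n (of_real B))"
    by (simp only: annealed_exponential_moment[OF assms \<beta>_nonneg])
  also have "\<dots> = centered_transform n ?y / centered_transform n 0"
    unfolding centered_transform_eq[OF assms] by simp
  finally show ?thesis .
qed

text \<open>
  The Laplace asymptotics at \<open>z\<close> and at \<open>0\<close> share their scale and their prefactor, so only the
  exponential survives in the quotient.
\<close>

lemma fluctuation_limit:
  fixes z :: complex
  shows
  "(\<lambda>n. \<integral>\<sigma>. exp (z * of_real (fluctuation n \<sigma>)) \<partial>\<mu> n) \<longlonglongrightarrow> exp (of_real chi * z\<^sup>2 / 2)"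
proof -
  let ?L = "\<lambda>z n. of_real (sqrt (real n)) * centered_transform n (z / of_real (sqrt (real n))) / of_real (laplace_scale n)"
  define \<kappa> where "\<kappa> = complex_of_real (sqrt (2 * pi / (real d * slope)))"
  have \<kappa>: "\<kappa> \<noteq> 0" using slope_pos d_ge_2 by (simp add: \<kappa>_def)
  have "(\<lambda>n. ?L z n / ?L 0 n) \<longlonglongrightarrow> (\<kappa> * exp (of_real chi * z\<^sup>2 / 2)) / (\<kappa> * exp (of_real chi * 0\<^sup>2 / 2))"
    unfolding \<kappa>_def by (rule tendsto_divide[OF laplace_limit laplace_limit]) (use \<kappa> in \<open>simp add: \<kappa>_def\<close>)
  also have "(\<kappa> * exp (of_real chi * z\<^sup>2 / 2)) / (\<kappa> * exp (of_real chi * 0\<^sup>2 / 2)) = exp (of_real chi * z\<^sup>2 / 2)"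
    using \<kappa> by simp
  finally have "(\<lambda>n. ?L z n / ?L 0 n) \<longlonglongrightarrow> exp (of_real chi * z\<^sup>2 / 2)" .
  moreover have "\<forall>\<^sub>F n in sequentially. ?L z n / ?L 0 n = (\<integral>\<sigma>. exp (z * of_real (fluctuation n \<sigma>)) \<partial>\<mu> n)"
    using eventually_ge_at_top[of 1]
  proof eventually_elim
    case (elim n)
    then show ?case
      using laplace_scale_pos[of n] by (subst fluctuation_exponential_moment) auto
  qed
  ultimately show ?thesis by (rule Lim_transform_eventually)
qed

lemmas prob_\<mu> = prob_space_annealed_measure[of d \<beta> B]

lemma fluctuation_mean: "(\<lambda>n. \<integral>\<sigma>. fluctuation n \<sigma> \<partial>\<mu> n) \<longlonglongrightarrow> 0"
  and fluctuation_second_moment: "(\<lambda>n. \<integral>\<sigma>. (fluctuation n \<sigma>)\<^sup>2 \<partial>\<mu> n) \<longlonglongrightarrow> chi"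
  by (rule moments_from_exponential_moments[where v = chi];
      rule prob_\<mu> integrable_annealed_measure chi_pos fluctuation_limit)+

lemma fluctuation_expectation:
  assumes "n \<ge> 1"
  shows "(\<integral>\<sigma>. fluctuation n \<sigma> \<partial>\<mu> n) =
    ((\<integral>\<sigma>. total_spin n \<sigma> \<partial>\<mu> n) - real n * mag_of (tanh \<beta>) w) / sqrt (real n)"
  using prob_space.prob_space[OF prob_\<mu>[of n]]
  by (simp add: fluctuation_def integrable_annealed_measure)

lemma variance_limit:
  "(\<lambda>n. prob_space.variance (\<mu> n) (\<lambda>\<sigma>. total_spin n \<sigma> / sqrt (real n))) \<longlonglongrightarrow> chi"
proof -
  have "(\<lambda>n. (\<integral>\<sigma>. (fluctuation n \<sigma>)\<^sup>2 \<partial>\<mu> n) - (\<integral>\<sigma>. fluctuation n \<sigma> \<partial>\<mu> n)\<^sup>2) \<longlonglongrightarrow> chi - 0\<^sup>2"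
    by (intro tendsto_intros fluctuation_mean fluctuation_second_moment)
  moreover have "\<forall>\<^sub>F n in sequentially. (\<integral>\<sigma>. (fluctuation n \<sigma>)\<^sup>2 \<partial>\<mu> n) - (\<integral>\<sigma>. fluctuation n \<sigma> \<partial>\<mu> n)\<^sup>2
     = prob_space.variance (\<mu> n) (\<lambda>\<sigma>. total_spin n \<sigma> / sqrt (real n))"
    using eventually_ge_at_top[of 1]
  proof eventually_elim
    case (elim n)
    have "(\<integral>\<sigma>. (fluctuation n \<sigma>)\<^sup>2 \<partial>\<mu> n) - (\<integral>\<sigma>. fluctuation n \<sigma> \<partial>\<mu> n)\<^sup>2 = prob_space.variance (\<mu> n) (fluctuation n)"
      by (rule prob_space.variance_eq[OF prob_\<mu> integrable_annealed_measure integrable_annealed_measure, symmetric])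
    also have "\<dots> = prob_space.variance (\<mu> n) (\<lambda>\<sigma>. total_spin n \<sigma> / sqrt (real n))"
      unfolding fluctuation_expectation[OF elim]
      by (simp add: fluctuation_def diff_divide_distrib)
    finally show ?case .
  qed
  ultimately show ?thesis by (auto intro: Lim_transform_eventually)
qed

lemma mean_spin_limit: "mean_spin d \<beta> B \<longlonglongrightarrow> mag_of (tanh \<beta>) w"
proof -
  have "(\<lambda>n. mag_of (tanh \<beta>) w + (\<integral>\<sigma>. fluctuation n \<sigma> \<partial>\<mu> n) * (1 / sqrt (real n))) \<longlonglongrightarrow> mag_of (tanh \<beta>) w + 0 * 0"
    by (intro tendsto_intros fluctuation_mean inverse_sqrt_tendsto_0)
  moreover have "\<forall>\<^sub>F n in sequentially. mag_of (tanh \<beta>) w + (\<integral>\<sigma>. fluctuation n \<sigma> \<partial>\<mu> n) * (1 / sqrt (real n)) = mean_spin d \<beta> B n"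
    using eventually_ge_at_top[of 1]
  proof eventually_elim
    case (elim n)
    then show ?case
      unfolding mean_spin_def fluctuation_expectation[OF elim] by (simp add: field_simps)
  qed
  ultimately show ?thesis by (auto intro: Lim_transform_eventually)
qed

text \<open>
  The error made by centring at \<open>n * m\<close> instead of the mean vanishes in the limit by
  \<open>fluctuation_mean\<close>.
\<close>

lemma central_limit:
  "weak_conv_m
    (\<lambda>n. distr (\<mu> n) borel (\<lambda>\<sigma>. (total_spin n \<sigma> - prob_space.expectation (\<mu> n) (total_spin n)) / sqrt (real n)))
    (centered_gaussian chi)"
proof (rule levy_continuity)
  let ?X = "\<lambda>n \<sigma>. (total_spin n \<sigma> - prob_space.expectation (\<mu> n) (total_spin n)) / sqrt (real n)"
  show "real_distribution (distr (\<mu> n) borel (?X n))" for n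
    by (rule prob_space.real_distribution_distr[OF prob_\<mu> measurable_annealed_measure])
  show "real_distribution (centered_gaussian chi)"
    by (rule real_distribution_centered_gaussian[OF chi_pos])
  fix s :: real
  have "(\<lambda>n. exp (- (\<i> * of_real s * of_real (\<integral>\<sigma>. fluctuation n \<sigma> \<partial>\<mu> n))) * (\<integral>\<sigma>. exp (\<i> * of_real s * of_real (fluctuation n \<sigma>)) \<partial>\<mu> n))
     \<longlonglongrightarrow> exp (- (\<i> * of_real s * of_real 0)) * exp (of_real chi * (\<i> * of_real s)\<^sup>2 / 2)"
    by (intro tendsto_intros fluctuation_mean fluctuation_limit)
  then have "(\<lambda>n. exp (- (\<i> * of_real s * of_real (\<integral>\<sigma>. fluctuation n \<sigma> \<partial>\<mu> n))) * (\<integral>\<sigma>. exp (\<i> * of_real s * of_real (fluctuation n \<sigma>)) \<partial>\<mu> n))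
     \<longlonglongrightarrow> char (centered_gaussian chi) s"
    by (simp add: char_centered_gaussian[OF chi_pos] power_mult_distrib)
  moreover have "\<forall>\<^sub>F n in sequentially. exp (- (\<i> * of_real s * of_real (\<integral>\<sigma>. fluctuation n \<sigma> \<partial>\<mu> n))) * (\<integral>\<sigma>. exp (\<i> * of_real s * of_real (fluctuation n \<sigma>)) \<partial>\<mu> n)
     = char (distr (\<mu> n) borel (?X n)) s"
    using eventually_ge_at_top[of 1]
  proof eventually_elim
    case (elim n)
    have X: "?X n \<sigma> = fluctuation n \<sigma> - (\<integral>\<sigma>. fluctuation n \<sigma> \<partial>\<mu> n)" for \<sigma>
      unfolding fluctuation_expectation[OF elim] by (simp add: fluctuation_def diff_divide_distrib)
    have "char (distr (\<mu> n) borel (?X n)) s = (\<integral>\<sigma>. iexp (s * ?X n \<sigma>) \<partial>\<mu> n)"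
      unfolding char_def by (subst integral_distr) (auto intro: measurable_annealed_measure)
    also have "\<dots> = (\<integral>\<sigma>. exp (- (\<i> * of_real s * of_real (\<integral>\<sigma>. fluctuation n \<sigma> \<partial>\<mu> n))) * exp (\<i> * of_real s * of_real (fluctuation n \<sigma>)) \<partial>\<mu> n)"
      unfolding X exp_add[symmetric] by (simp add: algebra_simps)
    also have "\<dots> = exp (- (\<i> * of_real s * of_real (\<integral>\<sigma>. fluctuation n \<sigma> \<partial>\<mu> n))) * (\<integral>\<sigma>. exp (\<i> * of_real s * of_real (fluctuation n \<sigma>)) \<partial>\<mu> n)"
      by (rule integral_mult_right_zero)
    finally show ?case ..
  qed
  ultimately show "(\<lambda>n. char (distr (\<mu> n) borel (?X n)) s) \<longlonglongrightarrow> char (centered_gaussian chi) s"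
    by (rule Lim_transform_eventually)
qed

end

section \<open>The pressure and the critical temperature\<close>

lemma tendsto_ln_over_n:
  fixes x :: "nat \<Rightarrow> real"
  assumes "x \<longlonglongrightarrow> c" "c > 0" shows "(\<lambda>n. ln (x n) / real n) \<longlonglongrightarrow> 0"
  by (rule real_tendsto_divide_at_top[OF tendsto_ln[OF assms(1)] filterlim_real_sequentially]) (use assms in simp)

lemma vertex_degree_last: "vertex_degree d n n = d \<or> vertex_degree d n n = d + 1"
  by (simp add: vertex_degree_def)

context optimum
begin

text \<open>
  The scale of the integral grows like the \<open>n\<close>-th power of the maximum; the remaining factors are
  subexponential.
\<close>

lemma log_transform_limit:
  "(\<lambda>n. ln (norm (centered_transform n 0)) / real n) \<longlonglongrightarrow> ln (opt_weight r d d w)"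
proof -
  let ?A = "opt_weight r d d w" and ?A' = "opt_weight r d (d + 1) w"
  define x where "x = (\<lambda>n. norm (of_real (sqrt (real n)) * centered_transform n 0 / of_real (laplace_scale n)))"
  define \<kappa> where "\<kappa> = sqrt (2 * pi / (real d * slope))"
  have \<kappa>: "\<kappa> > 0" using slope_pos d_ge by (simp add: \<kappa>_def)
  have "x \<longlonglongrightarrow> norm (complex_of_real \<kappa>)"
    unfolding x_def using tendsto_norm[OF laplace_limit[of 0]] by (simp add: \<kappa>_def norm_mult)
  then have x: "x \<longlonglongrightarrow> \<kappa>" using \<kappa> by simp
  have xpos: "\<forall>\<^sub>F n in sequentially. x n > 0" using order_tendstoD(1)[OF x \<kappa>] .
  define D where "D = (\<lambda>n. ln (opt_weight r d (vertex_degree d n n) w))"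
  have D: "(\<lambda>n. D n / real n) \<longlonglongrightarrow> 0"
  proof (rule Lim_null_comparison)
    show "\<forall>\<^sub>F n in sequentially. norm (D n / real n) \<le> (\<bar>ln ?A\<bar> + \<bar>ln ?A'\<bar>) / real n"
    proof (rule always_eventually, intro allI)
      fix n
      have "\<bar>D n\<bar> \<le> \<bar>ln ?A\<bar> + \<bar>ln ?A'\<bar>" using vertex_degree_last[of d n] by (auto simp: D_def)
      then show "norm (D n / real n) \<le> (\<bar>ln ?A\<bar> + \<bar>ln ?A'\<bar>) / real n" by (simp add: divide_right_mono)
    qed
    show "(\<lambda>n. (\<bar>ln ?A\<bar> + \<bar>ln ?A'\<bar>) / real n) \<longlonglongrightarrow> 0"
      by (intro real_tendsto_divide_at_top[OF tendsto_const] filterlim_real_sequentially)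
  qed
  have lnn: "(\<lambda>n. ln (real n) / real n) \<longlonglongrightarrow> 0" by real_asymp
  have frac: "(\<lambda>n. real (n - 1) / real n) \<longlonglongrightarrow> 1" by real_asymp
  have "(\<lambda>n. ln (x n) / real n + real (n - 1) / real n * ln ?A + D n / real n - ln (real n) / real n / 2)
     \<longlonglongrightarrow> 0 + 1 * ln ?A + 0 - 0 / 2"
    by (intro tendsto_intros tendsto_ln_over_n[OF x \<kappa>] frac D lnn) auto
  moreover have "\<forall>\<^sub>F n in sequentially. ln (x n) / real n + real (n - 1) / real n * ln ?A + D n / real n - ln (real n) / real n / 2
     = ln (norm (centered_transform n 0)) / real n"
    using xpos eventually_ge_at_top[of 1]
  proof eventually_elim
    case (elim n)
    have n: "sqrt (real n) > 0" using elim by simp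
    have s: "laplace_scale n > 0" by (rule laplace_scale_pos)
    have xe: "x n = sqrt (real n) * norm (centered_transform n 0) / laplace_scale n"
      using s by (simp add: x_def norm_mult norm_divide)
    then have c: "norm (centered_transform n 0) > 0" using elim(1) n s
      by (cases "centered_transform n 0 = 0") auto
    have "ln (x n) = ln (real n) / 2 + ln (norm (centered_transform n 0)) - ln (laplace_scale n)"
      unfolding xe using n s c elim by (simp add: ln_div ln_mult ln_sqrt)
    moreover have "ln (laplace_scale n) = real (n - 1) * ln ?A + D n"
      using opt_weight_pos[of d] opt_weight_pos[of "vertex_degree d n n"]
      by (simp add: laplace_scale_def D_def ln_mult ln_realpow)
    ultimately have "ln (norm (centered_transform n 0)) = ln (x n) + real (n - 1) * ln ?A + D n - ln (real n) / 2"
      by simp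
    then show ?case by (simp add: add_divide_distrib diff_divide_distrib)
  qed
  ultimately show ?thesis by (auto intro: Lim_transform_eventually)
qed

lemma ln_opt_weight:
  "ln (opt_weight r d d w) = b + real d * (ln (1 + \<tau> * t) - ln (1 + \<tau> * t\<^sup>2) / 2) - ln ((1 + m) / 2)"
proof -
  have m: "1 + m > 0" using abs_mag_less by linarith
  have c: "ln (cos \<theta>\<^sub>0) = - (ln (1 + \<tau> * t\<^sup>2) / 2)"
  proof -
    have "cos \<theta>\<^sub>0 = 1 / sqrt (1 + \<tau> * t\<^sup>2)"
      by (simp add: opt_angle_def cos_arctan power_mult_distrib)
    then show ?thesis using bounds(3) by (simp add: ln_div ln_sqrt)
  qed
  have "ln (exp b * (cos \<theta>\<^sub>0 + r * sin \<theta>\<^sub>0) ^ d) = b + real d * (ln (cos \<theta>\<^sub>0) + ln (1 + \<tau> * t))"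
    unfolding half_edge_opt using cos_opt bounds by (simp add: ln_mult ln_realpow)
  moreover have "ln (exp b * (cos \<theta>\<^sub>0 + r * sin \<theta>\<^sub>0) ^ d) = ln (opt_weight r d d w) + ln ((1 + m) / 2)"
    unfolding opt_split by (rule ln_mult_pos[OF opt_weight_pos]) (use m in simp)
  ultimately show ?thesis unfolding c by (simp add: algebra_simps)
qed

end

text \<open>
  Laplace's method for the model with \<open>\<beta> = 0\<close> and zero field, whose transform is
  \<open>2 ^ n * cos_integral d n\<close>.
\<close>

lemma cos_integral_growth:
  assumes "d \<ge> 2" shows "(\<lambda>n. ln (cos_integral d n) / real n) \<longlonglongrightarrow> 0"
proof -
  interpret o: optimum 0 d 0 using assms by unfold_locales (auto simp: regular_param_def)
  have A: "opt_weight 0 d d 0 = 2" by (simp add: opt_weight_def envelope_def opt_angle_def)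
  have "norm (o.centered_transform n 0) = 2 ^ n * cos_integral d n" if n: "n \<ge> 1" for n
  proof -
    have w: "centered_weight 0 D (field_of (0\<^sup>2) d 0) (mag_of (0\<^sup>2) 0) 0 \<theta> = of_real (2 * cos \<theta> ^ D)" for D \<theta>
      by (simp add: centered_weight_def vertex_weight_def)
    have "(n - 1) * d + vertex_degree d n n = card (half_edges d n)"
      using n by (cases n) (auto simp: card_half_edges vertex_degree_def)
    then have "(2 * cos \<theta> ^ d) ^ (n - 1) * (2 * cos \<theta> ^ vertex_degree d n n) = 2 ^ n * cos \<theta> ^ card (half_edges d n)" for \<theta> :: real
      using n by (cases n) (auto simp: power_mult_distrib power_mult[symmetric] power_add[symmetric] mult_ac)
    then have "o.centered_transform n 0 = half_circle (\<lambda>\<theta>. complex_of_real (2 ^ n * cos \<theta> ^ card (half_edges d n)))"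
      unfolding o.centered_transform_def w of_real_power[symmetric] of_real_mult[symmetric] by simp
    also have "\<dots> = of_real (2 ^ n * cos_integral d n)"
      unfolding half_circle_of_real half_circle_mult_right cos_integral_def ..
    finally show ?thesis using cos_integral_pos[of d n] by (simp add: norm_mult norm_power)
  qed
  then have eq: "ln (norm (o.centered_transform n 0)) / real n - ln 2 = ln (cos_integral d n) / real n" if "n \<ge> 1" for n
    using that cos_integral_pos[of d n] by (simp add: ln_mult ln_realpow add_divide_distrib)
  have "(\<lambda>n. ln (norm (o.centered_transform n 0)) / real n - ln 2) \<longlonglongrightarrow> ln 2 - ln 2"
    using o.log_transform_limit unfolding A by (intro tendsto_intros)
  moreover have "\<forall>\<^sub>F n in sequentially. ln (norm (o.centered_transform n 0)) / real n - ln 2 = ln (cos_integral d n) / real n"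
    using eventually_ge_at_top[of 1] by eventually_elim (rule eq)
  ultimately show ?thesis by (auto intro: Lim_transform_eventually)
qed

lemma num_edges_growth: "(\<lambda>n. real (num_edges d n) / real n) \<longlonglongrightarrow> real d / 2"
proof -
  have lim: "(\<lambda>n. real d / 2 + 1 / real n) \<longlonglongrightarrow> real d / 2 + 0"
    by (intro tendsto_intros lim_1_over_n)
  have b: "real d / 2 \<le> real (num_edges d n) / real n \<and> real (num_edges d n) / real n \<le> real d / 2 + 1 / real n" if "n \<ge> 1" for n
  proof -
    have "2 * num_edges d n = d * n + (if odd (d * n) then 1 else 0)"
      using card_half_edges_eq[of d n] card_half_edges[of d n] by simp
    then have "d * n \<le> 2 * num_edges d n" "2 * num_edges d n \<le> d * n + 1" by auto
    then have "real (d * n) \<le> real (2 * num_edges d n)" "real (2 * num_edges d n) \<le> real (d * n + 1)"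
      by (simp_all only: of_nat_le_iff)
    then have "real d * real n \<le> 2 * real (num_edges d n)" "2 * real (num_edges d n) \<le> real d * real n + 1"
      by simp_all
    then show ?thesis using that by (simp add: field_simps)
  qed
  show ?thesis
  proof (rule tendsto_sandwich[OF _ _ tendsto_const])
    show "\<forall>\<^sub>F n in sequentially. real d / 2 \<le> real (num_edges d n) / real n"
      using eventually_ge_at_top[of 1] by eventually_elim (rule b[THEN conjunct1])
    show "\<forall>\<^sub>F n in sequentially. real (num_edges d n) / real n \<le> real d / 2 + 1 / real n"
      using eventually_ge_at_top[of 1] by eventually_elim (rule b[THEN conjunct2])
    show "(\<lambda>n. real d / 2 + 1 / real n) \<longlonglongrightarrow> real d / 2" using lim by simp
  qed
qed

text \<open>
  The logarithm of the maximum of the envelope as an explicit function of the parameter.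
\<close>

definition log_opt_weight :: "real \<Rightarrow> nat \<Rightarrow> real \<Rightarrow> real" where
  "log_opt_weight \<tau> d w = field_of \<tau> d w
     + real d * (ln (1 + \<tau> * tanh w) - ln (1 + \<tau> * (tanh w)\<^sup>2) / 2) - ln ((1 + mag_of \<tau> w) / 2)"

text \<open>
  The edges contribute \<open>cosh \<beta>\<close> each, and the number of matchings that normalises the expectation
  cancels up to the subexponential factor \<open>cos_integral\<close>.
\<close>

lemma (in annealed_optimum) pressure_eq:
  "pressure d \<beta> B = real d / 2 * ln (cosh \<beta>) + log_opt_weight (tanh \<beta>) d w"
proof -
  let ?r = "sqrt (tanh \<beta>)"
  let ?Z = "\<lambda>n. measure_pmf.expectation (config_model d n) (partition_function \<beta> B n)"
  have L: "ln (opt_weight ?r d d w) = log_opt_weight (tanh \<beta>) d w"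
    using ln_opt_weight unfolding log_opt_weight_def tanh_\<beta>(3) .
  have "(\<lambda>n. real (num_edges d n) / real n * ln (cosh \<beta>) - ln (cos_integral d n) / real n
      + ln (norm (centered_transform n 0)) / real n) \<longlonglongrightarrow> real d / 2 * ln (cosh \<beta>) - 0 + ln (opt_weight ?r d d w)"
    by (intro tendsto_intros num_edges_growth cos_integral_growth d_ge_2 log_transform_limit)
  moreover have "\<forall>\<^sub>F n in sequentially. real (num_edges d n) / real n * ln (cosh \<beta>) - ln (cos_integral d n) / real n
      + ln (norm (centered_transform n 0)) / real n = ln (?Z n) / real n"
    using eventually_ge_at_top[of 1]
  proof eventually_elim
    case (elim n)
    have c: "cosh \<beta> ^ num_edges d n / cos_integral d n > 0"
      using cos_integral_pos by (simp add: cosh_real_pos)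
    have Z: "?Z n > 0" by (rule expectation_partition_function_pos)
    have "complex_of_real (?Z n) = of_real (cosh \<beta> ^ num_edges d n / cos_integral d n) * centered_transform n 0"
      using partition_function_transform[OF elim \<beta>_nonneg, of d B] centered_transform_eq[OF elim, of 0] by simp
    then have "norm (complex_of_real (?Z n)) = norm (of_real (cosh \<beta> ^ num_edges d n / cos_integral d n) * centered_transform n 0)"
      by simp
    then have eq: "?Z n = cosh \<beta> ^ num_edges d n / cos_integral d n * norm (centered_transform n 0)"
      using Z c by (simp only: norm_mult norm_of_real abs_of_pos)
    have "norm (centered_transform n 0) > 0" by (rule zero_less_mult_pos[OF Z[unfolded eq] c])
    then have "ln (?Z n) = real (num_edges d n) * ln (cosh \<beta>) - ln (cos_integral d n) + ln (norm (centered_transform n 0))"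
      unfolding eq using c cos_integral_pos[of d n] cosh_real_pos[of \<beta>] by (simp add: ln_mult ln_div ln_realpow)
    then show ?case by (simp add: add_divide_distrib diff_divide_distrib)
  qed
  ultimately have "(\<lambda>n. ln (?Z n) / real n) \<longlonglongrightarrow> real d / 2 * ln (cosh \<beta>) + ln (opt_weight ?r d d w)"
    by (auto intro: Lim_transform_eventually)
  then show ?thesis unfolding pressure_def L by (rule limI)
qed

text \<open>
  The envelope theorem: along the maximisers the logarithm of the maximum changes with the field at
  rate \<open>mag_of\<close>. It is verified here by direct computation.
\<close>

lemma log_opt_weight_has_derivative:
  assumes \<tau>: "0 \<le> \<tau>" "\<tau> < 1"
  shows "(log_opt_weight \<tau> d has_real_derivative mag_of \<tau> w * field_slope \<tau> d w) (at w)"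
proof -
  let ?t = "tanh w"
  define T where "T = 1 - ?t\<^sup>2"
  note bd = tau_tanh_bounds[OF \<tau>, of w]
  have tb: "1 + ?t > 0" "1 - ?t > 0" using tanh_real_lt_1[of w] tanh_real_gt_neg1[of w] by auto
  have m: "1 + mag_of \<tau> w = (1 + ?t) * (1 + \<tau> * ?t) / (1 + \<tau> * ?t\<^sup>2)" "1 - mag_of \<tau> w = (1 - ?t) * (1 - \<tau> * ?t) / (1 + \<tau> * ?t\<^sup>2)"
    using bd(3) by (simp_all add: mag_of_def field_simps power2_eq_square)
  have mp: "1 + mag_of \<tau> w > 0" unfolding m using bd tb by simp
  have dt: "(tanh has_real_derivative T) (at w)"
    unfolding T_def by (auto intro!: derivative_eq_intros)
  have "((\<lambda>w. 1 + \<tau> * tanh w) has_real_derivative \<tau> * T) (at w)"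
    using DERIV_add[OF DERIV_const[of 1] DERIV_cmult[OF dt, of \<tau>]] by simp
  from DERIV_chain2[OF DERIV_ln_divide[OF bd(4)] this]
  have d1: "((\<lambda>w. ln (1 + \<tau> * tanh w)) has_real_derivative \<tau> * T / (1 + \<tau> * ?t)) (at w)" by simp
  have "((\<lambda>w. 1 + \<tau> * (tanh w)\<^sup>2) has_real_derivative \<tau> * (2 * ?t * T)) (at w)"
    using DERIV_add[OF DERIV_const[of 1] DERIV_cmult[OF DERIV_power[OF dt, of 2], of \<tau>]] by (simp add: mult_ac)
  from DERIV_chain2[OF DERIV_ln_divide[OF bd(3)] this]
  have d2: "((\<lambda>w. ln (1 + \<tau> * (tanh w)\<^sup>2)) has_real_derivative \<tau> * (2 * ?t * T) / (1 + \<tau> * ?t\<^sup>2)) (at w)" by simp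
  have half: "(1 + mag_of \<tau> w) / 2 > 0" using mp by simp
  have "((\<lambda>w. (1 + mag_of \<tau> w) / 2) has_real_derivative mag_slope \<tau> w / 2) (at w)"
    using DERIV_cdivide[OF DERIV_add[OF DERIV_const[of 1] mag_of_has_derivative[OF \<tau>, of w]], of 2] by simp
  note DERIV_chain2[OF DERIV_ln_divide[OF half] this]
  moreover have "1 / (y / 2) * (x / 2) = x / y" for x y :: real by simp
  ultimately have d3: "((\<lambda>w. ln ((1 + mag_of \<tau> w) / 2)) has_real_derivative mag_slope \<tau> w / (1 + mag_of \<tau> w)) (at w)"
    by (simp only:)
  have D: "(log_opt_weight \<tau> d has_real_derivative
     field_slope \<tau> d w + real d * (\<tau> * T / (1 + \<tau> * ?t) - \<tau> * (2 * ?t * T) / (1 + \<tau> * ?t\<^sup>2) / 2)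
       - mag_slope \<tau> w / (1 + mag_of \<tau> w)) (at w)"
    unfolding log_opt_weight_def[abs_def]
    by (rule DERIV_diff[OF DERIV_add[OF field_of_has_derivative[OF \<tau>] DERIV_cmult[OF DERIV_diff[OF d1 DERIV_cdivide[OF d2]]]] d3])
  have "field_slope \<tau> d w + real d * (\<tau> * T / (1 + \<tau> * ?t) - \<tau> * (2 * ?t * T) / (1 + \<tau> * ?t\<^sup>2) / 2)
       - mag_slope \<tau> w / (1 + mag_of \<tau> w) = mag_of \<tau> w * field_slope \<tau> d w"
  proof -
    define S P Q where "S = 1 + \<tau> * ?t\<^sup>2" and "P = 1 + \<tau> * ?t" and "Q = 1 - \<tau> * ?t"
    have pos: "S > 0" "P > 0" "Q > 0" using bd by (simp_all add: S_def P_def Q_def)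
    have E: "1 - \<tau>\<^sup>2 * ?t\<^sup>2 = P * Q" unfolding P_def Q_def by algebra
    have 1: "\<tau> * T / P - \<tau> * (2 * ?t * T) / S / 2 = \<tau> * T * (1 - ?t) / (S * P)"
    proof -
      have "\<tau> * T / P - \<tau> * (2 * ?t * T) / S / 2 = \<tau> * T * (S - ?t * P) / (S * P)"
        using pos by (simp add: field_simps)
      also have "S - ?t * P = 1 - ?t" unfolding S_def P_def by algebra
      finally show ?thesis .
    qed
    have 2: "mag_slope \<tau> w / (1 + mag_of \<tau> w) = (1 + \<tau>) * (1 - \<tau> * ?t\<^sup>2) * (1 - ?t) / (S * P)"
    proof -
      have "(1 + \<tau>) * (1 - \<tau> * ?t\<^sup>2) * (1 - ?t\<^sup>2) = (1 + \<tau>) * (1 - \<tau> * ?t\<^sup>2) * (1 - ?t) * (1 + ?t)" by algebra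
      moreover have "N * (1 + ?t) / S\<^sup>2 / ((1 + ?t) * P / S) = N / (S * P)" for N
        using pos tb by (simp add: power2_eq_square)
      ultimately show ?thesis
        unfolding mag_slope_def m S_def[symmetric] P_def[symmetric] by (simp only:)
    qed
    have 3: "(1 - mag_of \<tau> w) * field_slope \<tau> d w = (1 - ?t) * (P * Q - (real d - 1) * \<tau> * T) / (S * P)"
    proof -
      have "field_slope \<tau> d w = (P * Q - (real d - 1) * \<tau> * T) / (P * Q)"
        unfolding field_slope_def E T_def[symmetric] using pos by (simp add: diff_divide_distrib)
      then show ?thesis unfolding m S_def[symmetric] Q_def[symmetric] using pos by simp
    qed
    have "(1 - mag_of \<tau> w) * field_slope \<tau> d w + real d * (\<tau> * T * (1 - ?t) / (S * P))
       - (1 + \<tau>) * (1 - \<tau> * ?t\<^sup>2) * (1 - ?t) / (S * P)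
      = ((1 - ?t) * (P * Q - (real d - 1) * \<tau> * T) + real d * (\<tau> * T * (1 - ?t)) - (1 + \<tau>) * (1 - \<tau> * ?t\<^sup>2) * (1 - ?t)) / (S * P)"
      unfolding 3 by (simp add: add_divide_distrib diff_divide_distrib)
    also have "(1 - ?t) * (P * Q - (real d - 1) * \<tau> * T) + real d * (\<tau> * T * (1 - ?t)) - (1 + \<tau>) * (1 - \<tau> * ?t\<^sup>2) * (1 - ?t) = 0"
      unfolding P_def Q_def T_def by algebra
    finally have "(1 - mag_of \<tau> w) * field_slope \<tau> d w + real d * (\<tau> * T * (1 - ?t) / (S * P))
       - (1 + \<tau>) * (1 - \<tau> * ?t\<^sup>2) * (1 - ?t) / (S * P) = 0" by simp
    then show ?thesis
      unfolding 2 S_def[symmetric] P_def[symmetric] 1 by (simp add: left_diff_distrib)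
  qed
  with D show ?thesis by simp
qed

definition param_of :: "real \<Rightarrow> nat \<Rightarrow> real \<Rightarrow> real" where
  "param_of \<tau> d b = (SOME w. regular_param \<tau> d w \<and> field_of \<tau> d w = b)"

lemma param_of:
  assumes "0 \<le> \<tau>" "\<tau> < 1" "d \<ge> 1" "b \<noteq> 0 \<or> (real d - 1) * \<tau> < 1"
  shows "regular_param \<tau> d (param_of \<tau> d b)" "field_of \<tau> d (param_of \<tau> d b) = b"
  using someI_ex[OF field_of_surj[OF assms]] by (simp_all add: param_of_def)

text \<open>
  The inverse function theorem on the open set of regular parameters, where the field is
  injective.
\<close>

lemma param_of_has_derivative:
  assumes \<tau>: "0 \<le> \<tau>" "\<tau> < 1" and d: "d \<ge> 1" and b: "b \<noteq> 0 \<or> (real d - 1) * \<tau> < 1"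
  shows "(param_of \<tau> d has_real_derivative 1 / field_slope \<tau> d (param_of \<tau> d b)) (at b)"
proof -
  let ?w = "param_of \<tau> d b"
  let ?g = "field_slope \<tau> d ?w"
  have reg: "regular_param \<tau> d ?w" and fw: "field_of \<tau> d ?w = b" using param_of[OF \<tau> d b] by auto
  have pos: "?g > 0" by (rule field_slope_pos[OF \<tau> d reg])
  have left: "param_of \<tau> d (field_of \<tau> d w) = w" if "regular_param \<tau> d w" for w
  proof (rule field_of_inj[OF \<tau> d])
    have "\<exists>v. regular_param \<tau> d v \<and> field_of \<tau> d v = field_of \<tau> d w" using that by blast
    from someI_ex[OF this] show "regular_param \<tau> d (param_of \<tau> d (field_of \<tau> d w))"
      "field_of \<tau> d (param_of \<tau> d (field_of \<tau> d w)) = field_of \<tau> d w"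
      by (simp_all add: param_of_def)
  qed (rule that)
  have "(param_of \<tau> d has_derivative (\<lambda>x. x * (1 / ?g))) (at (field_of \<tau> d ?w))"
  proof (rule has_derivative_inverse_strong[where f = "field_of \<tau> d" and x = ?w and f' = "\<lambda>x. x * ?g"
        and S = "{w. regular_param \<tau> d w}"])
    show "open {w. regular_param \<tau> d w}" by (rule open_regular_param[OF \<tau>])
    show "?w \<in> {w. regular_param \<tau> d w}" using reg by simp
    show "continuous_on {w. regular_param \<tau> d w} (field_of \<tau> d)" by (rule continuous_on_field_of[OF \<tau>])
    show "(field_of \<tau> d has_derivative (\<lambda>x. x * ?g)) (at ?w)"
      using field_of_has_derivative[OF \<tau>, of d ?w] by (simp add: has_field_derivative_def mult_commute_abs)
    show "(\<lambda>x. x * ?g) \<circ> (\<lambda>x. x * (1 / ?g)) = id" using pos by (auto simp: fun_eq_iff)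
  qed (use left in auto)
  moreover have "(\<lambda>x. x * (1 / ?g)) = (*) (1 / ?g)" by (simp add: fun_eq_iff)
  ultimately show ?thesis unfolding fw has_field_derivative_def by (simp only:)
qed

text \<open>
  The first derivative of the pressure is the magnetization, which is then differentiated through
  the inverse of the field.
\<close>

lemma pressure_second_derivative:
  assumes \<beta>: "\<beta> \<ge> 0" and d: "d \<ge> 2" and B: "B \<noteq> 0 \<or> (real d - 1) * tanh \<beta> < 1"
  shows "has_second_derivative (pressure d \<beta>)
    (mag_slope (tanh \<beta>) (param_of (tanh \<beta>) d B) / field_slope (tanh \<beta>) d (param_of (tanh \<beta>) d B)) B"
proof -
  let ?\<tau> = "tanh \<beta>"
  let ?w = "param_of ?\<tau> d"
  have \<tau>: "0 \<le> ?\<tau>" "?\<tau> < 1" and d1: "d \<ge> 1" using \<beta> d by (auto simp: tanh_real_lt_1)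
  define U where "U = {b::real. b \<noteq> 0 \<or> (real d - 1) * ?\<tau> < 1}"
  have U: "open U" unfolding U_def by (cases "(real d - 1) * ?\<tau> < 1") (auto intro: open_Collect_neq continuous_intros)
  have BU: "B \<in> U" using B by (simp add: U_def)
  have p: "pressure d \<beta> b = real d / 2 * ln (cosh \<beta>) + log_opt_weight ?\<tau> d (?w b)" if "b \<in> U" for b
  proof -
    have w: "regular_param ?\<tau> d (?w b)" "field_of ?\<tau> d (?w b) = b"
      using param_of[OF \<tau> d1, of b] that by (auto simp: U_def)
    interpret annealed_optimum \<beta> d "?w b" by unfold_locales (use \<beta> d w in auto)
    show ?thesis using pressure_eq unfolding w(2) .
  qed
  have dw: "(?w has_real_derivative 1 / field_slope ?\<tau> d (?w b)) (at b)" if "b \<in> U" for b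
    using param_of_has_derivative[OF \<tau> d1] that by (simp add: U_def)
  have sp: "field_slope ?\<tau> d (?w b) > 0" if "b \<in> U" for b
    using field_slope_pos[OF \<tau> d1] param_of[OF \<tau> d1, of b] that by (simp add: U_def)
  have first: "(pressure d \<beta> has_real_derivative mag_of ?\<tau> (?w b)) (at b)" if b: "b \<in> U" for b
  proof (rule has_field_derivative_transform_within_open[OF _ U b])
    have "((\<lambda>b. log_opt_weight ?\<tau> d (?w b)) has_real_derivative
        mag_of ?\<tau> (?w b) * field_slope ?\<tau> d (?w b) * (1 / field_slope ?\<tau> d (?w b))) (at b)"
      by (rule DERIV_chain2[OF log_opt_weight_has_derivative[OF \<tau>] dw[OF b]])
    then have "((\<lambda>b. log_opt_weight ?\<tau> d (?w b)) has_real_derivative mag_of ?\<tau> (?w b)) (at b)"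
      using sp[OF b] by simp
    from DERIV_add[OF DERIV_const this]
    show "((\<lambda>b. real d / 2 * ln (cosh \<beta>) + log_opt_weight ?\<tau> d (?w b)) has_real_derivative mag_of ?\<tau> (?w b)) (at b)"
      by simp
  qed (use p in simp)
  have "(deriv (pressure d \<beta>) has_real_derivative mag_slope ?\<tau> (?w B) * (1 / field_slope ?\<tau> d (?w B))) (at B)"
  proof (rule has_field_derivative_transform_within_open[OF _ U BU])
    show "((\<lambda>b. mag_of ?\<tau> (?w b)) has_real_derivative mag_slope ?\<tau> (?w B) * (1 / field_slope ?\<tau> d (?w B))) (at B)"
      by (rule DERIV_chain2[OF mag_of_has_derivative[OF \<tau>] dw[OF BU]])
    show "mag_of ?\<tau> (?w b) = deriv (pressure d \<beta>) b" if "b \<in> U" for b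
      using DERIV_imp_deriv[OF first[OF that]] by simp
  qed
  moreover have "\<forall>\<^sub>F y in nhds B. pressure d \<beta> differentiable (at y)"
    using eventually_nhds_in_open[OF U BU]
    by eventually_elim (use first in \<open>auto simp: real_differentiable_def\<close>)
  ultimately show ?thesis by (simp add: has_second_derivative_def)
qed

lemma monotone_limit_at_right:
  fixes f :: "real \<Rightarrow> real"
  assumes "\<And>x y. 0 < x \<Longrightarrow> x < y \<Longrightarrow> f x \<le> f y" "\<And>x. 0 < x \<Longrightarrow> c \<le> f x"
  shows "\<exists>L\<ge>c. (f \<longlongrightarrow> L) (at_right 0)"
proof -
  define L where "L = Inf (f ` {0<..})"
  have bdd: "bdd_below (f ` {0<..})" using assms(2) by (auto intro!: bdd_belowI[of _ c])
  have "L \<ge> c" unfolding L_def using assms(2) by (intro cInf_greatest) auto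
  moreover have "(f \<longlongrightarrow> L) (at_right 0)"
  proof (rule order_tendstoI)
    fix y assume "y < L"
    moreover have "L \<le> f x" if "x > 0" for x
      unfolding L_def using bdd that by (intro cInf_lower) auto
    ultimately show "\<forall>\<^sub>F x in at_right 0. y < f x"
      by (intro eventually_mono[OF eventually_at_right_less[of 0]]) (rule less_le_trans)
  next
    fix y assume "L < y"
    then obtain x where x: "x > 0" "f x < y"
      using cInf_lessD[of "f ` {0<..}" y] by (auto simp: L_def)
    have "\<forall>\<^sub>F z in at_right 0. z \<in> {0<..<x}" using x(1) by (rule eventually_at_right_real)
    then show "\<forall>\<^sub>F z in at_right 0. f z < y"
      by eventually_elim (use assms(1)[of _ x] x(2) in \<open>auto intro: le_less_trans\<close>)
  qed
  ultimately show ?thesis by blast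
qed

text \<open>
  The magnetization is monotone in the field and bounded below by its value at a positive
  parameter below which the field is negative.
\<close>

lemma spontaneous_magnetization:
  assumes d: "d \<ge> 2" and \<beta>: "\<beta> > 0" and k: "(real d - 1) * tanh \<beta> > 1"
  shows "(\<forall>\<^sub>F B in at_right 0. convergent (mean_spin d \<beta> B)) \<and> (\<exists>m>0. (magnetization d \<beta> \<longlongrightarrow> m) (at_right 0))"
proof -
  let ?\<tau> = "tanh \<beta>"
  let ?w = "param_of ?\<tau> d"
  have \<tau>: "0 \<le> ?\<tau>" "?\<tau> < 1" and d1: "d \<ge> 1" using \<beta> d by (auto simp: tanh_real_lt_1)
  have w: "?w b > 0" "field_of ?\<tau> d (?w b) = b" "regular_param ?\<tau> d (?w b)" if "b > 0" for b
    using param_of[OF \<tau> d1, of b] that k by (auto simp: regular_param_def)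
  have lim: "mean_spin d \<beta> b \<longlonglongrightarrow> mag_of ?\<tau> (?w b)" if "b > 0" for b
  proof -
    interpret annealed_optimum \<beta> d "?w b" by unfold_locales (use \<beta> d w[OF that] in auto)
    show ?thesis using mean_spin_limit unfolding w(2)[OF that] .
  qed
  \<comment> \<open>near zero the field is negative, so the parameter of a positive field stays away from zero\<close>
  have "field_slope ?\<tau> d 0 < 0" using k by (simp add: field_slope_def)
  then obtain \<delta> where \<delta>: "\<delta> > 0" "\<And>h. 0 < h \<Longrightarrow> h < \<delta> \<Longrightarrow> field_of ?\<tau> d h < 0"
    using DERIV_neg_dec_right[OF field_of_has_derivative[OF \<tau>, of d 0]] by auto
  have wd: "\<delta> \<le> ?w b" if "b > 0" for b
    using \<delta>(2)[of "?w b"] w[OF that] that by force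
  have mono: "?w x < ?w y" if "0 < x" "x < y" for x y
  proof (rule ccontr)
    assume "\<not> ?w x < ?w y"
    moreover have "?w x \<noteq> ?w y" using w(2)[of x] w(2)[of y] that by force
    ultimately have "?w y < ?w x" by simp
    then have "field_of ?\<tau> d (?w y) < field_of ?\<tau> d (?w x)"
      using field_of_strict_mono_aux[OF \<tau> d1, of "?w y" "?w x"] w[of y] that by simp
    then show False using w(2)[of x] w(2)[of y] that by simp
  qed
  have mag_mono: "mag_of ?\<tau> x \<le> mag_of ?\<tau> y" if "x \<le> y" for x y
    by (rule DERIV_nonneg_imp_nondecreasing[OF that])
       (use mag_of_has_derivative[OF \<tau>] mag_slope_pos[OF \<tau>] in \<open>blast intro: less_imp_le\<close>)
  have magn: "magnetization d \<beta> b = mag_of ?\<tau> (?w b)" if "b > 0" for b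
    unfolding magnetization_def using lim[OF that] by (rule limI)
  have "\<exists>L\<ge>mag_of ?\<tau> \<delta>. (magnetization d \<beta> \<longlongrightarrow> L) (at_right 0)"
  proof (rule monotone_limit_at_right)
    show "magnetization d \<beta> x \<le> magnetization d \<beta> y" if "0 < x" "x < y" for x y
      using mag_mono[OF less_imp_le[OF mono[OF that]]] magn that by simp
    show "mag_of ?\<tau> \<delta> \<le> magnetization d \<beta> x" if "0 < x" for x
      using mag_mono[OF wd[OF that]] magn[OF that] by simp
  qed
  moreover have "mag_of ?\<tau> \<delta> > 0"
    unfolding mag_of_def using \<delta>(1) tau_tanh_bounds(3)[OF \<tau>, of \<delta>] add_pos_nonneg[OF zero_less_one \<tau>(1)]
    by (intro divide_pos_pos mult_pos_pos) auto
  moreover have "\<forall>\<^sub>F B in at_right 0. convergent (mean_spin d \<beta> B)"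
    using eventually_at_right_less[of 0] by eventually_elim (use lim in \<open>auto simp: convergent_def\<close>)
  ultimately show ?thesis by (meson less_le_trans)
qed

text \<open>
  If \<open>(d - 1) * tanh \<beta> \<ge> 1\<close>, every larger inverse temperature shows spontaneous magnetization, so
  the infimum that defines the critical one is at most \<open>\<beta>\<close>.
\<close>

lemma subcritical_beta:
  assumes d: "d \<ge> 2" and \<beta>: "\<beta> > 0" and c: "ereal \<beta> < critical_beta d"
  shows "(real d - 1) * tanh \<beta> < 1"
proof (rule ccontr)
  assume "\<not> ?thesis"
  then have k: "(real d - 1) * tanh \<beta> \<ge> 1" by simp
  obtain \<gamma> where \<gamma>: "ereal \<beta> < ereal \<gamma>" "ereal \<gamma> < critical_beta d" using ereal_dense2[OF c] by blast
  then have "\<beta> < \<gamma>" by simp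
  then have "(real d - 1) * tanh \<beta> < (real d - 1) * tanh \<gamma>" using d by (intro mult_strict_left_mono) auto
  with k have "(real d - 1) * tanh \<gamma> > 1" by simp
  then have "critical_beta d \<le> ereal \<gamma>"
    unfolding critical_beta_def using spontaneous_magnetization[OF d, of \<gamma>] \<beta> \<open>\<beta> < \<gamma>\<close>
    by (intro Inf_lower imageI) auto
  then show False using \<gamma>(2) by simp
qed

theorem theorem1p3:
  fixes d :: nat and \<beta> B :: real
  assumes "d \<ge> 2" and "(\<beta>, B) \<in> uniqueness_region d"
  shows "\<exists>chi::real.
    (\<lambda>n. prob_space.variance (annealed_measure d \<beta> B n) (\<lambda>\<sigma>. total_spin n \<sigma> / sqrt (real n)))
      \<longlonglongrightarrow> chi \<and>
    has_second_derivative (\<lambda>b. pressure d \<beta> b) chi B \<and>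
    weak_conv_m
      (\<lambda>n. distr (annealed_measure d \<beta> B n) borel
        (\<lambda>\<sigma>. (total_spin n \<sigma> - prob_space.expectation (annealed_measure d \<beta> B n) (total_spin n))
              / sqrt (real n)))
      (centered_gaussian chi)"
proof -
  have \<beta>: "\<beta> \<ge> 0" and B: "B \<noteq> 0 \<or> (real d - 1) * tanh \<beta> < 1"
    using assms subcritical_beta[OF assms(1), of \<beta>] by (auto simp: uniqueness_region_def)
  define w where "w = param_of (tanh \<beta>) d B"
  have w: "regular_param (tanh \<beta>) d w" "field_of (tanh \<beta>) d w = B"
    unfolding w_def using param_of[of "tanh \<beta>" d B] \<beta> B assms(1) by (auto simp: tanh_real_lt_1)
  interpret a: annealed_optimum \<beta> d w by unfold_locales (use \<beta> assms(1) w in auto)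
  have chi: "a.chi = mag_slope (tanh \<beta>) w / field_slope (tanh \<beta>) d w"
    unfolding a.chi_def a.tanh_\<beta>(3) ..
  show ?thesis
  proof (intro exI conjI)
    show "(\<lambda>n. prob_space.variance (annealed_measure d \<beta> B n) (\<lambda>\<sigma>. total_spin n \<sigma> / sqrt (real n))) \<longlonglongrightarrow> a.chi"
      using a.variance_limit unfolding w(2) .
    show "has_second_derivative (\<lambda>b. pressure d \<beta> b) a.chi B"
      using pressure_second_derivative[OF \<beta> assms(1) B, folded w_def] unfolding chi .
    show "weak_conv_m
      (\<lambda>n. distr (annealed_measure d \<beta> B n) borel
        (\<lambda>\<sigma>. (total_spin n \<sigma> - prob_space.expectation (annealed_measure d \<beta> B n) (total_spin n))
              / sqrt (real n)))
      (centered_gaussian a.chi)"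
      using a.central_limit unfolding w(2) .
  qed
qed

end
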